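(* Let $E$ be a TMIB or a DTMIB on $\mathbb R^n$, let $B$ be a real $n\times n$-matrix, let $\Lambda$ be a lattice in $\mathbb R^n$, and let $U$ be a bounded open neighbourhood of the origin in $\mathbb R^n$ such that the sets $\lambda+U$, $\lambda\in\Lambda$, are pairwise disjoint. For $\chi\in\mathcal D(U)\setminus\{0\}$ let $$E^B_{d,\chi}(\Lambda)=\Big\{c=(c_\lambda)_{\lambda\in\Lambda}\in\mathbb C^\Lambda:\ S_\chi(c):=\sum_{\lambda\in\Lambda}c_\lambda T^B_\lambda\chi\in E\Big\},\qquad\|c\|_{E^B_{d,\chi}(\Lambda)}=\|S_\chi(c)\|_E.$$ Then: (i) $E^B_{d,\chi}(\Lambda)$ is a Banach space. (ii) The space $E^B_{d,\chi}(\Lambda)$ is independent of the choice of $\chi\in\mathcal D(U)\setminus\{0\}$, and different non-zero elements of $\mathcal D(U)$ induce equivalent norms on it.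
   Context: $T_xf(t)=f(t-x)$, $M_\xi f(t)=f(t)e^{2\pi i t\cdot\xi}$ (extended to distributions by duality). A TMIB on $\mathbb R^n$ is a Banach space $E$ such that (1) there are dense continuous inclusions $\mathcal S(\mathbb R^n)\hookrightarrow E\hookrightarrow\mathcal S'(\mathbb R^n)$; (2) $T_x(E)\subseteq E$ and $M_\xi(E)\subseteq E$ for all $x,\xi\in\mathbb R^n$; (3) the operator norms $\|T_x\|_{\mathcal L(E)}$ and $\|M_{-\xi}\|_{\mathcal L(E)}$ are bounded by $C(1+|x|)^{\tau}$, respectively $C(1+|\xi|)^\tau$, for some $C,\tau>0$. A DTMIB is the strong dual of a TMIB, viewed as a subspace of $\mathcal S'(\mathbb R^n)$. The twisted translation is $T^B_xf(t)=f(t-x)e^{-2\pi i Bx\cdot(t-x)}$. A lattice in $\mathbb R^n$ is a discrete subgroup spanning $\mathbb R^n$. $\mathcal D(U)$ is the space of smooth functions with compact support in $U$. The series $S_\chi(c)$ has pairwise disjointly supported terms and defines a distribution on $\mathbb R^n$ for every $c\in\mathbb C^\Lambda$. *)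

theory Defs
  imports "HOL-Analysis.Analysis"
begin

section \<open>Normed and locally convex spaces of complex-valued functions\<close>

text \<open>All vector spaces below are sets of functions \<open>'a \<Rightarrow> complex\<close> with the pointwise
  operations. Distributions are such functions as well, with \<open>'a\<close> the type of test functions. A
  linear functional on a space \<open>V\<close> is extended by 0 outside \<open>V\<close>, so that functionals that agree
  on \<open>V\<close> are equal.\<close>

definition complex_subspace :: "('a \<Rightarrow> complex) set \<Rightarrow> bool" where
  "complex_subspace V \<longleftrightarrow>
     (\<lambda>x. 0) \<in> V \<and>
     (\<forall>u\<in>V. \<forall>v\<in>V. (\<lambda>x. u x + v x) \<in> V) \<and>
     (\<forall>a. \<forall>u\<in>V. (\<lambda>x. a * u x) \<in> V)"

definition norm_on :: "('a \<Rightarrow> complex) set \<Rightarrow> (('a \<Rightarrow> complex) \<Rightarrow> real) \<Rightarrow> bool" where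
  "norm_on V N \<longleftrightarrow>
     (\<forall>u\<in>V. 0 \<le> N u) \<and>
     (\<forall>u\<in>V. N u = 0 \<longleftrightarrow> u = (\<lambda>x. 0)) \<and>
     (\<forall>a. \<forall>u\<in>V. N (\<lambda>x. a * u x) = cmod a * N u) \<and>
     (\<forall>u\<in>V. \<forall>v\<in>V. N (\<lambda>x. u x + v x) \<le> N u + N v)"

text \<open>The value outside \<open>V\<close> is irrelevant; it is fixed because the locale \<open>Metric_space\<close> demands
  nonnegativity and symmetry on the whole type.\<close>

definition norm_dist ::
    "('a \<Rightarrow> complex) set \<Rightarrow> (('a \<Rightarrow> complex) \<Rightarrow> real) \<Rightarrow> ('a \<Rightarrow> complex) \<Rightarrow> ('a \<Rightarrow> complex) \<Rightarrow> real" where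
  "norm_dist V N u v = (if u \<in> V \<and> v \<in> V then N (\<lambda>x. u x - v x) else 0)"

definition norm_topology ::
    "('a \<Rightarrow> complex) set \<Rightarrow> (('a \<Rightarrow> complex) \<Rightarrow> real) \<Rightarrow> ('a \<Rightarrow> complex) topology" where
  "norm_topology V N = Metric_space.mtopology V (norm_dist V N)"

definition complex_banach_space ::
    "('a \<Rightarrow> complex) set \<Rightarrow> (('a \<Rightarrow> complex) \<Rightarrow> real) \<Rightarrow> bool" where
  "complex_banach_space V N \<longleftrightarrow>
     complex_subspace V \<and> norm_on V N \<and> Metric_space.mcomplete V (norm_dist V N)"

definition lc_topology ::
    "('a \<Rightarrow> complex) set \<Rightarrow> (('a \<Rightarrow> complex) \<Rightarrow> real) set \<Rightarrow> ('a \<Rightarrow> complex) topology" where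
  "lc_topology V P = topology (\<lambda>W. W \<subseteq> V \<and>
     (\<forall>u\<in>W. \<exists>F \<epsilon>. finite F \<and> F \<subseteq> P \<and> 0 < \<epsilon> \<and>
        {v \<in> V. \<forall>p\<in>F. p (\<lambda>x. v x - u x) < \<epsilon>} \<subseteq> W))"

lemma openin_lc_topology:
  "openin (lc_topology V P) W \<longleftrightarrow> W \<subseteq> V \<and>
     (\<forall>u\<in>W. \<exists>F \<epsilon>. finite F \<and> F \<subseteq> P \<and> 0 < \<epsilon> \<and>
        {v \<in> V. \<forall>p\<in>F. p (\<lambda>x. v x - u x) < \<epsilon>} \<subseteq> W)"
proof -
  define Op where "Op W \<longleftrightarrow> W \<subseteq> V \<and>
     (\<forall>u\<in>W. \<exists>F \<epsilon>. finite F \<and> F \<subseteq> P \<and> 0 < \<epsilon> \<and>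
        {v \<in> V. \<forall>p\<in>F. p (\<lambda>x. v x - u x) < \<epsilon>} \<subseteq> W)" for W
  have "istopology Op"
    unfolding istopology_def
  proof (intro conjI allI impI)
    fix S T assume S: "Op S" and T: "Op T"
    show "Op (S \<inter> T)"
      unfolding Op_def
    proof (intro conjI ballI)
      show "S \<inter> T \<subseteq> V" using S by (auto simp: Op_def)
      fix u assume u: "u \<in> S \<inter> T"
      obtain F d where F: "finite F" "F \<subseteq> P" "0 < d"
          "{v \<in> V. \<forall>p\<in>F. p (\<lambda>x. v x - u x) < d} \<subseteq> S"
        using S u unfolding Op_def by blast
      obtain G e where G: "finite G" "G \<subseteq> P" "0 < e"
          "{v \<in> V. \<forall>p\<in>G. p (\<lambda>x. v x - u x) < e} \<subseteq> T"
        using T u unfolding Op_def by blast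
      have "{v \<in> V. \<forall>p\<in>F \<union> G. p (\<lambda>x. v x - u x) < min d e} \<subseteq> S \<inter> T"
        using F(4) G(4) by (simp add: subset_iff)
      then show "\<exists>F \<epsilon>. finite F \<and> F \<subseteq> P \<and> 0 < \<epsilon> \<and>
          {v \<in> V. \<forall>p\<in>F. p (\<lambda>x. v x - u x) < \<epsilon>} \<subseteq> S \<inter> T"
        using F(1-3) G(1-3) by (intro exI[of _ "F \<union> G"] exI[of _ "min d e"]) simp
    qed
  next
    fix K assume K: "\<forall>W\<in>K. Op W"
    show "Op (\<Union>K)"
      unfolding Op_def
    proof (intro conjI ballI)
      show "\<Union>K \<subseteq> V" using K by (auto simp: Op_def)
      fix u assume "u \<in> \<Union>K"
      then obtain W where W: "W \<in> K" "u \<in> W" by blast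
      have "Op W" using K W(1) by blast
      then obtain F d where F: "finite F" "F \<subseteq> P" "0 < d"
          "{v \<in> V. \<forall>p\<in>F. p (\<lambda>x. v x - u x) < d} \<subseteq> W"
        using W(2) unfolding Op_def by blast
      from F(4) W(1) have "{v \<in> V. \<forall>p\<in>F. p (\<lambda>x. v x - u x) < d} \<subseteq> \<Union>K"
        by (meson Union_upper subset_trans)
      with F(1-3) show "\<exists>F \<epsilon>. finite F \<and> F \<subseteq> P \<and> 0 < \<epsilon> \<and>
          {v \<in> V. \<forall>p\<in>F. p (\<lambda>x. v x - u x) < \<epsilon>} \<subseteq> \<Union>K"
        by blast
    qed
  qed
  moreover have "lc_topology V P = topology Op"
    unfolding lc_topology_def Op_def by simp
  ultimately have "openin (lc_topology V P) = Op"
    by (simp add: topology_inverse')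
  then show ?thesis
    by (simp add: Op_def)
qed

definition linear_functional ::
    "('a \<Rightarrow> complex) set \<Rightarrow> (('a \<Rightarrow> complex) \<Rightarrow> complex) \<Rightarrow> bool" where
  "linear_functional V L \<longleftrightarrow>
     (\<forall>u\<in>V. \<forall>v\<in>V. L (\<lambda>x. u x + v x) = L u + L v) \<and>
     (\<forall>a. \<forall>u\<in>V. L (\<lambda>x. a * u x) = a * L u) \<and>
     (\<forall>u. u \<notin> V \<longrightarrow> L u = 0)"

definition dual_space ::
    "('a \<Rightarrow> complex) set \<Rightarrow> (('a \<Rightarrow> complex) \<Rightarrow> real) \<Rightarrow> (('a \<Rightarrow> complex) \<Rightarrow> complex) set" where
  "dual_space V N = {L. linear_functional V L \<and> continuous_map (norm_topology V N) euclidean L}"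

definition dual_norm ::
    "('a \<Rightarrow> complex) set \<Rightarrow> (('a \<Rightarrow> complex) \<Rightarrow> real) \<Rightarrow> (('a \<Rightarrow> complex) \<Rightarrow> complex) \<Rightarrow> real" where
  "dual_norm V N L = (SUP u\<in>{u \<in> V. N u \<le> 1}. cmod (L u))"

section \<open>Test functions, Schwartz functions and distributions\<close>

text \<open>\<open>pderivs [i\<^sub>1, \<dots>, i\<^sub>m] f\<close> is the iterated partial derivative
  \<open>\<partial>\<^bsub>i\<^sub>1\<^esub> \<dots> \<partial>\<^bsub>i\<^sub>m\<^esub> f\<close>.\<close>

primrec pderivs :: "'n::finite list \<Rightarrow> (real^'n \<Rightarrow> complex) \<Rightarrow> real^'n \<Rightarrow> complex" where
  "pderivs [] f = f"
| "pderivs (i # js) f = (\<lambda>x. frechet_derivative (pderivs js f) (at x) (axis i 1))"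

definition smooth :: "(real^'n \<Rightarrow> complex) \<Rightarrow> bool" where
  "smooth f \<longleftrightarrow> (\<forall>js x. pderivs js f differentiable (at x))"

definition test_functions :: "(real^'n) set \<Rightarrow> (real^'n \<Rightarrow> complex) set" where
  "test_functions U = {f. smooth f \<and> compact (closure {x. f x \<noteq> 0}) \<and> closure {x. f x \<noteq> 0} \<subseteq> U}"

definition schwartz_space :: "(real^'n \<Rightarrow> complex) set" where
  "schwartz_space = {f. smooth f \<and>
     (\<forall>k js. bounded (range (\<lambda>x. (1 + norm x) ^ k *\<^sub>R pderivs js f x)))}"

definition schwartz_seminorm :: "nat \<Rightarrow> (real^'n \<Rightarrow> complex) \<Rightarrow> real" where
  "schwartz_seminorm k f =
     (SUP (js, x) \<in> {js. length js \<le> k} \<times> UNIV. (1 + norm x) ^ k * cmod (pderivs js f x))"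

definition schwartz_topology :: "(real^'n \<Rightarrow> complex) topology" where
  "schwartz_topology = lc_topology schwartz_space (range schwartz_seminorm)"

text \<open>Tempered distributions are functionals, paired bilinearly with Schwartz functions:
  \<open>u \<phi>\<close> stands for \<open>\<langle>u, \<phi>\<rangle>\<close>.\<close>

definition tempered_distributions :: "((real^'n \<Rightarrow> complex) \<Rightarrow> complex) set" where
  "tempered_distributions =
     {u. linear_functional schwartz_space u \<and> continuous_map schwartz_topology euclidean u}"

definition schwartz_bounded :: "(real^'n \<Rightarrow> complex) set \<Rightarrow> bool" where
  "schwartz_bounded A \<longleftrightarrow> A \<subseteq> schwartz_space \<and> (\<forall>k. bounded (schwartz_seminorm k ` A))"

text \<open>The strong dual topology: uniform convergence on bounded sets. The empty set is left out
  since the supremum of the empty set of reals is unspecified.\<close>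

definition tempered_topology :: "((real^'n \<Rightarrow> complex) \<Rightarrow> complex) topology" where
  "tempered_topology = lc_topology tempered_distributions
     {(\<lambda>u. SUP \<phi>\<in>A. cmod (u \<phi>)) | A. schwartz_bounded A \<and> A \<noteq> {}}"

text \<open>The distribution \<open>\<phi> \<mapsto> \<integral> f \<phi>\<close> on a space \<open>V\<close> of test functions, and the restriction of a
  tempered distribution to a functional on \<open>\<D>(\<real>\<^sup>n)\<close>, by which \<open>\<S>'\<close> is regarded as a subspace of
  \<open>\<D>'\<close>.\<close>

definition regular_distribution ::
    "(real^'n \<Rightarrow> complex) set \<Rightarrow> (real^'n \<Rightarrow> complex) \<Rightarrow> (real^'n \<Rightarrow> complex) \<Rightarrow> complex" where
  "regular_distribution V f = (\<lambda>\<phi>. if \<phi> \<in> V then LINT x|lborel. f x * \<phi> x else 0)"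

definition restrict_to_D ::
    "((real^'n \<Rightarrow> complex) \<Rightarrow> complex) \<Rightarrow> (real^'n \<Rightarrow> complex) \<Rightarrow> complex" where
  "restrict_to_D u = (\<lambda>\<phi>. if \<phi> \<in> test_functions UNIV then u \<phi> else 0)"

abbreviation schwartz_embed :: "(real^'n \<Rightarrow> complex) \<Rightarrow> (real^'n \<Rightarrow> complex) \<Rightarrow> complex" where
  "schwartz_embed \<equiv> regular_distribution schwartz_space"

definition translation :: "real^'n \<Rightarrow> (real^'n \<Rightarrow> complex) \<Rightarrow> real^'n \<Rightarrow> complex" where
  "translation x f = (\<lambda>t. f (t - x))"

definition modulation :: "real^'n \<Rightarrow> (real^'n \<Rightarrow> complex) \<Rightarrow> real^'n \<Rightarrow> complex" where
  "modulation \<xi> f = (\<lambda>t. f t * exp (2 * pi * \<i> * complex_of_real (t \<bullet> \<xi>)))"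

text \<open>The transpose of \<open>T\<^sub>x\<close> is \<open>T\<^bsub>-x\<^esub>\<close>, and \<open>M\<^sub>\<xi>\<close> is its own transpose.\<close>

definition dist_translation ::
    "real^'n \<Rightarrow> ((real^'n \<Rightarrow> complex) \<Rightarrow> complex) \<Rightarrow> (real^'n \<Rightarrow> complex) \<Rightarrow> complex" where
  "dist_translation x u = (\<lambda>\<phi>. u (translation (- x) \<phi>))"

definition dist_modulation ::
    "real^'n \<Rightarrow> ((real^'n \<Rightarrow> complex) \<Rightarrow> complex) \<Rightarrow> (real^'n \<Rightarrow> complex) \<Rightarrow> complex" where
  "dist_modulation \<xi> u = (\<lambda>\<phi>. u (modulation \<xi> \<phi>))"

section \<open>Translation-modulation invariant Banach spaces of distributions\<close>

definition TMIB ::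
    "((real^'n \<Rightarrow> complex) \<Rightarrow> complex) set \<Rightarrow> (((real^'n \<Rightarrow> complex) \<Rightarrow> complex) \<Rightarrow> real) \<Rightarrow> bool" where
  "TMIB E N \<longleftrightarrow>
     complex_banach_space E N \<and>
     schwartz_embed ` schwartz_space \<subseteq> E \<and>
     continuous_map schwartz_topology (norm_topology E N) schwartz_embed \<and>
     norm_topology E N closure_of (schwartz_embed ` schwartz_space) = E \<and>
     E \<subseteq> tempered_distributions \<and>
     continuous_map (norm_topology E N) tempered_topology (\<lambda>u. u) \<and>
     tempered_topology closure_of E = tempered_distributions \<and>
     (\<forall>x. dist_translation x ` E \<subseteq> E) \<and>
     (\<forall>\<xi>. dist_modulation \<xi> ` E \<subseteq> E) \<and>
     (\<exists>C>0. \<exists>\<tau>>0.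
        (\<forall>x. \<forall>u\<in>E. N (dist_translation x u) \<le> C * (1 + norm x) powr \<tau> * N u) \<and>
        (\<forall>\<xi>. \<forall>u\<in>E. N (dist_modulation (- \<xi>) u) \<le> C * (1 + norm \<xi>) powr \<tau> * N u))"

text \<open>An element \<open>L\<close> of the dual of \<open>E\<close> is viewed as the tempered distribution \<open>\<phi> \<mapsto> L \<phi>\<close>;
  this is injective since \<open>\<S>\<close> is dense in \<open>E\<close>.\<close>

definition dual_embed ::
    "(((real^'n \<Rightarrow> complex) \<Rightarrow> complex) \<Rightarrow> complex) \<Rightarrow> (real^'n \<Rightarrow> complex) \<Rightarrow> complex" where
  "dual_embed L = (\<lambda>\<phi>. if \<phi> \<in> schwartz_space then L (schwartz_embed \<phi>) else 0)"

definition DTMIB ::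
    "((real^'n \<Rightarrow> complex) \<Rightarrow> complex) set \<Rightarrow> (((real^'n \<Rightarrow> complex) \<Rightarrow> complex) \<Rightarrow> real) \<Rightarrow> bool" where
  "DTMIB E N \<longleftrightarrow> (\<exists>E\<^sub>0 N\<^sub>0. TMIB E\<^sub>0 N\<^sub>0 \<and>
     E = dual_embed ` dual_space E\<^sub>0 N\<^sub>0 \<and>
     (\<forall>L\<in>dual_space E\<^sub>0 N\<^sub>0. N (dual_embed L) = dual_norm E\<^sub>0 N\<^sub>0 L))"

section \<open>The discrete spaces\<close>

definition euclidean_lattice :: "(real^'n) set \<Rightarrow> bool" where
  "euclidean_lattice \<Lambda> \<longleftrightarrow>
     0 \<in> \<Lambda> \<and> (\<forall>x\<in>\<Lambda>. \<forall>y\<in>\<Lambda>. x + y \<in> \<Lambda>) \<and> (\<forall>x\<in>\<Lambda>. - x \<in> \<Lambda>) \<and>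
     discrete \<Lambda> \<and> span \<Lambda> = UNIV"

definition twisted_translation ::
    "real^'n^'n \<Rightarrow> real^'n \<Rightarrow> (real^'n \<Rightarrow> complex) \<Rightarrow> real^'n \<Rightarrow> complex" where
  "twisted_translation B x f =
     (\<lambda>t. f (t - x) * exp (- (2 * pi * \<i> * complex_of_real ((B *v x) \<bullet> (t - x)))))"

text \<open>\<open>S\<^sub>\<chi>(c)\<close>, as a functional on \<open>\<D>(\<real>\<^sup>n)\<close>. The terms of the series have disjoint supports in the
  situation of interest, so that at each point \<open>t\<close> at most one of them is non-zero.\<close>

definition synthesis ::
    "real^'n^'n \<Rightarrow> (real^'n) set \<Rightarrow> (real^'n \<Rightarrow> complex) \<Rightarrow> (real^'n \<Rightarrow> complex)
      \<Rightarrow> (real^'n \<Rightarrow> complex) \<Rightarrow> complex" where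
  "synthesis B \<Lambda> chi c = regular_distribution (test_functions UNIV)
     (\<lambda>t. \<Sum>\<^sub>\<infinity>l\<in>\<Lambda>. c l * twisted_translation B l chi t)"

text \<open>Families \<open>c \<in> \<complex>\<^sup>\<Lambda>\<close> are functions on \<open>\<real>\<^sup>n\<close> that vanish outside \<open>\<Lambda>\<close>.\<close>

definition discrete_space ::
    "((real^'n \<Rightarrow> complex) \<Rightarrow> complex) set \<Rightarrow> real^'n^'n \<Rightarrow> (real^'n) set \<Rightarrow> (real^'n \<Rightarrow> complex)
      \<Rightarrow> (real^'n \<Rightarrow> complex) set" where
  "discrete_space E B \<Lambda> chi =
     {c. (\<forall>x. x \<notin> \<Lambda> \<longrightarrow> c x = 0) \<and> synthesis B \<Lambda> chi c \<in> restrict_to_D ` E}"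

text \<open>The element of \<open>E\<close> that restricts to \<open>S\<^sub>\<chi>(c)\<close> is unique because \<open>\<D>(\<real>\<^sup>n)\<close> is dense in \<open>\<S>\<close>.\<close>

definition discrete_norm ::
    "((real^'n \<Rightarrow> complex) \<Rightarrow> complex) set \<Rightarrow> (((real^'n \<Rightarrow> complex) \<Rightarrow> complex) \<Rightarrow> real)
      \<Rightarrow> real^'n^'n \<Rightarrow> (real^'n) set \<Rightarrow> (real^'n \<Rightarrow> complex) \<Rightarrow> (real^'n \<Rightarrow> complex) \<Rightarrow> real" where
  "discrete_norm E N B \<Lambda> chi c = N (the_inv_into E restrict_to_D (synthesis B \<Lambda> chi c))"

end

theory Submission
  imports Defs
begin

text \<open>
  Fix \<open>\<theta> \<in> \<D>(U)\<close> with \<open>\<integral> \<chi> \<theta> = 1\<close>. Since the translates of \<open>U\<close> are disjoint, the coefficients of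
  \<open>f = S\<^sub>\<chi>(c)\<close> are recovered as \<open>c\<^sub>\<lambda> = \<langle>f, T\<^bsup>-B\<^esup>\<^sub>\<lambda> \<theta>\<rangle>\<close>, which makes limits in \<open>E\<close> pass to the coefficients and
  gives completeness. Moreover \<open>S\<^sub>\<psi>(c) = P f\<close> for the operator \<open>P f = \<Sum>\<^sub>\<lambda> \<langle>f, T\<^bsup>-B\<^esup>\<^sub>\<lambda> \<theta>\<rangle> T\<^bsup>B\<^esup>\<^sub>\<lambda> \<psi>\<close>, so the
  independence of the window is the boundedness of \<open>P\<close> on \<open>E\<close>.

  On test functions \<open>P \<phi>\<close> is an integral over a compact set of \<open>x\<close> of functions \<open>p\<^sub>x M\<^sub>\<xi> T\<^sub>x \<phi>\<close>, where
  \<open>\<xi> = - B\<^sup>t x\<close> and \<open>p\<^sub>x\<close> is smooth and \<open>\<Lambda>\<close>-periodic. Multiplication by \<open>p\<^sub>x\<close> is bounded since its Fourier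
  coefficients decay rapidly while the modulations grow polynomially; the integral is bounded by
  approximating it with Riemann sums in the Schwartz topology. It suffices to expand with respect to the sublattice spanned by a
  basis of \<open>\<real>\<^sup>n\<close> contained in \<open>\<Lambda>\<close>, so no structure theorem for lattices is needed. For a TMIB, \<open>P\<close> extends from the
  dense subspace of test functions; for its dual one transposes, because the transpose of \<open>P\<close> has the
  same form with \<open>B\<close>, \<open>\<theta>\<close>, \<open>\<psi>\<close> replaced by \<open>-B\<close>, \<open>\<psi>\<close>, \<open>\<theta>\<close>.
\<close>

section \<open>Smooth families of functions\<close>

text \<open>The norm of \<open>E\<close> is known only through its growth under translations and
  modulations and through its continuity for the Schwartz topology; it need not be monotone in the
  modulus, and the series defining \<open>synthesis\<close> need not converge in \<open>E\<close>.
  So no estimate can be made term by term over the lattice. All analysis is done for the seminorm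
  \<open>q f = N (schwartz_embed f)\<close> on test functions, where one bound for
  \<open>frame_operator\<close> has to be found. It comes from the phases: in the
  \<open>l\<close>-th summand, with \<open>s = t - x\<close>, those of the coefficient (matrix
  \<open>-B\<close>) and of the atom (matrix \<open>B\<close>) combine to a character linear in
  \<open>l\<close>. All summands then share one modulation in \<open>t\<close>, and what remains
  depends on \<open>t - l\<close> only, hence is periodic. Elements of \<open>E\<close> that are not
  functions are reached through the pairing alone: an extended operator is described by
  \<open>v f = u (P f)\<close> with \<open>P\<close> acting on test functions, which is also the
  form that suits the dual space.\<close>

abbreviation partial :: "'n \<Rightarrow> (real^'n \<Rightarrow> complex) \<Rightarrow> real^'n \<Rightarrow> complex" where
  "partial i f \<equiv> (\<lambda>t. frechet_derivative f (at t) (axis i 1))"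

lemma pderivs_append: "pderivs (js @ ks) f = pderivs js (pderivs ks f)"
  by (induction js) auto

text \<open>Only \<open>t\<close> is differentiated; in the parameter \<open>p\<close> joint
  continuity of all derivatives is kept. That is what differentiation under an integral over
  \<open>p\<close> and uniform continuity on compact sets require, and it admits phases such as
  \<open>wave (g p)\<close> with \<open>g\<close> merely continuous. Counting the order makes
  closure under products an induction on \<open>k\<close>.\<close>

primrec Ck_family :: "nat \<Rightarrow> ('p::topological_space \<Rightarrow> real^'n \<Rightarrow> complex) \<Rightarrow> bool" where
  "Ck_family 0 F \<longleftrightarrow> continuous_on UNIV (\<lambda>(p, t). F p t)"
| "Ck_family (Suc k) F \<longleftrightarrow> continuous_on UNIV (\<lambda>(p, t). F p t) \<and>
     (\<forall>p t. F p differentiable (at t)) \<and> (\<forall>i. Ck_family k (\<lambda>p. partial i (F p)))"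

definition smooth_family :: "('p::topological_space \<Rightarrow> real^'n \<Rightarrow> complex) \<Rightarrow> bool" where
  "smooth_family F \<longleftrightarrow> (\<forall>k. Ck_family k F)"

lemma Ck_family_continuous: "Ck_family k F \<Longrightarrow> continuous_on UNIV (\<lambda>(p, t). F p t)"
  by (cases k) auto

lemma Ck_family_SucD: "Ck_family (Suc k) F \<Longrightarrow> Ck_family k F"
  by (induction k arbitrary: F) auto

lemma continuous_family_slice:
  assumes "continuous_on UNIV (\<lambda>(p, t). F p t)"
  shows "continuous_on UNIV (F p)" "continuous_on UNIV (\<lambda>p. F p t)"
proof -
  have "continuous_on UNIV ((\<lambda>(p, t). F p t) \<circ> Pair p)"
    by (intro continuous_on_compose continuous_intros continuous_on_subset[OF assms]) auto
  then show "continuous_on UNIV (F p)" by (simp add: o_def)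
  have "continuous_on UNIV ((\<lambda>(p, t). F p t) \<circ> (\<lambda>p. (p, t)))"
    by (intro continuous_on_compose continuous_intros continuous_on_subset[OF assms]) auto
  then show "continuous_on UNIV (\<lambda>p. F p t)" by (simp add: o_def)
qed

lemma smooth_family_partial: "smooth_family F \<Longrightarrow> smooth_family (\<lambda>p. partial i (F p))"
  unfolding smooth_family_def by (metis Ck_family.simps(2))

lemma smooth_family_pderivs: "smooth_family F \<Longrightarrow> smooth_family (\<lambda>p. pderivs js (F p))"
  by (induction js) (auto intro: smooth_family_partial)

lemma smooth_family_differentiable: "smooth_family F \<Longrightarrow> F p differentiable (at t)"
  unfolding smooth_family_def by (metis Ck_family.simps(2))

lemma smooth_family_continuous: "smooth_family F \<Longrightarrow> continuous_on UNIV (\<lambda>(p, t). F p t)"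
  unfolding smooth_family_def using Ck_family_continuous by blast

lemma smooth_family_imp_smooth: "smooth_family F \<Longrightarrow> smooth (F p)"
  unfolding smooth_def by (intro allI smooth_family_differentiable[OF smooth_family_pderivs])

lemma smooth_partial: "smooth f \<Longrightarrow> smooth (partial i f)"
  unfolding smooth_def
proof (intro allI)
  fix js t assume "\<forall>js t. pderivs js f differentiable (at t)"
  then have "pderivs (js @ [i]) f differentiable (at t)" by blast
  then show "pderivs js (partial i f) differentiable (at t)" by (simp only: pderivs_append pderivs.simps)
qed

lemma smooth_differentiable: "smooth f \<Longrightarrow> f differentiable (at t)"
  unfolding smooth_def by (metis pderivs.simps(1))

lemma smooth_continuous: "smooth f \<Longrightarrow> continuous_on UNIV f"
  by (intro continuous_at_imp_continuous_on ballI differentiable_imp_continuous_within smooth_differentiable)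

lemma smooth_imp_smooth_family:
  assumes "smooth f" shows "smooth_family (\<lambda>_. f)"
proof -
  have cont: "continuous_on UNIV (\<lambda>(p::'b, t). g t)" if "smooth g" for g :: "real^'a \<Rightarrow> complex"
    unfolding case_prod_unfold
    by (rule continuous_on_compose2[OF smooth_continuous[OF that]]) (auto intro!: continuous_intros)
  have "Ck_family k (\<lambda>_::'b. f)" for k
    using assms
  proof (induction k arbitrary: f)
    case 0 then show ?case using cont by simp
  next
    case (Suc k)
    have "f differentiable (at t)" for t
      by (rule smooth_differentiable[OF Suc.prems])
    moreover have "\<forall>i. Ck_family k (\<lambda>_::'b. partial i f)"
      by (intro allI Suc.IH smooth_partial Suc.prems)
    ultimately show ?case unfolding Ck_family.simps using cont[OF Suc.prems] by blast
  qed
  then show ?thesis by (simp add: smooth_family_def)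
qed

text \<open>Single functions are constant families, so the closure rules for families yield those
  for \<open>smooth\<close>. The parameter type \<open>real\<close> is an arbitrary choice.\<close>

lemma smooth_iff_family: "smooth f \<longleftrightarrow> smooth_family (\<lambda>_::real. f)"
  using smooth_imp_smooth_family smooth_family_imp_smooth by blast

lemma smooth_pderivs: "smooth f \<Longrightarrow> smooth (pderivs js f)"
  by (induction js) (auto intro: smooth_partial)

lemma smooth_pderivs_continuous: "smooth f \<Longrightarrow> continuous_on UNIV (pderivs js f)"
  by (simp add: smooth_continuous smooth_pderivs)

lemma partial_unique:
  "(f has_derivative f') (at t) \<Longrightarrow> partial i f t = f' (axis i 1)"
  by (metis frechet_derivative_at)

lemma differentiable_has_derivative: "f differentiable (at t) \<Longrightarrow> (f has_derivative frechet_derivative f (at t)) (at t)"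
  by (simp add: frechet_derivative_works)

lemma partial_add:
  assumes "f differentiable (at t)" "g differentiable (at t)"
  shows "partial i (\<lambda>t. f t + g t) t = partial i f t + partial i g t"
  by (rule partial_unique[OF has_derivative_add[OF differentiable_has_derivative[OF assms(1)] differentiable_has_derivative[OF assms(2)]]])

lemma partial_mult:
  assumes "f differentiable (at t)" "g differentiable (at t)"
  shows "partial i (\<lambda>t. f t * g t) t = f t * partial i g t + partial i f t * g t"
  by (rule partial_unique[OF has_derivative_mult[OF differentiable_has_derivative[OF assms(1)] differentiable_has_derivative[OF assms(2)]]])

lemma partial_cmult:
  assumes "f differentiable (at t)"
  shows "partial i (\<lambda>t. c * f t) t = c * partial i f t"
  by (rule partial_unique[OF has_derivative_mult_right[OF differentiable_has_derivative[OF assms]]])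

lemma continuous_family_comb:
  assumes "continuous_on UNIV (\<lambda>(p, t). F p t)" "continuous_on UNIV (\<lambda>(p, t). G p t)"
  shows "continuous_on UNIV (\<lambda>(p, t). F p t + G p t :: complex)"
    "continuous_on UNIV (\<lambda>(p, t). F p t * G p t :: complex)"
  using continuous_on_add[OF assms] continuous_on_mult[OF assms] by (simp_all add: case_prod_unfold)

lemma Ck_family_add:
  assumes "Ck_family k F" "Ck_family k G"
  shows "Ck_family k (\<lambda>p t. F p t + G p t)"
  using assms
proof (induction k arbitrary: F G)
  case 0 then show ?case by (simp add: continuous_family_comb)
next
  case (Suc k)
  have "Ck_family k (\<lambda>p t. partial i (F p) t + partial i (G p) t)" for i
    using Suc.prems by (intro Suc.IH) auto
  then show ?case using Suc.prems
    by (simp add: continuous_family_comb partial_add)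
qed

lemma Ck_family_mult:
  assumes "Ck_family k F" "Ck_family k G"
  shows "Ck_family k (\<lambda>p t. F p t * G p t)"
  using assms
proof (induction k arbitrary: F G)
  case 0 then show ?case by (simp add: continuous_family_comb)
next
  case (Suc k)
  \<comment> \<open>The product rule pairs a factor of order \<open>Suc k\<close> with a derivative
    of order \<open>k\<close>; the former is downgraded by \<open>Ck_family_SucD\<close>.\<close>
  have "Ck_family k (\<lambda>p t. F p t * partial i (G p) t + partial i (F p) t * G p t)" for i
    using Suc.prems by (intro Suc.IH Ck_family_add) (auto intro: Ck_family_SucD)
  then show ?case using Suc.prems
    by (simp add: continuous_family_comb partial_mult)
qed

lemma smooth_family_add: "smooth_family F \<Longrightarrow> smooth_family G \<Longrightarrow> smooth_family (\<lambda>p t. F p t + G p t)"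
  and smooth_family_mult: "smooth_family F \<Longrightarrow> smooth_family G \<Longrightarrow> smooth_family (\<lambda>p t. F p t * G p t)"
  unfolding smooth_family_def using Ck_family_add Ck_family_mult by blast+

lemma partial_const [simp]: "partial i (\<lambda>t. c) = (\<lambda>t. 0)"
  by (rule ext, rule partial_unique) (rule has_derivative_const)

lemma smooth_family_scalar:
  assumes "continuous_on UNIV (c :: 'p::topological_space \<Rightarrow> complex)"
  shows "smooth_family (\<lambda>p (t::real^'n). c p)"
proof -
  have "continuous_on UNIV (\<lambda>(p, t::real^'n). c p)" if "continuous_on UNIV c" for c :: "'p \<Rightarrow> complex"
    unfolding case_prod_unfold
    by (rule continuous_on_compose2[OF that]) (auto intro!: continuous_intros)
  then have "Ck_family k (\<lambda>p (t::real^'n). c p)" if "continuous_on UNIV c" for k and c :: "'p \<Rightarrow> complex"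
    using that by (induction k arbitrary: c) simp_all
  with assms show ?thesis by (simp add: smooth_family_def)
qed

lemma partial_shift:
  assumes "f differentiable (at (t - a))"
  shows "partial i (\<lambda>t. f (t - a)) t = partial i f (t - a)"
proof -
  have "((\<lambda>t. f (t - a)) has_derivative frechet_derivative f (at (t - a))) (at t)"
    using has_derivative_compose[of "\<lambda>t. t - a" "\<lambda>h. h" t UNIV f] differentiable_has_derivative[OF assms]
      has_derivative_diff[OF has_derivative_ident has_derivative_const, of a] by simp
  then show ?thesis by (rule partial_unique)
qed

lemma differentiable_shift:
  assumes "f differentiable (at (t - a))"
  shows "(\<lambda>t. f (t - a)) differentiable (at t)"
  using differentiable_chain_at[of "\<lambda>t. t - a" t f] assms by (simp add: o_def)

lemma smooth_family_shift:
  fixes f :: "real^'n \<Rightarrow> complex" and g :: "'p::topological_space \<Rightarrow> real^'n"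
  assumes "smooth f" "continuous_on UNIV g"
  shows "smooth_family (\<lambda>p t. f (t - g p))"
proof -
  have g: "continuous_on UNIV (\<lambda>x :: 'p \<times> (real^'n). g (fst x))"
    by (rule continuous_on_compose2[OF assms(2)]) (auto intro: continuous_on_fst continuous_on_id)
  have cont: "continuous_on UNIV (\<lambda>(p, t). f (t - g p))" if "smooth f" for f :: "real^'n \<Rightarrow> complex"
    unfolding case_prod_unfold
    by (rule continuous_on_compose2[OF smooth_continuous[OF that]])
      (auto intro!: continuous_on_diff continuous_on_snd continuous_on_id g)
  have "Ck_family k (\<lambda>p t. f (t - g p))" for k
    using assms(1)
  proof (induction k arbitrary: f)
    case 0 then show ?case using cont by simp
  next
    case (Suc k)
    have "Ck_family k (\<lambda>p t. partial i f (t - g p))" for i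
      using Suc.prems by (intro Suc.IH smooth_partial)
    then show ?case using cont[OF Suc.prems] smooth_differentiable[OF Suc.prems]
      by (simp add: partial_shift differentiable_shift)
  qed
  then show ?thesis by (simp add: smooth_family_def)
qed

lemma smooth_shift: "smooth f \<Longrightarrow> smooth (\<lambda>t. f (t - a))"
  using smooth_family_imp_smooth[OF smooth_family_shift[of f "\<lambda>_::real. a"]] by simp

lemma pderivs_shift:
  assumes "smooth f"
  shows "pderivs js (\<lambda>t. f (t - a)) = (\<lambda>t. pderivs js f (t - a))"
  by (induction js) (auto simp: partial_shift smooth_differentiable[OF smooth_pderivs[OF assms]])

section \<open>Characters, and smooth functions built from them\<close>

definition wave :: "real^'n \<Rightarrow> real^'n \<Rightarrow> complex" where
  "wave \<xi> t = exp (2 * pi * \<i> * complex_of_real (t \<bullet> \<xi>))"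

lemma wave_has_derivative:
  "(wave \<xi> has_derivative (\<lambda>h. 2 * pi * \<i> * complex_of_real (h \<bullet> \<xi>) * wave \<xi> t)) (at t)"
proof -
  have "((\<lambda>t. 2 * pi * \<i> * complex_of_real (t \<bullet> \<xi>)) has_derivative
      (\<lambda>h. 2 * pi * \<i> * complex_of_real (h \<bullet> \<xi>))) (at t)"
    by (intro bounded_linear_imp_has_derivative bounded_linear_mult_const[of "\<lambda>t. complex_of_real (t \<bullet> \<xi>)"]
      bounded_linear_const_mult bounded_linear_compose[OF bounded_linear_of_real] bounded_linear_inner_left)
  from has_derivative_compose[OF this DERIV_exp[unfolded has_field_derivative_def]]
  show ?thesis
    unfolding wave_def by (simp add: mult_ac)
qed

lemma partial_wave: "partial i (wave \<xi>) t = 2 * pi * \<i> * complex_of_real (\<xi> $ i) * wave \<xi> t"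
  using partial_unique[OF wave_has_derivative[of \<xi> t], of i] by (simp add: inner_axis' )

lemma wave_add: "wave \<xi> (s + t) = wave \<xi> s * wave \<xi> t"
  and wave_freq_add: "wave (\<xi> + \<eta>) t = wave \<xi> t * wave \<eta> t"
  by (simp_all add: wave_def inner_simps distrib_left flip: exp_add)

lemma norm_wave [simp]: "cmod (wave \<xi> t) = 1"
  by (simp add: wave_def mult.assoc norm_exp_i_times flip: of_real_mult)

lemma smooth_family_wave:
  fixes g :: "'p::topological_space \<Rightarrow> real^'n"
  assumes "continuous_on UNIV g"
  shows "smooth_family (\<lambda>p. wave (g p))"
proof -
  have cont: "continuous_on UNIV (\<lambda>(p, t). wave (g p) t)"
    unfolding case_prod_unfold wave_def
    by (intro continuous_on_exp continuous_on_mult continuous_on_of_real continuous_on_inner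
      continuous_on_snd continuous_on_id continuous_on_const continuous_on_compose2[OF assms continuous_on_fst[OF continuous_on_id]]) simp
  have "Ck_family k (\<lambda>p. wave (g p))" for k
  proof (induction k)
    case 0 then show ?case using cont by simp
  next
    case (Suc k)
    have "smooth_family (\<lambda>p (t::real^'n). 2 * pi * \<i> * complex_of_real (g p $ i))" for i
      by (intro smooth_family_scalar continuous_intros continuous_on_component assms)
    then have "Ck_family k (\<lambda>p t. 2 * pi * \<i> * complex_of_real (g p $ i) * wave (g p) t)" for i
      using Suc Ck_family_mult[of k "\<lambda>p t. 2 * pi * \<i> * complex_of_real (g p $ i)" "\<lambda>p. wave (g p)"]
      by (simp add: smooth_family_def)
    moreover have "wave (g p) differentiable (at t)" for p t
      using wave_has_derivative differentiable_def by blast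
    ultimately show ?case using cont by (simp add: partial_wave)
  qed
  then show ?thesis by (simp add: smooth_family_def)
qed

lemma smooth_wave: "smooth (wave \<xi>)"
  using smooth_family_imp_smooth[OF smooth_family_wave[of "\<lambda>_::real. \<xi>"]] by simp

lemma smooth_add: "smooth f \<Longrightarrow> smooth g \<Longrightarrow> smooth (\<lambda>t. f t + g t)"
  and smooth_mult: "smooth f \<Longrightarrow> smooth g \<Longrightarrow> smooth (\<lambda>t. f t * g t)"
  by (simp_all add: smooth_iff_family smooth_family_add smooth_family_mult)

lemma smooth_const: "smooth (\<lambda>t. c)"
  using smooth_family_imp_smooth[OF smooth_family_scalar[of "\<lambda>_::real. c"]] by simp

text \<open>Conjugation is only real-linear, so it is no instance of \<open>smooth_cmult\<close>; as
  a bounded real-linear map it still commutes with every partial derivative.\<close>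

lemma smooth_cnj:
  assumes "smooth f" shows "smooth (\<lambda>t. cnj (f t))"
proof -
  have d: "((\<lambda>t. cnj (g t)) has_derivative (\<lambda>h. cnj (frechet_derivative g (at t) h))) (at t)"
    if "g differentiable (at t)" for g :: "real^'a \<Rightarrow> complex" and t
    using bounded_linear.has_derivative[OF bounded_linear_cnj differentiable_has_derivative[OF that]] .
  have eq: "pderivs js (\<lambda>t. cnj (f t)) = (\<lambda>t. cnj (pderivs js f t))" for js
    by (induction js) (auto simp: partial_unique[OF d] smooth_differentiable[OF smooth_pderivs[OF assms]])
  show ?thesis
    unfolding smooth_def eq using d smooth_differentiable[OF smooth_pderivs[OF assms]]
      differentiable_def by blast
qed

section \<open>Linearity, locality and product estimates for iterated derivatives\<close>

lemma pderivs_add: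
  assumes "smooth f" "smooth g"
  shows "pderivs js (\<lambda>t. f t + g t) = (\<lambda>t. pderivs js f t + pderivs js g t)"
  by (induction js) (auto simp: partial_add smooth_differentiable[OF smooth_pderivs] assms)

lemma pderivs_cmult:
  assumes "smooth f"
  shows "pderivs js (\<lambda>t. c * f t) = (\<lambda>t. c * pderivs js f t)"
  by (induction js) (auto simp: partial_cmult smooth_differentiable[OF smooth_pderivs] assms)

lemma smooth_cmult: "smooth f \<Longrightarrow> smooth (\<lambda>t. c * f t)"
  by (intro smooth_mult smooth_const)

lemma smooth_diff: "smooth f \<Longrightarrow> smooth g \<Longrightarrow> smooth (\<lambda>t. f t - g t)"
  using smooth_add[OF _ smooth_cmult[of g "-1"], of f] by simp

lemma pderivs_diff:
  assumes "smooth f" "smooth g"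
  shows "pderivs js (\<lambda>t. f t - g t) = (\<lambda>t. pderivs js f t - pderivs js g t)"
  using pderivs_add[OF assms(1) smooth_cmult[OF assms(2), of "-1"], of js]
    pderivs_cmult[OF assms(2), of js "-1"] by simp

lemma pderivs_zero [simp]: "pderivs js (\<lambda>t. 0) = (\<lambda>t. 0)"
  by (induction js) auto

lemma smooth_sum:
  "(\<And>a. a \<in> A \<Longrightarrow> smooth (f a)) \<Longrightarrow> smooth (\<lambda>t. \<Sum>a\<in>A. f a t)"
  by (induction A rule: infinite_finite_induct) (auto intro: smooth_const smooth_add)

lemma pderivs_sum:
  "(\<And>a. a \<in> A \<Longrightarrow> smooth (f a)) \<Longrightarrow>
    pderivs js (\<lambda>t. \<Sum>a\<in>A. f a t) = (\<lambda>t. \<Sum>a\<in>A. pderivs js (f a) t)"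
  by (induction A rule: infinite_finite_induct) (auto simp: pderivs_add smooth_sum)

lemma partial_cong_open:
  assumes "open S" "t \<in> S" "\<And>s. s \<in> S \<Longrightarrow> f s = g s" "f differentiable (at t)"
  shows "partial i f t = partial i g t" "g differentiable (at t)"
proof -
  have "(g has_derivative frechet_derivative f (at t)) (at t)"
    by (rule has_derivative_transform_within_open[OF differentiable_has_derivative[OF assms(4)] assms(1,2)]) (simp add: assms(3))
  then show "partial i f t = partial i g t" "g differentiable (at t)"
    using partial_unique differentiable_def by (fastforce, blast)
qed

text \<open>\<open>g\<close> is not assumed smooth: on \<open>S\<close> its derivatives are
  inherited from \<open>f\<close>. In this way functions given by different formulas on different
  open sets, such as \<open>periodization\<close>, are shown to be smooth.\<close>

lemma pderivs_cong_open:
  assumes "open S" "\<And>s. s \<in> S \<Longrightarrow> f s = g s" "smooth f"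
  shows "t \<in> S \<Longrightarrow> pderivs js f t = pderivs js g t"
    and "t \<in> S \<Longrightarrow> pderivs js g differentiable (at t)"
proof -
  have *: "\<forall>t\<in>S. pderivs js f t = pderivs js g t"
  proof (induction js)
    case Nil then show ?case using assms by simp
  next
    case (Cons i js)
    then show ?case
      using partial_cong_open(1)[OF assms(1)] smooth_differentiable[OF smooth_pderivs[OF assms(3)]] by simp
  qed
  show "t \<in> S \<Longrightarrow> pderivs js f t = pderivs js g t" using * by blast
  show "t \<in> S \<Longrightarrow> pderivs js g differentiable (at t)"
    using partial_cong_open(2)[OF assms(1)] * smooth_differentiable[OF smooth_pderivs[OF assms(3)]] by blast
qed

text \<open>Each differentiation doubles the number of terms of the product rule, whence
  \<open>2 ^ length js\<close>. The induction removes the last index, which is the derivative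
  applied first, so that the product rule acts before the remaining derivatives.\<close>

lemma pderivs_mult_bound:
  assumes "smooth f" "smooth g"
    and "\<And>ks. length ks \<le> length js \<Longrightarrow> cmod (pderivs ks f x) \<le> M"
    and "\<And>ks. length ks \<le> length js \<Longrightarrow> cmod (pderivs ks g x) \<le> L"
  shows "cmod (pderivs js (\<lambda>t. f t * g t) x) \<le> 2 ^ length js * M * L"
  using assms
proof (induction js arbitrary: f g rule: rev_induct)
  case Nil
  have "0 \<le> M" using Nil(3)[of "[]"] order_trans[OF norm_ge_zero] by fastforce
  then show ?case using Nil(3)[of "[]"] Nil(4)[of "[]"] by (simp add: norm_mult mult_mono)
next
  case (snoc i js)
  note f = snoc.prems(1) and g = snoc.prems(2)
  note bf = snoc.prems(3) and bg = snoc.prems(4)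
  have b: "cmod (pderivs ks (partial i f) x) \<le> M" "cmod (pderivs ks (partial i g) x) \<le> L"
      "cmod (pderivs ks f x) \<le> M" "cmod (pderivs ks g x) \<le> L"
    if "length ks \<le> length js" for ks
    using bf[of "ks @ [i]"] bg[of "ks @ [i]"] bf[of ks] bg[of ks] that by (simp_all add: pderivs_append)
  have "partial i (\<lambda>t. f t * g t) = (\<lambda>t. f t * partial i g t + partial i f t * g t)"
    using f g by (auto simp: partial_mult smooth_differentiable)
  then have "pderivs (js @ [i]) (\<lambda>t. f t * g t) x =
      pderivs js (\<lambda>t. f t * partial i g t) x + pderivs js (\<lambda>t. partial i f t * g t) x"
    using f g by (simp add: pderivs_append pderivs_add smooth_mult smooth_partial)
  moreover have "cmod (pderivs js (\<lambda>t. f t * partial i g t) x) \<le> 2 ^ length js * M * L"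
    using b f g by (intro snoc.IH smooth_partial) auto
  moreover have "cmod (pderivs js (\<lambda>t. partial i f t * g t) x) \<le> 2 ^ length js * M * L"
    using b f g by (intro snoc.IH smooth_partial) auto
  ultimately show ?case
    using norm_triangle_ineq[of "pderivs js (\<lambda>t. f t * partial i g t) x" "pderivs js (\<lambda>t. partial i f t * g t) x"]
    by (simp add: mult.assoc)
qed

section \<open>Differentiation under the integral sign\<close>

lemma integral_family_partial:
  fixes F :: "'s::euclidean_space \<Rightarrow> real^'n \<Rightarrow> complex"
  assumes "smooth_family F"
  shows "(\<lambda>t. integral (cbox a b) (\<lambda>s. F s t)) differentiable (at t)"
    and "partial i (\<lambda>t. integral (cbox a b) (\<lambda>s. F s t)) t = integral (cbox a b) (\<lambda>s. partial i (F s) t)"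
proof -
  define D where "D t s = Blinfun (frechet_derivative (F s) (at t))" for t s
  have der: "(F s has_derivative frechet_derivative (F s) (at t)) (at t)" for s t
    using differentiable_has_derivative smooth_family_differentiable[OF assms] by blast
  then have D: "blinfun_apply (D t s) = frechet_derivative (F s) (at t)" for t s
    unfolding D_def by (intro bounded_linear_Blinfun_apply) (rule has_derivative_bounded_linear)
  have swap: "continuous_on UNIV (\<lambda>(t, s). G s t)" if "continuous_on UNIV (\<lambda>(s, t). G s t)"
    for G :: "'s \<Rightarrow> real^'n \<Rightarrow> complex"
  proof -
    have "continuous_on UNIV ((\<lambda>(s, t). G s t) \<circ> (\<lambda>(t, s). (s, t)))"
      unfolding case_prod_unfold
      by (intro continuous_on_compose continuous_intros continuous_on_subset[OF that[unfolded case_prod_unfold]]) auto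
    then show ?thesis by (simp add: o_def case_prod_unfold)
  qed
  \<comment> \<open>The Leibniz rule asks for the whole derivative as a jointly continuous
    operator-valued map. In finite dimension this can be checked on basis vectors, that is, on the
    partial derivatives, whose joint continuity is part of \<open>smooth_family\<close>.\<close>
  have contD: "continuous_on (UNIV \<times> cbox a b) (\<lambda>(t, s). D t s)"
    unfolding case_prod_unfold
  proof (rule continuous_on_blinfun_componentwise)
    fix k :: "real^'n" assume "k \<in> Basis"
    then obtain i where k: "k = axis i 1" by (auto simp: Basis_vec_def)
    have "continuous_on UNIV (\<lambda>(t, s). partial i (F s) t)"
      by (rule swap) (rule smooth_family_continuous[OF smooth_family_partial[OF assms]])
    then show "continuous_on (UNIV \<times> cbox a b) (\<lambda>x. blinfun_apply (D (fst x) (snd x)) k)"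
      unfolding D k case_prod_unfold by (rule continuous_on_subset) auto
  qed
  have int: "(\<lambda>s. F s t) integrable_on cbox a b" for t
    by (intro integrable_continuous continuous_on_subset[OF continuous_family_slice(2)[OF smooth_family_continuous[OF assms]]]) auto
  have main: "((\<lambda>t. integral (cbox a b) (\<lambda>s. F s t)) has_derivative
      blinfun_apply (integral (cbox a b) (D t))) (at t)"
    by (rule leibniz_rule[where U = UNIV and f = "\<lambda>t s. F s t", simplified])
      (use der D int contD in auto)
  then show "(\<lambda>t. integral (cbox a b) (\<lambda>s. F s t)) differentiable (at t)"
    using differentiable_def by blast
  have "D t integrable_on cbox a b"
  proof (rule integrable_continuous)
    have "continuous_on (cbox a b) ((\<lambda>(t, s). D t s) \<circ> Pair t)"
      by (intro continuous_on_compose continuous_intros continuous_on_subset[OF contD]) auto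
    then show "continuous_on (cbox a b) (D t)" by (simp add: o_def)
  qed
  then show "partial i (\<lambda>t. integral (cbox a b) (\<lambda>s. F s t)) t = integral (cbox a b) (\<lambda>s. partial i (F s) t)"
    unfolding partial_unique[OF main] using blinfun_apply_integral[of "D t" "cbox a b" "axis i 1"] by (simp add: D)
qed

lemma pderivs_integral:
  fixes F :: "'s::euclidean_space \<Rightarrow> real^'n \<Rightarrow> complex"
  assumes "smooth_family F"
  shows "pderivs js (\<lambda>t. integral (cbox a b) (\<lambda>s. F s t)) = (\<lambda>t. integral (cbox a b) (\<lambda>s. pderivs js (F s) t))"
  using integral_family_partial(2)[OF smooth_family_pderivs[OF assms]] by (induction js) auto

lemma smooth_integral:
  fixes F :: "'s::euclidean_space \<Rightarrow> real^'n \<Rightarrow> complex"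
  assumes "smooth_family F"
  shows "smooth (\<lambda>t. integral (cbox a b) (\<lambda>s. F s t))"
  unfolding smooth_def pderivs_integral[OF assms]
  using integral_family_partial(1)[OF smooth_family_pderivs[OF assms]] by blast

section \<open>Minkowski's inequality for seminorms on test functions\<close>

lemma test_functionsI:
  assumes "smooth f" "compact K" "K \<subseteq> U" "\<And>t. t \<notin> K \<Longrightarrow> f t = 0"
  shows "f \<in> test_functions U"
proof -
  have "closure {x. f x \<noteq> 0} \<subseteq> K"
    using assms by (intro closure_minimal) (auto simp: compact_imp_closed)
  moreover from this have "compact (closure {x. f x \<noteq> 0})"
    using assms(2) compact_Int_closed[of K "closure {x. f x \<noteq> 0}"] by (simp add: Int_absorb1)
  ultimately show ?thesis using assms by (auto simp: test_functions_def)
qed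

lemma test_functionsE:
  assumes "f \<in> test_functions U"
  obtains K where "smooth f" "compact K" "K \<subseteq> U" "\<And>t. t \<notin> K \<Longrightarrow> f t = 0"
proof
  show "smooth f" "compact (closure {x. f x \<noteq> 0})" "closure {x. f x \<noteq> 0} \<subseteq> U"
    using assms by (auto simp: test_functions_def)
  show "f t = 0" if "t \<notin> closure {x. f x \<noteq> 0}" for t
    using that closure_subset[of "{x. f x \<noteq> 0}"] by blast
qed

lemma test_functions_smooth: "f \<in> test_functions U \<Longrightarrow> smooth f"
  by (simp add: test_functions_def)

lemma test_functions_zero: "(\<lambda>t. 0) \<in> test_functions U"
  by (rule test_functionsI[of _ "{}"]) (auto intro: smooth_const)

lemma test_functions_add:
  assumes "f \<in> test_functions U" "g \<in> test_functions U"
  shows "(\<lambda>t. f t + g t) \<in> test_functions U"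
proof -
  obtain K where "smooth f" "compact K" "K \<subseteq> U" "\<And>t. t \<notin> K \<Longrightarrow> f t = 0"
    using assms(1) by (rule test_functionsE) (rule that)
  moreover obtain L where "smooth g" "compact L" "L \<subseteq> U" "\<And>t. t \<notin> L \<Longrightarrow> g t = 0"
    using assms(2) by (rule test_functionsE) (rule that)
  ultimately show ?thesis by (intro test_functionsI[of _ "K \<union> L"] smooth_add) auto
qed

lemma test_functions_mult:
  assumes "f \<in> test_functions U" "smooth g"
  shows "(\<lambda>t. g t * f t) \<in> test_functions U" "(\<lambda>t. f t * g t) \<in> test_functions U"
proof -
  obtain K where "smooth f" "compact K" "K \<subseteq> U" "\<And>t. t \<notin> K \<Longrightarrow> f t = 0"
    using assms(1) by (rule test_functionsE) (rule that)
  then show "(\<lambda>t. f t * g t) \<in> test_functions U"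
    using assms(2) by (intro test_functionsI[of _ K] smooth_mult) auto
  then show "(\<lambda>t. g t * f t) \<in> test_functions U" by (simp add: mult.commute)
qed

lemma test_functions_cmult: "f \<in> test_functions U \<Longrightarrow> (\<lambda>t. c * f t) \<in> test_functions U"
  by (rule test_functions_mult(1)[OF _ smooth_const])

lemma test_functions_diff:
  "f \<in> test_functions U \<Longrightarrow> g \<in> test_functions U \<Longrightarrow> (\<lambda>t. f t - g t) \<in> test_functions U"
  using test_functions_add[of f U "\<lambda>t. (-1) * g t"] test_functions_cmult[of g U "-1"] by simp

lemma test_functions_sum:
  "(\<And>a. a \<in> A \<Longrightarrow> f a \<in> test_functions U) \<Longrightarrow> (\<lambda>t. \<Sum>a\<in>A. f a t) \<in> test_functions U"
  by (induction A rule: infinite_finite_induct) (auto intro: test_functions_zero test_functions_add)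

lemma test_functions_shift:
  assumes "f \<in> test_functions U"
  shows "(\<lambda>t. f (t - a)) \<in> test_functions UNIV"
proof -
  obtain K where K: "smooth f" "compact K" "K \<subseteq> U" "\<And>t. t \<notin> K \<Longrightarrow> f t = 0"
    using assms by (rule test_functionsE) (rule that)
  show ?thesis
  proof (rule test_functionsI[of _ "(+) a ` K"])
    show "f (t - a) = 0" if "t \<notin> (+) a ` K" for t
      using that K(4)[of "t - a"] by (metis add.commute diff_add_cancel image_eqI)
  qed (use K compact_translation smooth_shift in auto)
qed

lemma pderivs_zero_outside:
  assumes "closed K" "smooth f" "\<And>t. t \<notin> K \<Longrightarrow> f t = 0" "t \<notin> K"
  shows "pderivs js f t = 0"
  using pderivs_cong_open(1)[of "- K" f "\<lambda>t. 0" t js] assms by auto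

lemma finite_multi_indices: "finite {js :: 'n::finite list. length js \<le> k}"
  using finite_lists_length_le[of "UNIV :: 'n set" k] by simp

text \<open>Each weighted derivative is uniformly continuous on the compact set
  \<open>cbox a b \<times> K\<close> and vanishes off \<open>K\<close>. Thus \<open>s\<close> to
  \<open>F s\<close> is uniformly continuous for the \<open>k\<close>-th Schwartz norm, which lets
  Riemann sums approximate the integral of the family.\<close>

lemma smooth_family_uniformly_continuous:
  fixes F :: "'s::euclidean_space \<Rightarrow> real^'n \<Rightarrow> complex"
  assumes F: "smooth_family F" and K: "compact K" "\<And>s t. s \<in> cbox a b \<Longrightarrow> t \<notin> K \<Longrightarrow> F s t = 0"
    and "\<epsilon> > 0"
  obtains \<delta> where "\<delta> > 0"
    "\<And>s s' js t. s \<in> cbox a b \<Longrightarrow> s' \<in> cbox a b \<Longrightarrow> dist s s' < \<delta> \<Longrightarrow> length js \<le> k \<Longrightarrow>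
      (1 + norm t) ^ k * cmod (pderivs js (F s) t - pderivs js (F s') t) \<le> \<epsilon>"
proof -
  define P where "P js \<delta> \<longleftrightarrow> \<delta> > 0 \<and> (\<forall>s\<in>cbox a b. \<forall>s'\<in>cbox a b. \<forall>t. dist s s' < \<delta> \<longrightarrow>
      (1 + norm t) ^ k * cmod (pderivs js (F s) t - pderivs js (F s') t) \<le> \<epsilon>)" for js \<delta>
  have "\<exists>\<delta>. P js \<delta>" for js
  proof -
    define G where "G = (\<lambda>x. of_real ((1 + norm (snd x)) ^ k) * pderivs js (F (fst x)) (snd x))"
    have "continuous_on UNIV (\<lambda>x. pderivs js (F (fst x)) (snd x))"
      using smooth_family_continuous[OF smooth_family_pderivs[OF F, of js]] by (simp add: case_prod_unfold)
    then have "continuous_on (cbox a b \<times> K) G"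
      unfolding G_def by (intro continuous_intros) (auto intro: continuous_on_subset)
    then have "uniformly_continuous_on (cbox a b \<times> K) G"
      using K(1) by (intro compact_uniformly_continuous compact_Times compact_cbox)
    then obtain \<delta> where \<delta>: "\<delta> > 0" "\<And>x y. x \<in> cbox a b \<times> K \<Longrightarrow> y \<in> cbox a b \<times> K \<Longrightarrow> dist y x < \<delta> \<Longrightarrow>
        dist (G y) (G x) < \<epsilon>"
      using \<open>\<epsilon> > 0\<close> unfolding uniformly_continuous_on_def by meson
    show ?thesis
      unfolding P_def
    proof (intro exI[of _ \<delta>] conjI ballI allI impI)
      fix s s' and t :: "real^'n" assume s: "s \<in> cbox a b" "s' \<in> cbox a b" "dist s s' < \<delta>"
      show "(1 + norm t) ^ k * cmod (pderivs js (F s) t - pderivs js (F s') t) \<le> \<epsilon>"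
      proof (cases "t \<in> K")
        case True
        have "(1 + norm t) ^ k * cmod (pderivs js (F s) t - pderivs js (F s') t) = dist (G (s, t)) (G (s', t))"
          unfolding G_def dist_norm fst_conv snd_conv right_diff_distrib[symmetric] norm_mult norm_of_real
          by (simp add: abs_of_nonneg)
        also have "\<dots> \<le> \<epsilon>"
          using \<delta>(2)[of "(s', t)" "(s, t)"] s True by (simp add: dist_Pair_Pair dist_commute)
        finally show ?thesis .
      next
        case False
        then have "pderivs js (F s) t = 0" "pderivs js (F s') t = 0"
          using pderivs_zero_outside[OF compact_imp_closed[OF K(1)] smooth_family_imp_smooth[OF F]] K(2) s by blast+
        then show ?thesis using \<open>\<epsilon> > 0\<close> by simp
      qed
    qed (rule \<delta>(1))
  qed
  then obtain \<delta> where "\<And>js. P js (\<delta> js)" by metis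
  then have \<delta>: "\<And>js. \<delta> js > 0" "\<And>js s s' t. s \<in> cbox a b \<Longrightarrow> s' \<in> cbox a b \<Longrightarrow> dist s s' < \<delta> js \<Longrightarrow>
      (1 + norm t) ^ k * cmod (pderivs js (F s) t - pderivs js (F s') t) \<le> \<epsilon>"
    by (simp_all add: P_def)
  \<comment> \<open>One \<open>\<delta>\<close> per index list is available; the lists of length at
    most \<open>k\<close> are finitely many, so the least one serves all.\<close>
  define J where "J = {js :: 'n list. length js \<le> k}"
  have J: "finite J" "J \<noteq> {}" unfolding J_def by (rule finite_multi_indices) (auto intro: exI[of _ "[]"])
  show ?thesis
  proof
    show "Min (\<delta> ` J) > 0" using J \<delta>(1) by simp
    show "(1 + norm t) ^ k * cmod (pderivs js (F s) t - pderivs js (F s') t) \<le> \<epsilon>"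
      if "s \<in> cbox a b" "s' \<in> cbox a b" "dist s s' < Min (\<delta> ` J)" "length js \<le> k" for s s' js t
    proof (rule \<delta>(2)[OF that(1,2)])
      have "Min (\<delta> ` J) \<le> \<delta> js" using J that(4) by (intro Min_le) (auto simp: J_def)
      then show "dist s s' < \<delta> js" using that(3) by simp
    qed
  qed
qed

text \<open>A bound on weighted derivatives stated without a supremum, so that no boundedness has to
  be shown before it can be used.\<close>

definition schwartz_bound :: "nat \<Rightarrow> (real^'n \<Rightarrow> complex) \<Rightarrow> real \<Rightarrow> bool" where
  "schwartz_bound k f S \<longleftrightarrow> (\<forall>js t. length js \<le> k \<longrightarrow> (1 + norm t) ^ k * cmod (pderivs js f t) \<le> S)"

text \<open>\<open>q\<close> stands for the norm of \<open>E\<close> pulled back along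
  \<open>schwartz_embed\<close>. The integration arguments use only these three properties, so no
  integral with values in \<open>E\<close> is ever formed.\<close>

locale dominated_seminorm =
  fixes q :: "(real^'n \<Rightarrow> complex) \<Rightarrow> real"
  assumes triangle: "f \<in> test_functions UNIV \<Longrightarrow> g \<in> test_functions UNIV \<Longrightarrow> q (\<lambda>t. f t + g t) \<le> q f + q g"
    and homogeneous: "f \<in> test_functions UNIV \<Longrightarrow> q (\<lambda>t. c * f t) = cmod c * q f"
    and dominated: "\<exists>C\<ge>0. \<exists>k. \<forall>f\<in>test_functions UNIV. \<forall>S. schwartz_bound k f S \<longrightarrow> q f \<le> C * S"
begin

lemma zero: "q (\<lambda>t. 0) = 0"
  using homogeneous[OF test_functions_zero, of 0] by simp

lemma nonneg: "f \<in> test_functions UNIV \<Longrightarrow> 0 \<le> q f"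
  using triangle[of f "\<lambda>t. (-1) * f t"] homogeneous[of f "-1"] test_functions_cmult[of f UNIV "-1"] zero by simp

lemma triangle_diff:
  assumes "f \<in> test_functions UNIV" "g \<in> test_functions UNIV"
  shows "q f \<le> q g + q (\<lambda>t. f t - g t)"
  using triangle[OF assms(2) test_functions_diff[OF assms]] by simp

lemma commute: "f \<in> test_functions UNIV \<Longrightarrow> g \<in> test_functions UNIV \<Longrightarrow> q (\<lambda>t. f t - g t) = q (\<lambda>t. g t - f t)"
  using homogeneous[OF test_functions_diff, of g f "-1"] by simp

lemma triangle_sum:
  "finite A \<Longrightarrow> (\<And>a. a \<in> A \<Longrightarrow> f a \<in> test_functions UNIV) \<Longrightarrow>
    q (\<lambda>t. \<Sum>a\<in>A. c a * f a t) \<le> (\<Sum>a\<in>A. cmod (c a) * q (f a))"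
proof (induction A rule: finite_induct)
  case empty then show ?case by (simp add: zero)
next
  case (insert x A)
  have "q (\<lambda>t. c x * f x t + (\<Sum>a\<in>A. c a * f a t)) \<le> q (\<lambda>t. c x * f x t) + q (\<lambda>t. \<Sum>a\<in>A. c a * f a t)"
    using insert.prems by (intro triangle test_functions_cmult test_functions_sum) auto
  also have "\<dots> \<le> cmod (c x) * q (f x) + (\<Sum>a\<in>A. cmod (c a) * q (f a))"
    using insert by (simp add: homogeneous)
  finally show ?case using insert.hyps by simp
qed

context
  fixes F :: "'s::euclidean_space \<Rightarrow> real^'n \<Rightarrow> complex" and K a b
  assumes F: "smooth_family F" and K: "compact K" "\<And>s t. s \<in> cbox a b \<Longrightarrow> t \<notin> K \<Longrightarrow> F s t = 0"
begin

lemma family_test_function: "s \<in> cbox a b \<Longrightarrow> F s \<in> test_functions UNIV"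
  using K by (intro test_functionsI[of _ K] smooth_family_imp_smooth[OF F]) auto

lemma seminorm_family_continuous: "continuous_on (cbox a b) (\<lambda>s. q (F s))"
  unfolding continuous_on_iff
proof (intro ballI allI impI)
  fix s \<epsilon> assume s: "s \<in> cbox a b" and "(\<epsilon>::real) > 0"
  obtain C k where C: "C \<ge> 0" "\<forall>f\<in>test_functions UNIV. \<forall>S. schwartz_bound k f S \<longrightarrow> q f \<le> C * S"
    using dominated by blast
  \<comment> \<open>\<open>C + 1\<close> instead of \<open>C\<close>, which may be zero.\<close>
  define \<eta> where "\<eta> = \<epsilon> / (C + 1)"
  have "\<eta> > 0" "C * \<eta> < \<epsilon>" using \<open>\<epsilon> > 0\<close> C(1) by (auto simp: \<eta>_def field_simps)
  obtain \<delta> where \<delta>: "\<delta> > 0" "\<And>s s' js t. s \<in> cbox a b \<Longrightarrow> s' \<in> cbox a b \<Longrightarrow> dist s s' < \<delta> \<Longrightarrow> length js \<le> k \<Longrightarrow>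
      (1 + norm t) ^ k * cmod (pderivs js (F s) t - pderivs js (F s') t) \<le> \<eta>"
    using smooth_family_uniformly_continuous[OF F K \<open>\<eta> > 0\<close>, where k = k] by blast
  have "dist (q (F s')) (q (F s)) < \<epsilon>" if s': "s' \<in> cbox a b" "dist s' s < \<delta>" for s'
  proof -
    note D = family_test_function[OF s] family_test_function[OF s'(1)]
    have "q (\<lambda>t. F s' t - F s t) \<le> C * \<eta>"
      using \<delta>(2)[OF s'(1) s s'(2)] D smooth_family_imp_smooth[OF F]
      by (intro C(2)[rule_format] test_functions_diff) (auto simp: pderivs_diff schwartz_bound_def)
    with \<open>C * \<eta> < \<epsilon>\<close> triangle_diff[OF D] triangle_diff[OF D(2,1)] commute[OF D] show ?thesis
      by (simp add: dist_real_def)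
  qed
  with \<delta>(1) show "\<exists>d>0. \<forall>x'\<in>cbox a b. dist x' s < d \<longrightarrow> dist (q (F x')) (q (F s)) < \<epsilon>" by blast
qed

lemma integral_test_function: "(\<lambda>t. integral (cbox a b) (\<lambda>s. F s t)) \<in> test_functions UNIV"
proof (rule test_functionsI[OF smooth_integral[OF F] K(1)])
  show "integral (cbox a b) (\<lambda>s. F s t) = 0" if "t \<notin> K" for t
    using that K(2) integral_cong[of "cbox a b" "\<lambda>s. F s t" "\<lambda>s. 0"] by simp
qed simp

text \<open>One Riemann sum \<open>R\<close> serves two purposes. Subadditivity bounds
  \<open>q R\<close> by the Riemann sum of \<open>q (F s)\<close>, which is close to the integral on
  the right, and \<open>R\<close> is close to the integral on the left in a Schwartz norm that
  dominates \<open>q\<close>.\<close>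

lemma minkowski_integral:
  "q (\<lambda>t. integral (cbox a b) (\<lambda>s. F s t)) \<le> integral (cbox a b) (\<lambda>s. q (F s))"
proof (rule field_le_epsilon)
  fix \<epsilon> :: real assume "\<epsilon> > 0"
  define G where "G = (\<lambda>t. integral (cbox a b) (\<lambda>s. F s t))"
  define I where "I = integral (cbox a b) (\<lambda>s. q (F s))"
  define V where "V = measure lborel (cbox a b)"
  have "V \<ge> 0" by (simp add: V_def)
  obtain C k where C: "C \<ge> 0" "\<forall>f\<in>test_functions UNIV. \<forall>S. schwartz_bound k f S \<longrightarrow> q f \<le> C * S"
    using dominated by blast
  \<comment> \<open>Chosen so that the error \<open>\<eta>\<close> of the numerical Riemann sum and
    the error \<open>C * (V * \<eta>)\<close> of the function-valued one add up to
    \<open>\<epsilon>\<close>.\<close>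
  define \<eta> where "\<eta> = \<epsilon> / (C * V + 1)"
  have "C * V \<ge> 0" using C(1) \<open>V \<ge> 0\<close> by simp
  have \<eta>: "\<eta> > 0" "C * (V * \<eta>) + \<eta> = \<epsilon>"
  proof -
    show "\<eta> > 0" using \<open>\<epsilon> > 0\<close> \<open>C * V \<ge> 0\<close> by (simp add: \<eta>_def)
    have "\<eta> * (C * V + 1) = \<epsilon>" using \<open>C * V \<ge> 0\<close> unfolding \<eta>_def by (intro nonzero_eq_divide_eq[THEN iffD1]) auto
    then show "C * (V * \<eta>) + \<eta> = \<epsilon>" by (simp add: algebra_simps)
  qed
  obtain \<delta> where \<delta>: "\<delta> > 0" "\<And>s s' js t. s \<in> cbox a b \<Longrightarrow> s' \<in> cbox a b \<Longrightarrow> dist s s' < \<delta> \<Longrightarrow> length js \<le> k \<Longrightarrow>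
      (1 + norm t) ^ k * cmod (pderivs js (F s) t - pderivs js (F s') t) \<le> \<eta>"
    using smooth_family_uniformly_continuous[OF F K \<open>\<eta> > 0\<close>, where k = k] by blast
  have "((\<lambda>s. q (F s)) has_integral I) (cbox a b)"
    unfolding I_def by (intro integrable_integral integrable_continuous seminorm_family_continuous)
  then obtain \<gamma> where \<gamma>: "gauge \<gamma>" "\<And>\<D>. \<D> tagged_division_of cbox a b \<Longrightarrow> \<gamma> fine \<D> \<Longrightarrow>
      norm ((\<Sum>(x, Q)\<in>\<D>. measure lborel Q *\<^sub>R q (F x)) - I) < \<eta>"
    using \<open>\<eta> > 0\<close> unfolding has_integral by metis
  \<comment> \<open>The division is fine for the gauge of the integral of \<open>q (F s)\<close> and
    also for balls of radius \<open>\<delta>\<close>, so that both approximations hold for the same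
    division.\<close>
  obtain p where p: "p tagged_division_of cbox a b" "(\<lambda>x. \<gamma> x \<inter> ball x \<delta>) fine p"
    using fine_division_exists[OF gauge_Int[OF \<gamma>(1) gauge_ball[OF \<delta>(1)]]] by blast
  then have fine: "\<gamma> fine p" "(\<lambda>x. ball x \<delta>) fine p" by (auto simp: fine_Int)
  have "finite p" using p(1) by blast
  have tag: "x \<in> Q" "Q \<subseteq> cbox a b" "\<exists>u v. Q = cbox u v" "Q \<subseteq> ball x \<delta>" if "(x, Q) \<in> p" for x Q
    using that p(1) fine(2) tagged_division_ofD(2,3,4)[OF p(1)] by (auto simp: fine_def)
  define R where "R = (\<lambda>t. \<Sum>z\<in>p. complex_of_real (measure lborel (snd z)) * F (fst z) t)"
  have FD: "F (fst z) \<in> test_functions UNIV" if "z \<in> p" for z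
    using that tag[of "fst z" "snd z"] by (intro family_test_function) auto
  have GD: "G \<in> test_functions UNIV" unfolding G_def by (rule integral_test_function)
  have RD: "R \<in> test_functions UNIV"
    unfolding R_def by (intro test_functions_sum test_functions_cmult FD)
  have "q R \<le> (\<Sum>z\<in>p. measure lborel (snd z) * q (F (fst z)))"
    using triangle_sum[OF \<open>finite p\<close>, of "\<lambda>z. F (fst z)" "\<lambda>z. complex_of_real (measure lborel (snd z))"] FD
    by (simp add: R_def)
  also have "\<dots> \<le> I + \<eta>"
    using \<gamma>(2)[OF p(1) fine(1)] by (simp add: case_prod_unfold)
  finally have R: "q R \<le> I + \<eta>" .
  have "q (\<lambda>t. G t - R t) \<le> C * (V * \<eta>)"
  proof (rule C(2)[rule_format])
    show "(\<lambda>t. G t - R t) \<in> test_functions UNIV" by (intro test_functions_diff GD RD)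
    show "schwartz_bound k (\<lambda>t. G t - R t) (V * \<eta>)"
      unfolding schwartz_bound_def
    proof (intro allI impI)
      fix js :: "'n list" and t :: "real^'n" assume js: "length js \<le> k"
      define P where "P s = pderivs js (F s) t" for s
      define w where "w = (1 + norm t) ^ k"
      have w: "w > 0" unfolding w_def by (intro zero_less_power) (simp add: add_pos_nonneg)
      have contP: "continuous_on UNIV P"
        unfolding P_def by (rule continuous_family_slice(2)[OF smooth_family_continuous[OF smooth_family_pderivs[OF F]]])
      have intP: "P integrable_on Q" if "(x, Q) \<in> p" for x Q
        using tag(3)[OF that] contP by (auto intro!: integrable_continuous intro: continuous_on_subset)
      have "pderivs js (\<lambda>t. G t - R t) t = integral (cbox a b) P - (\<Sum>z\<in>p. of_real (measure lborel (snd z)) * P (fst z))"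
        using test_functions_smooth[OF GD] test_functions_smooth[OF RD] smooth_family_imp_smooth[OF F]
        by (simp add: pderivs_diff) (simp add: G_def R_def pderivs_integral[OF F] pderivs_sum pderivs_cmult smooth_cmult P_def[abs_def])
      also have "integral (cbox a b) P = (\<Sum>(x, Q)\<in>p. integral Q P)"
        by (intro integral_combine_tagged_division_topdown[OF _ p(1)] integrable_continuous continuous_on_subset[OF contP]) simp
      also have "(\<Sum>(x, Q)\<in>p. integral Q P) - (\<Sum>z\<in>p. of_real (measure lborel (snd z)) * P (fst z)) =
          (\<Sum>z\<in>p. integral (snd z) (\<lambda>s. P s - P (fst z)))"
        unfolding sum_subtractf[symmetric]
      proof (intro sum.cong refl)
        fix z assume "z \<in> p"
        then have z1: "(fst z, snd z) \<in> p" by simp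
        obtain u v where "snd z = cbox u v" using tag(3)[OF z1] by blast
        note z = z1 this
        have "integral (cbox u v) (\<lambda>s. P s - P (fst z)) = integral (cbox u v) P - measure lborel (cbox u v) *\<^sub>R P (fst z)"
          using intP[OF z(1)] z(2) by (subst integral_diff) auto
        then show "(case z of (x, Q) \<Rightarrow> integral Q P) - of_real (measure lborel (snd z)) * P (fst z) =
            integral (snd z) (\<lambda>s. P s - P (fst z))"
          using z(2) by (simp add: case_prod_unfold scaleR_conv_of_real)
    qed
    finally have "cmod (pderivs js (\<lambda>t. G t - R t) t) \<le> (\<Sum>z\<in>p. cmod (integral (snd z) (\<lambda>s. P s - P (fst z))))"
      using norm_sum by simp
    also have "\<dots> \<le> (\<Sum>z\<in>p. \<eta> / w * measure lborel (snd z))"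
    proof (rule sum_mono)
      fix z assume "z \<in> p"
      then have z: "(fst z, snd z) \<in> p" by simp
      then obtain u v where uv: "snd z = cbox u v" using tag(3) by blast
      \<comment> \<open>A piece lies within \<open>\<delta>\<close> of its tag, so the derivative at
        \<open>t\<close> varies by at most \<open>\<eta> / w\<close> over it; the division by
        \<open>w\<close> undoes the polynomial weight at the fixed point \<open>t\<close>.\<close>
      have "cmod (integral (cbox u v) (\<lambda>s. P s - P (fst z))) \<le> \<eta> / w * measure lborel (cbox u v)"
      proof (rule integrable_bound)
        show "0 \<le> \<eta> / w" using \<eta>(1) w by simp
        show "(\<lambda>s. P s - P (fst z)) integrable_on cbox u v"
          using intP[OF z] uv by (intro integrable_diff) auto
        fix s assume "s \<in> cbox u v"
        then have "s \<in> cbox a b" "fst z \<in> cbox a b" "dist s (fst z) < \<delta>"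
          using tag[OF z] uv by (auto simp: dist_commute)
        from \<delta>(2)[OF this js, of t] show "cmod (P s - P (fst z)) \<le> \<eta> / w"
          using w unfolding P_def w_def by (simp add: field_simps)
      qed
      then show "cmod (integral (snd z) (\<lambda>s. P s - P (fst z))) \<le> \<eta> / w * measure lborel (snd z)" by (simp add: uv)
    qed
    also have "\<dots> = \<eta> / w * V"
      unfolding sum_distrib_left[symmetric] V_def
      using additive_content_tagged_division[OF p(1)] by (simp add: case_prod_unfold)
    finally show "(1 + norm t) ^ k * cmod (pderivs js (\<lambda>t. G t - R t) t) \<le> V * \<eta>"
      using w by (simp add: field_simps flip: w_def)
    qed
  qed
  then show "q G \<le> I + \<epsilon>"
    using triangle_diff[OF GD RD] R \<eta>(2) by simp
qed

end

end

section \<open>Trigonometric polynomials\<close>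

text \<open>The unit cube lengthened by \<open>r\<close> in direction \<open>i\<close> is cut in two
  ways: into the cube at \<open>a\<close> and a slab of height \<open>r\<close> above it, or into a
  slab of height \<open>r\<close> and the shifted cube. The two slabs differ by one period, so the
  cubes have equal integrals.\<close>

lemma integral_periodic_step:
  fixes g :: "real^'n \<Rightarrow> complex"
  assumes g: "continuous_on UNIV g" "\<And>u. g (u + axis i 1) = g u" and "r \<ge> 0"
  shows "integral (cbox (a + r *\<^sub>R axis i 1) (a + 1 + r *\<^sub>R axis i 1)) g = integral (cbox a (a + 1)) g"
proof -
  define b where "b = a + 1 + r *\<^sub>R axis i (1::real)"
  define slab where "slab = integral (cbox a (b - axis i 1)) g"
  have int: "g integrable_on cbox a b"
    by (rule integrable_continuous) (rule continuous_on_subset[OF g(1)], simp)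
  have basis: "axis i (1::real) \<in> Basis" by simp
  have eq: "cbox a b \<inter> {x. x \<bullet> axis i 1 \<le> a $ i + 1} = cbox a (a + 1)"
    "cbox a b \<inter> {x. x \<bullet> axis i 1 \<ge> a $ i + 1} = cbox (a + axis i 1) (b - axis i 1 + axis i 1)"
    "cbox a b \<inter> {x. x \<bullet> axis i 1 \<le> a $ i + r} = cbox a (b - axis i 1)"
    "cbox a b \<inter> {x. x \<bullet> axis i 1 \<ge> a $ i + r} = cbox (a + r *\<^sub>R axis i 1) b"
  proof -
    have mem: "x \<in> cbox l u \<longleftrightarrow> l $ i \<le> x $ i \<and> x $ i \<le> u $ i \<and> (\<forall>j. j \<noteq> i \<longrightarrow> l $ j \<le> x $ j \<and> x $ j \<le> u $ j)"
      for x l u :: "real^'n"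
      unfolding mem_box_cart by metis
    have ax: "axis i (1::real) $ j = 0" "axis i (1::real) $ i = 1" if "j \<noteq> i" for j
      using that by (auto simp: axis_def)
    have axi: "axis i (1::real) $ i = 1" by (simp add: axis_def)
    show "cbox a b \<inter> {x. x \<bullet> axis i 1 \<le> a $ i + 1} = cbox a (a + 1)"
      "cbox a b \<inter> {x. x \<bullet> axis i 1 \<ge> a $ i + 1} = cbox (a + axis i 1) (b - axis i 1 + axis i 1)"
      "cbox a b \<inter> {x. x \<bullet> axis i 1 \<le> a $ i + r} = cbox a (b - axis i 1)"
      "cbox a b \<inter> {x. x \<bullet> axis i 1 \<ge> a $ i + r} = cbox (a + r *\<^sub>R axis i 1) b"
      using \<open>r \<ge> 0\<close> unfolding b_def by (auto simp: mem ax(1) axi inner_axis)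
  qed
  have "integral (cbox (a + axis i 1) (b - axis i 1 + axis i 1)) g = slab"
    unfolding integral_shift_cbox_plus[symmetric] slab_def using g(2) by (simp add: o_def add.commute)
  then have "integral (cbox a b) g = integral (cbox a (a + 1)) g + slab"
    using integral_split[OF int basis, of "a $ i + 1"] by (simp add: eq)
  moreover have "integral (cbox a b) g = slab + integral (cbox (a + r *\<^sub>R axis i 1) b) g"
    using integral_split[OF int basis, of "a $ i + r"] by (simp add: eq slab_def)
  ultimately show ?thesis by (simp add: b_def)
qed

lemma integral_periodic_translate:
  fixes g :: "real^'n \<Rightarrow> complex"
  assumes g: "continuous_on UNIV g" "\<And>i u. g (u + axis i 1) = g u"
  shows "integral (cbox (a + v) (a + v + 1)) g = integral (cbox a (a + 1)) g"
proof -
  have step: "integral (cbox (a + r *\<^sub>R axis i 1) (a + r *\<^sub>R axis i 1 + 1)) g = integral (cbox a (a + 1)) g"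
    for a and i and r :: real
  proof (cases "r \<ge> 0")
    case True
    then show ?thesis using integral_periodic_step[OF g(1) g(2) True, of a i] by (simp only: ac_simps)
  next
    case False
    \<comment> \<open>A negative shift is undone by a positive one that starts from the shifted
      cube.\<close>
    have "a + r *\<^sub>R axis i 1 + (- r) *\<^sub>R axis i 1 = a" "a + r *\<^sub>R axis i 1 + 1 + (- r) *\<^sub>R axis i 1 = a + 1"
      by simp_all
    then show ?thesis
      using integral_periodic_step[OF g(1) g(2), of "- r" "a + r *\<^sub>R axis i 1" i] False by simp
  qed
  have "integral (cbox (a + (\<Sum>i\<in>S. v $ i *\<^sub>R axis i 1)) (a + (\<Sum>i\<in>S. v $ i *\<^sub>R axis i 1) + 1)) g =
      integral (cbox a (a + 1)) g" if "finite S" for S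
    using that
  proof (induction S rule: finite_induct)
    case empty then show ?case by simp
  next
    case (insert i S)
    then show ?case using step[of "a + (\<Sum>i\<in>S. v $ i *\<^sub>R axis i 1)" "v $ i" i] by (simp add: ac_simps)
  qed
  from this[of UNIV] show ?thesis
    using basis_expansion[of v] by (simp add: scalar_mult_eq_scaleR)
qed

text \<open>Centred at the origin, so that \<open>0\<close> is its only integer point and
  \<open>cosine_bump\<close> has a single maximum on it.\<close>

abbreviation unit_cube :: "(real^'n) set" where
  "unit_cube \<equiv> cbox (vec (- (1 / 2))) (vec (1 / 2))"

lemma integral_cube_shift:
  fixes g :: "real^'n \<Rightarrow> complex"
  assumes g: "continuous_on UNIV g" "\<And>i u. g (u + axis i 1) = g u"
  shows "integral unit_cube (\<lambda>u. g (u + v)) = integral unit_cube g"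
proof -
  have eq: "vec (- (1 / 2)) + 1 = (vec (1 / 2) :: real^'n)" "vec (- (1 / 2)) + v + 1 = vec (1 / 2) + v"
    by (simp_all add: vec_eq_iff)
  have "integral unit_cube (\<lambda>u. g (u + v)) = integral unit_cube (g \<circ> (+) v)"
    by (simp add: o_def add.commute)
  also have "\<dots> = integral (cbox (vec (- (1 / 2)) + v) (vec (1 / 2) + v)) g"
    by (rule integral_shift_cbox_plus)
  finally show ?thesis
    using integral_periodic_translate[OF g, of "vec (- (1 / 2))" v] unfolding eq by simp
qed

lemma content_unit_cube: "measure lborel (unit_cube :: (real^'n) set) = 1"
proof -
  have "0 \<in> (unit_cube :: (real^'n) set)" by (simp add: mem_box_cart)
  then have "(unit_cube :: (real^'n) set) \<noteq> {}" by blast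
  then show ?thesis by (simp add: content_cbox_cart)
qed

section \<open>Integer frequencies and trigonometric polynomials\<close>

definition int_vec :: "(real^'n) set" where
  "int_vec = {m. \<forall>i. m $ i \<in> \<int>}"

lemma int_vec_intros:
  "0 \<in> int_vec" "m \<in> int_vec \<Longrightarrow> m' \<in> int_vec \<Longrightarrow> m + m' \<in> int_vec"
  "m \<in> int_vec \<Longrightarrow> - m \<in> int_vec" "axis i 1 \<in> int_vec"
  by (auto simp: int_vec_def axis_def)

lemma wave_zero [simp]: "wave 0 t = 1" "wave \<xi> 0 = 1"
  by (simp_all add: wave_def)

lemma wave_minus: "wave (- \<xi>) t = inverse (wave \<xi> t)" "wave \<xi> (- t) = inverse (wave \<xi> t)"
  by (simp_all add: wave_def exp_minus)

lemma wave_int_vec_periodic: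
  assumes "m \<in> int_vec" shows "wave m (u + axis i 1) = wave m u"
proof -
  have "wave m (axis i 1) = exp ((2 * of_real (m $ i) * pi) * \<i>)"
    by (simp add: wave_def inner_axis' mult_ac)
  also have "\<dots> = 1" using assms by (intro exp_integer_2pi) (auto simp: int_vec_def)
  finally show ?thesis by (simp add: wave_add)
qed

lemma continuous_wave: "continuous_on S (wave m)"
  by (rule continuous_on_subset[OF smooth_continuous[OF smooth_wave]]) simp

text \<open>Shifting by half a wavelength along an axis on which \<open>m\<close> does not vanish
  multiplies the wave by \<open>-1\<close>, while periodicity keeps the integral.\<close>

lemma integral_wave:
  fixes m :: "real^'n"
  assumes "m \<in> int_vec" "m \<noteq> 0"
  shows "integral unit_cube (wave m) = 0"
proof -
  obtain i where i: "m $ i \<noteq> 0" using assms(2) by (auto simp: vec_eq_iff)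
  define v :: "real^'n" where "v = axis i (1 / (2 * m $ i))"
  have "wave m v = exp (pi * \<i>)"
    using i by (simp add: wave_def v_def inner_axis' mult_ac)
  then have v: "wave m v = -1" by simp
  have "integral unit_cube (wave m) = integral unit_cube (\<lambda>u. wave m (u + v))"
    by (rule integral_cube_shift[symmetric]) (auto simp: continuous_wave wave_int_vec_periodic[OF assms(1)])
  also have "\<dots> = - integral unit_cube (wave m)"
    by (simp add: wave_add v)
  finally show ?thesis by simp
qed

definition trig_poly :: "(real^'n \<Rightarrow> complex) \<Rightarrow> bool" where
  "trig_poly J \<longleftrightarrow> (\<exists>F c. finite F \<and> F \<subseteq> int_vec \<and> J = (\<lambda>u. \<Sum>m\<in>F. c m * wave m u))"

lemma trig_poly_wave: "m \<in> int_vec \<Longrightarrow> trig_poly (\<lambda>u. c * wave m u)"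
  unfolding trig_poly_def by (intro exI[of _ "{m}"] exI[of _ "\<lambda>_. c"]) auto

lemma trig_poly_const: "trig_poly (\<lambda>u. c)"
  using trig_poly_wave[OF int_vec_intros(1)] by simp

lemma trig_poly_add:
  assumes "trig_poly J" "trig_poly J'"
  shows "trig_poly (\<lambda>u. J u + J' u)"
proof -
  obtain F c where F: "finite F" "F \<subseteq> int_vec" "J = (\<lambda>u. \<Sum>m\<in>F. c m * wave m u)"
    using assms(1) by (auto simp: trig_poly_def)
  obtain F' c' where F': "finite F'" "F' \<subseteq> int_vec" "J' = (\<lambda>u. \<Sum>m\<in>F'. c' m * wave m u)"
    using assms(2) by (auto simp: trig_poly_def)
  define d where "d m = (if m \<in> F then c m else 0) + (if m \<in> F' then c' m else 0)" for m
  have "(\<Sum>m\<in>F \<union> F'. d m * wave m u) =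
      (\<Sum>m\<in>F \<union> F'. (if m \<in> F then c m * wave m u else 0)) + (\<Sum>m\<in>F \<union> F'. (if m \<in> F' then c' m * wave m u else 0))" for u
    unfolding sum.distrib[symmetric] by (rule sum.cong) (auto simp: d_def ring_distribs)
  also have "\<dots> u = J u + J' u" for u
    using F F' by (simp add: sum.If_cases Int_absorb1 Int_absorb2)
  finally have "J u + J' u = (\<Sum>m\<in>F \<union> F'. d m * wave m u)" for u by simp
  then show ?thesis unfolding trig_poly_def using F F' by (intro exI[of _ "F \<union> F'"] exI[of _ d]) auto
qed

lemma trig_poly_sum: "(\<And>a. a \<in> A \<Longrightarrow> trig_poly (f a)) \<Longrightarrow> trig_poly (\<lambda>u. \<Sum>a\<in>A. f a u)"
  by (induction A rule: infinite_finite_induct) (auto intro: trig_poly_const trig_poly_add)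

lemma trig_poly_mult:
  assumes "trig_poly J" "trig_poly J'"
  shows "trig_poly (\<lambda>u. J u * J' u)"
proof -
  obtain F c where F: "F \<subseteq> int_vec" "J = (\<lambda>u. \<Sum>m\<in>F. c m * wave m u)"
    using assms(1) by (auto simp: trig_poly_def)
  obtain F' c' where F': "F' \<subseteq> int_vec" "J' = (\<lambda>u. \<Sum>m\<in>F'. c' m * wave m u)"
    using assms(2) by (auto simp: trig_poly_def)
  have "trig_poly (\<lambda>u. \<Sum>m\<in>F. \<Sum>m'\<in>F'. (c m * c' m') * wave (m + m') u)"
    using F F' by (intro trig_poly_sum trig_poly_wave int_vec_intros) auto
  moreover have "(\<lambda>u. J u * J' u) = (\<lambda>u. \<Sum>m\<in>F. \<Sum>m'\<in>F'. (c m * c' m') * wave (m + m') u)"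
    unfolding F F' sum_product by (simp add: wave_freq_add mult_ac)
  ultimately show ?thesis by simp
qed

lemma trig_poly_power: "trig_poly J \<Longrightarrow> trig_poly (\<lambda>u. J u ^ k)"
  by (induction k) (auto intro: trig_poly_const trig_poly_mult)

text \<open>By orthogonality \<open>c m\<close> is a Fourier integral of \<open>w\<close>, hence
  bounded by the mass of \<open>w\<close> because \<open>w\<close> is nonnegative. For a kernel of
  mass 1 the factors by which averaging changes Fourier coefficients are therefore at most 1 in
  modulus.\<close>

lemma trig_poly_coefficients:
  fixes w :: "real^'n \<Rightarrow> real"
  assumes J: "trig_poly (\<lambda>u. complex_of_real (w u))" "continuous_on UNIV w" "\<And>u. w u \<ge> 0"
  obtains F c where "finite F" "F \<subseteq> int_vec" "\<And>u. complex_of_real (w u) = (\<Sum>m\<in>F. c m * wave m u)"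
    "\<And>m. m \<in> F \<Longrightarrow> cmod (c m) \<le> integral unit_cube w"
proof -
  obtain F c where F: "finite F" "F \<subseteq> int_vec" "(\<lambda>u. complex_of_real (w u)) = (\<lambda>u. \<Sum>m\<in>F. c m * wave m u)"
    using J(1) by (auto simp: trig_poly_def)
  have w: "complex_of_real (w u) = (\<Sum>m\<in>F. c m * wave m u)" for u
    using F(3) by meson
  have "cmod (c l) \<le> integral unit_cube w" if "l \<in> F" for l
  proof -
    have int: "integral unit_cube (\<lambda>u. wave (- l) u * wave m u) = (if m = l then 1 else 0)" if "m \<in> F" for m
    proof (cases "m = l")
      case True
      then show ?thesis using content_unit_cube[where 'n = 'n] wave_zero(1) by (simp add: wave_freq_add[symmetric])
    next
      case False
      have "m - l \<in> int_vec" "m - l \<noteq> 0"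
        using F(2) \<open>l \<in> F\<close> that False int_vec_intros(2)[of m "- l"] int_vec_intros(3)[of l] by auto
      from integral_wave[OF this] False show ?thesis
        by (simp add: wave_freq_add[symmetric])
    qed
    have "integral unit_cube (\<lambda>u. complex_of_real (w u) * wave (- l) u) =
        integral unit_cube (\<lambda>u. \<Sum>m\<in>F. c m * (wave (- l) u * wave m u))"
      unfolding w sum_distrib_right by (simp add: ac_simps)
    also have "\<dots> = (\<Sum>m\<in>F. integral unit_cube (\<lambda>u. c m * (wave (- l) u * wave m u)))"
      by (intro integral_sum F(1) integrable_continuous continuous_intros continuous_wave)
    also have "\<dots> = (\<Sum>m\<in>F. if m = l then c m else 0)"
      by (rule sum.cong) (auto simp: int)
    also have "\<dots> = c l" using \<open>l \<in> F\<close> F(1) by simp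
    finally have "cmod (c l) = cmod (integral unit_cube (\<lambda>u. complex_of_real (w u) * wave (- l) u))" by simp
    also have "\<dots> \<le> integral unit_cube w"
      using J(2,3)
      by (intro integral_norm_bound_integral integrable_continuous continuous_intros continuous_wave)
        (auto simp: norm_mult intro: continuous_on_subset)
    finally show ?thesis .
  qed
  with F(1,2) w show ?thesis by (rule that)
qed

text \<open>The mean over the coordinates of \<open>(1 + cos (2 * pi * u $ i)) / 2\<close>. Its
  normalised powers are nonnegative trigonometric polynomials that concentrate at the lattice
  points; they play the part of a Fejer kernel.\<close>

definition cosine_bump :: "real^'n \<Rightarrow> real" where
  "cosine_bump u = 1 / 2 + (\<Sum>i\<in>UNIV. cos (2 * pi * u $ i)) / (2 * CARD('n))"

lemma trig_poly_cosine_bump: "trig_poly (\<lambda>u :: real^'n. complex_of_real (cosine_bump u))"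
proof -
  have cos: "complex_of_real (cos (2 * pi * u $ i)) = 1 / 2 * wave (axis i 1) u + 1 / 2 * wave (- axis i 1) u"
    for u :: "real^'n" and i
    by (simp add: wave_minus, simp add: wave_def inner_axis cos_of_real[symmetric] cos_exp_eq exp_minus field_simps)
  have "trig_poly (\<lambda>u :: real^'n. 1 / 2 + (1 / (2 * CARD('n))) * (\<Sum>i\<in>UNIV. 1 / 2 * wave (axis i 1) u + 1 / 2 * wave (- axis i 1) u))"
    by (intro trig_poly_add trig_poly_mult trig_poly_sum trig_poly_wave trig_poly_const int_vec_intros)
  also have "(\<lambda>u :: real^'n. 1 / 2 + (1 / (2 * CARD('n))) * (\<Sum>i\<in>UNIV. 1 / 2 * wave (axis i 1) u + 1 / 2 * wave (- axis i 1) u)) =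
      (\<lambda>u. complex_of_real (cosine_bump u))"
    unfolding cosine_bump_def by (simp only: cos[symmetric]) (simp add: field_simps)
  finally show ?thesis .
qed

lemma continuous_cosine_bump: "continuous_on S cosine_bump"
  unfolding cosine_bump_def by (intro continuous_intros continuous_on_component) auto

lemma cosine_bump_bounds:
  fixes u :: "real^'n"
  shows "0 \<le> cosine_bump u" "cosine_bump (0 :: real^'n) = 1"
    "u \<in> unit_cube \<Longrightarrow> u \<noteq> 0 \<Longrightarrow> cosine_bump u < 1"
proof -
  have "- real CARD('n) \<le> (\<Sum>i\<in>UNIV. cos (2 * pi * u $ i))"
    using sum_mono[of UNIV "\<lambda>_. -1" "\<lambda>i. cos (2 * pi * u $ i)"] by simp
  then have "- 1 / 2 \<le> (\<Sum>i\<in>UNIV. cos (2 * pi * u $ i)) / (2 * CARD('n))"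
    by (simp add: field_simps)
  then show "0 \<le> cosine_bump u" unfolding cosine_bump_def by linarith
  show "cosine_bump (0 :: real^'n) = 1" by (simp add: cosine_bump_def)
  show "cosine_bump u < 1" if u: "u \<in> unit_cube" "u \<noteq> 0"
  proof -
    obtain i where i: "u $ i \<noteq> 0" using u(2) by (auto simp: vec_eq_iff)
    have "\<bar>u $ i\<bar> \<le> 1 / 2" 
    proof -
      have "- (1 / 2) \<le> u $ i" "u $ i \<le> 1 / 2" using u(1) by (simp_all add: mem_box_cart del: minus_divide_left)
      then show ?thesis by (simp add: abs_le_iff)
    qed
    \<comment> \<open>On the centred cube the argument stays in \<open>[0, pi]\<close>, where the
      cosine is strictly decreasing.\<close>
    then have "cos \<bar>2 * pi * u $ i\<bar> < cos 0"
      using i by (intro cos_monotone_0_pi) (auto simp: abs_mult)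
    then have "(\<Sum>i\<in>UNIV. cos (2 * pi * u $ i)) < (\<Sum>i\<in>(UNIV::'n set). 1)"
      by (intro sum_strict_mono_ex1) auto
    then have "(\<Sum>i\<in>UNIV. cos (2 * pi * u $ i)) / (2 * CARD('n)) < 1 / 2"
      by (simp add: field_simps)
    then show ?thesis unfolding cosine_bump_def by linarith
  qed
qed

text \<open>Away from the origin the powers decay like \<open>\<eta> ^ k\<close>, whereas their
  total mass is at least a constant times \<open>\<eta>' ^ k\<close> for some larger
  \<open>\<eta>'\<close>. So for large \<open>k\<close> the mean of \<open>\<beta>\<close> sees only
  values near \<open>\<beta> 0\<close>.\<close>

lemma cosine_bump_concentrates:
  fixes \<beta> :: "real^'n \<Rightarrow> real"
  assumes \<beta>: "continuous_on unit_cube \<beta>" "\<And>u. u \<in> unit_cube \<Longrightarrow> 0 \<le> \<beta> u" and "\<epsilon> > 0"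
  obtains k where "0 < integral unit_cube (\<lambda>u :: real^'n. cosine_bump u ^ k)"
    "integral unit_cube (\<lambda>u. cosine_bump u ^ k * \<beta> u) \<le> (\<beta> 0 + \<epsilon>) * integral unit_cube (\<lambda>u :: real^'n. cosine_bump u ^ k)"
proof -
  let ?Q = "unit_cube :: (real^'n) set"
  have 0: "0 \<in> ?Q" by (simp add: mem_box_cart)
  have contW: "continuous_on S (\<lambda>u :: real^'n. cosine_bump u ^ k)" for k S
    by (intro continuous_intros continuous_cosine_bump)
  have "bounded (\<beta> ` ?Q)" by (intro compact_imp_bounded compact_continuous_image \<beta>(1) compact_cbox)
  then obtain M where M: "M > 0" "\<And>u. u \<in> ?Q \<Longrightarrow> \<beta> u \<le> M"
    by (auto simp: bounded_pos abs_le_iff)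
  obtain \<delta> where \<delta>: "\<delta> > 0" "\<And>u. u \<in> ?Q \<Longrightarrow> dist u 0 < \<delta> \<Longrightarrow> dist (\<beta> u) (\<beta> 0) < \<epsilon> / 2"
    using \<beta>(1) 0 \<open>\<epsilon> > 0\<close> half_gt_zero unfolding continuous_on_iff by meson
  define P where "P = ?Q - ball 0 \<delta>"
  obtain \<eta> where \<eta>: "0 \<le> \<eta>" "\<eta> < 1" "\<And>u. u \<in> P \<Longrightarrow> cosine_bump u \<le> \<eta>"
  proof (cases "P = {}")
    case True then show ?thesis using that[of 0] by simp
  next
    case False
    have "compact P" unfolding P_def by (intro compact_diff compact_cbox) auto
    then obtain x where x: "x \<in> P" "\<And>u. u \<in> P \<Longrightarrow> cosine_bump u \<le> cosine_bump x"
      using continuous_attains_sup[OF _ False continuous_cosine_bump] by blast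
    have "x \<noteq> 0" using x(1) \<delta>(1) by (auto simp: P_def)
    then show ?thesis using that[of "cosine_bump x"] x cosine_bump_bounds(1)[of x] cosine_bump_bounds(3)[of x] by (auto simp: P_def)
  qed
  \<comment> \<open>A level strictly between the bound \<open>\<eta>\<close> away from the origin
    and the maximum 1.\<close>
  define \<eta>' where "\<eta>' = (1 + \<eta>) / 2"
  have \<eta>': "\<eta> < \<eta>'" "\<eta>' < 1" "0 < \<eta>'" using \<eta> by (auto simp: \<eta>'_def)
  obtain d where d: "d > 0" "\<And>u :: real^'n. dist u 0 < d \<Longrightarrow> dist (cosine_bump u) 1 < 1 - \<eta>'"
    using continuous_cosine_bump[of UNIV] \<eta>'(2) cosine_bump_bounds(2) unfolding continuous_on_iff
    by (metis UNIV_I diff_gt_0_iff_gt)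
  \<comment> \<open>A cube around the origin on which the bump stays above \<open>\<eta>'\<close>;
    its volume enters the lower bound for the mass.\<close>
  obtain R :: "(real^'n) set" and l r where R: "R = cbox l r" "R \<subseteq> ?Q" "R \<subseteq> ball 0 d" "measure lborel R > 0"
  proof -
    \<comment> \<open>\<open>1 / 2\<close> keeps the cube inside the unit cube; the other term makes
      the sum of the coordinates' moduli, hence the norm, smaller than \<open>d\<close>.\<close>
    define \<rho> where "\<rho> = min (1 / 2) (d / (2 * CARD('n)))"
    have \<rho>: "\<rho> > 0" "\<rho> \<le> 1 / 2" "CARD('n) * \<rho> < d"
    proof -
      show "\<rho> > 0" "\<rho> \<le> 1 / 2" using d(1) by (auto simp: \<rho>_def)
      have "CARD('n) * \<rho> \<le> CARD('n) * (d / (2 * CARD('n)))" by (intro mult_left_mono) (auto simp: \<rho>_def)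
      then show "CARD('n) * \<rho> < d" using d(1) by simp
    qed
    define R :: "(real^'n) set" where "R = cbox (vec (- \<rho>)) (vec \<rho>)"
    have "0 \<in> R" using \<rho> by (simp add: R_def mem_box_cart)
    then have "R \<noteq> {}" by blast
    then have "measure lborel R > 0" using \<rho> by (simp add: R_def content_cbox_cart)
    moreover have "R \<subseteq> ball 0 d"
    proof
      fix u assume "u \<in> R"
      then have "\<bar>u $ i\<bar> \<le> \<rho>" for i by (auto simp: R_def mem_box_cart abs_le_iff) (metis minus_le_iff)
      then have "norm u \<le> (\<Sum>i\<in>(UNIV::'n set). \<rho>)" using norm_le_l1_cart[of u] by (meson order_trans sum_mono)
      then show "u \<in> ball 0 d" using \<rho>(3) by simp
    qed
    moreover have "R \<subseteq> ?Q"
    proof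
      fix u assume "u \<in> R"
      then have "- \<rho> \<le> u $ i" "u $ i \<le> \<rho>" for i by (auto simp: R_def mem_box_cart)
      then have "- (1 / 2) \<le> u $ i" "u $ i \<le> 1 / 2" for i using \<rho>(2) by (meson neg_le_iff_le order_trans)+
      then show "u \<in> ?Q" by (simp add: mem_box_cart)
    qed
    ultimately show ?thesis using that R_def by blast
  qed
  define V where "V = measure lborel R"
  have V: "V > 0" using R by (simp add: V_def)
  have I: "\<eta>' ^ k * V \<le> integral ?Q (\<lambda>u. cosine_bump u ^ k)" for k
  proof -
    have "\<eta>' ^ k * V = integral R (\<lambda>u. \<eta>' ^ k)" by (simp add: R(1) V_def)
    also have "\<dots> \<le> integral R (\<lambda>u. cosine_bump u ^ k)"
      unfolding R(1)
    proof (intro integral_le integrable_continuous contW continuous_on_const power_mono)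
      fix u assume "u \<in> cbox l r"
      then have "dist u 0 < d" using R by (auto simp: dist_commute)
      from d(2)[OF this] show "\<eta>' \<le> cosine_bump u" by (simp add: dist_real_def)
    qed (use \<eta>' in simp)
    also have "\<dots> \<le> integral ?Q (\<lambda>u. cosine_bump u ^ k)"
      using R cosine_bump_bounds(1) unfolding R(1)
      by (intro integral_subset_le integrable_continuous contW) (auto intro: zero_le_power)
    finally show ?thesis .
  qed
  \<comment> \<open>Relative to the mass, the part away from the origin is at most
    \<open>M * (\<eta> / \<eta>') ^ k / V\<close>, which tends to zero.\<close>
  have "(\<lambda>k. (\<eta> / \<eta>') ^ k) \<longlonglongrightarrow> 0"
    using \<eta> \<eta>' by (intro LIMSEQ_power_zero) simp
  moreover have "\<epsilon> / 2 * V / M > 0" using \<open>\<epsilon> > 0\<close> V M by simp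
  ultimately obtain k where "(\<eta> / \<eta>') ^ k < \<epsilon> / 2 * V / M"
    by (metis (no_types, lifting) eventually_sequentially order_tendstoD(2) order_refl)
  then have "M * (\<eta> / \<eta>') ^ k \<le> \<epsilon> / 2 * V" using M(1) by (simp add: field_simps)
  then have "M * \<eta> ^ k \<le> \<epsilon> / 2 * (\<eta>' ^ k * V)" using \<eta>' by (simp add: power_divide field_simps)
  also have "\<dots> \<le> \<epsilon> / 2 * integral ?Q (\<lambda>u. cosine_bump u ^ k)"
    using I \<open>\<epsilon> > 0\<close> by (intro mult_left_mono) auto
  finally have k: "M * \<eta> ^ k \<le> \<epsilon> / 2 * integral ?Q (\<lambda>u. cosine_bump u ^ k)" .
  have pos: "0 < integral ?Q (\<lambda>u. cosine_bump u ^ k)"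
    using I[of k] \<eta>' V by (meson less_le_trans mult_pos_pos zero_less_power)
  have "integral ?Q (\<lambda>u. cosine_bump u ^ k * \<beta> u) \<le>
      integral ?Q (\<lambda>u. (\<beta> 0 + \<epsilon> / 2) * cosine_bump u ^ k + M * \<eta> ^ k)"
  proof (intro integral_le integrable_continuous continuous_intros continuous_cosine_bump \<beta>(1))
    fix u assume u: "u \<in> ?Q"
    have W: "0 \<le> cosine_bump u ^ k" using cosine_bump_bounds(1) by (rule zero_le_power)
    have b0: "0 \<le> \<beta> 0" using \<beta>(2) 0 by blast
    show "cosine_bump u ^ k * \<beta> u \<le> (\<beta> 0 + \<epsilon> / 2) * cosine_bump u ^ k + M * \<eta> ^ k"
    proof (cases "u \<in> P")
      case True
      then have "cosine_bump u ^ k * \<beta> u \<le> \<eta> ^ k * M"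
        using \<eta> M \<beta>(2) u cosine_bump_bounds(1) by (intro mult_mono power_mono) auto
      moreover have "0 \<le> (\<beta> 0 + \<epsilon> / 2) * cosine_bump u ^ k" using W b0 \<open>\<epsilon> > 0\<close> by simp
      ultimately show ?thesis by (simp add: mult.commute)
    next
      case False
      then have "dist (\<beta> u) (\<beta> 0) < \<epsilon> / 2" using u \<delta>(2)[OF u] by (auto simp: P_def)
      then have "\<beta> u \<le> \<beta> 0 + \<epsilon> / 2" unfolding dist_real_def by linarith
      then have "cosine_bump u ^ k * \<beta> u \<le> cosine_bump u ^ k * (\<beta> 0 + \<epsilon> / 2)"
        using W by (rule mult_left_mono)
      moreover have "0 \<le> M * \<eta> ^ k" using M \<eta> by simp
      ultimately show ?thesis by (simp add: mult.commute)
    qed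
  qed
  also have "\<dots> = (\<beta> 0 + \<epsilon> / 2) * integral ?Q (\<lambda>u. cosine_bump u ^ k) + M * \<eta> ^ k"
    using content_unit_cube
    by (subst integral_add) (auto intro!: integrable_continuous continuous_intros continuous_cosine_bump)
  also have "\<dots> \<le> (\<beta> 0 + \<epsilon>) * integral ?Q (\<lambda>u. cosine_bump u ^ k)"
    using k by (simp add: algebra_simps)
  finally show ?thesis using that pos by blast
qed

section \<open>Periodic multipliers\<close>

text \<open>\<open>F\<close> lies in a box \<open>I ^ n\<close>, over which a sum of products
  factors into one-dimensional sums. Each of these is at most twice the sum of
  \<open>1 / (1 + n) ^ 2\<close>, since an integer is \<open>n\<close> or \<open>- n\<close> for a
  natural number \<open>n\<close>.\<close>

lemma int_vec_inverse_square_sum: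
  obtains S where "S \<ge> 0" "\<And>F. finite F \<Longrightarrow> F \<subseteq> (int_vec :: (real^'n) set) \<Longrightarrow>
    (\<Sum>m\<in>F. \<Prod>i\<in>UNIV. 1 / (1 + \<bar>m $ i\<bar>)\<^sup>2) \<le> S"
proof -
  define g where "g z = 1 / (1 + \<bar>z\<bar>)\<^sup>2" for z :: real
  have "summable (\<lambda>n. g (real n))"
    using inverse_squares_sums summable_def by (auto simp: g_def add.commute sums_iff)
  define s where "s = (\<Sum>n. g (real n))"
  have s: "(\<Sum>n\<in>N. g (real n)) \<le> s" if "finite N" for N
    unfolding s_def by (intro sum_le_suminf that \<open>summable _\<close>) (simp add: g_def)
  have "s \<ge> 0" using s[of "{}"] by simp
  have int: "(\<Sum>z\<in>I. g z) \<le> 2 * s" if I: "finite I" "I \<subseteq> \<int>" for I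
  proof -
    define N where "N = (\<lambda>z. nat \<lfloor>\<bar>z\<bar>\<rfloor>) ` I"
    have "finite N" using I by (simp add: N_def)
    have "I \<subseteq> (\<lambda>n. real n) ` N \<union> (\<lambda>n. - real n) ` N"
    proof
      fix z assume z: "z \<in> I"
      then obtain k where k: "z = of_int k" using I(2) by (auto elim: Ints_cases)
      have "nat \<lfloor>\<bar>z\<bar>\<rfloor> \<in> N" using z by (auto simp: N_def)
      moreover have "z = real (nat \<lfloor>\<bar>z\<bar>\<rfloor>) \<or> z = - real (nat \<lfloor>\<bar>z\<bar>\<rfloor>)"
        using k by (cases "k \<ge> 0") (auto simp flip: of_int_abs)
      ultimately show "z \<in> (\<lambda>n. real n) ` N \<union> (\<lambda>n. - real n) ` N" by blast
    qed
    then have "(\<Sum>z\<in>I. g z) \<le> (\<Sum>z\<in>(\<lambda>n. real n) ` N \<union> (\<lambda>n. - real n) ` N. g z)"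
      using \<open>finite N\<close> by (intro sum_mono2) (auto simp: g_def)
    also have "\<dots> \<le> (\<Sum>z\<in>(\<lambda>n. real n) ` N. g z) + (\<Sum>z\<in>(\<lambda>n. - real n) ` N. g z)"
      using \<open>finite N\<close> by (subst sum.union_inter[symmetric]) (auto simp: g_def intro!: sum_nonneg)
    also have "\<dots> = (\<Sum>n\<in>N. g (real n)) + (\<Sum>n\<in>N. g (- real n))"
      by (simp add: sum.reindex inj_on_def)
    also have "\<dots> \<le> 2 * s" using s[OF \<open>finite N\<close>] by (simp add: g_def)
    finally show ?thesis .
  qed
  show ?thesis
  proof
    show "0 \<le> (2 * s) ^ CARD('n)" using \<open>s \<ge> 0\<close> by simp
    fix F :: "(real^'n) set" assume F: "finite F" "F \<subseteq> int_vec"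
    define I where "I = (\<Union>m\<in>F. range (($) m))"
    have I: "finite I" "I \<subseteq> \<int>" using F by (auto simp: I_def int_vec_def)
    have "(\<Sum>m\<in>F. \<Prod>i\<in>UNIV. g (m $ i)) = (\<Sum>h\<in>($) ` F. \<Prod>i\<in>UNIV. g (h i))"
      by (subst sum.reindex) (auto simp: inj_on_def vec_eq_iff)
    also have "\<dots> \<le> (\<Sum>h\<in>PiE (UNIV :: 'n set) (\<lambda>_. I). \<Prod>i\<in>UNIV. g (h i))"
      using I F by (intro sum_mono2 finite_PiE) (auto simp: I_def g_def intro!: prod_nonneg)
    also have "\<dots> = (\<Prod>i\<in>(UNIV::'n set). \<Sum>z\<in>I. g z)"
      using I by (subst prod_sum_PiE) auto
    also have "\<dots> = (\<Sum>z\<in>I. g z) ^ CARD('n)" by simp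
    also have "\<dots> \<le> (2 * s) ^ CARD('n)"
      using int[OF I] by (intro power_mono) (auto simp: g_def intro!: sum_nonneg)
    finally show "(\<Sum>m\<in>F. \<Prod>i\<in>UNIV. 1 / (1 + \<bar>m $ i\<bar>)\<^sup>2) \<le> (2 * s) ^ CARD('n)"
      by (simp add: g_def)
  qed
qed

lemma smooth_family_wave_scalar: "smooth_family (\<lambda>u (t :: real^'n). wave m u)"
  by (intro smooth_family_scalar continuous_wave)

context
  fixes A A' :: "real^'n \<Rightarrow> real^'n"
  assumes A: "linear A" "linear A'" "\<And>x. A' (A x) = x" "\<And>x. A (A' x) = x"
begin

text \<open>The adjoint of the inverse maps integer vectors onto the dual of the lattice spanned by
  the \<open>A (axis i 1)\<close>, so that \<open>wave (frequency m)\<close> is invariant under that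
  lattice for \<open>m\<close> in \<open>int_vec\<close>.\<close>

definition frequency :: "real^'n \<Rightarrow> real^'n" where
  "frequency m = adjoint A' m"

lemma wave_frequency: "wave (frequency m) t = wave m (A' t)"
  using adjoint_works[OF A(2), of t m] by (simp add: wave_def frequency_def inner_commute)

text \<open>Coefficients with respect to the characters of the lattice spanned by the vectors
  \<open>A (axis i 1)\<close>.\<close>

definition fourier_coeff :: "(real^'n \<Rightarrow> complex) \<Rightarrow> real^'n \<Rightarrow> complex" where
  "fourier_coeff H m = integral unit_cube (\<lambda>u. H (- A u) * wave m u)"

lemma continuous_A: "continuous_on S A"
  using A(1) by (simp add: linear_continuous_on linear_conv_bounded_linear)

lemma continuous_A_image:
  assumes "smooth H" shows "continuous_on S (\<lambda>u. H (t - A u))"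
  by (rule continuous_on_compose2[OF smooth_continuous[OF assms]])
    (auto intro!: continuous_intros continuous_A)

text \<open>With \<open>t = A v\<close>, periodicity allows the cube to be translated by
  \<open>v\<close>, which pulls the character out. Hence averaging the translates
  \<open>H (t - A u)\<close> against a trigonometric polynomial in \<open>u\<close> leaves a finite
  sum of characters in \<open>t\<close>.\<close>

lemma integral_shift_coefficient:
  assumes H: "smooth H" "\<And>t i. H (t + A (axis i 1)) = H t" and m: "m \<in> int_vec"
  shows "integral unit_cube (\<lambda>u. H (t - A u) * wave m u) = wave (frequency m) t * fourier_coeff H m"
proof -
  define v where "v = A' t"
  define g where "g u = H (- A u) * wave m u" for u
  have per: "g (u + axis i 1) = g u" for i u
    using H(2)[of "- A (u + axis i 1)" i]
    by (simp add: g_def wave_int_vec_periodic[OF m] linear_add[OF A(1)])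
  have cont: "continuous_on UNIV g"
    unfolding g_def using continuous_A_image[OF H(1), of UNIV 0]
    by (intro continuous_intros continuous_wave) simp
  have "H (t - A u) * wave m u = wave m v * g (u + - v)" for u
    using A(4)[of t] wave_add[of m u "- v"]
    by (simp add: g_def v_def linear_diff[OF A(1)] wave_minus) (simp add: wave_def)
  then have "integral unit_cube (\<lambda>u. H (t - A u) * wave m u) = wave m v * integral unit_cube (\<lambda>u. g (u + - v))"
    by simp
  also have "integral unit_cube (\<lambda>u. g (u + - v)) = integral unit_cube g"
    by (rule integral_cube_shift[OF cont per])
  finally show ?thesis by (simp add: fourier_coeff_def g_def[abs_def] wave_frequency v_def)
qed

lemma smooth_family_A_shift:
  "smooth H \<Longrightarrow> smooth_family (\<lambda>u t. H (t - A u))"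
  by (rule smooth_family_shift[OF _ continuous_A])

text \<open>Instead of integrating by parts, both sides of \<open>integral_shift_coefficient\<close>
  are differentiated in \<open>t\<close> at \<open>0\<close>.\<close>

lemma fourier_coeff_partial:
  assumes H: "smooth H" "\<And>t i. H (t + A (axis i 1)) = H t" and m: "m \<in> int_vec"
  shows "fourier_coeff (partial i H) m = 2 * pi * \<i> * complex_of_real (frequency m $ i) * fourier_coeff H m"
proof -
  have F: "smooth_family (\<lambda>u t. wave m u * H (t - A u))"
    by (intro smooth_family_mult smooth_family_wave_scalar smooth_family_A_shift H(1))
  have eq: "(\<lambda>t. integral unit_cube (\<lambda>u. wave m u * H (t - A u))) = (\<lambda>t. fourier_coeff H m * wave (frequency m) t)"
    using integral_shift_coefficient[OF H m] by (simp add: mult.commute)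
  have d: "(\<lambda>t. H (t - A u)) differentiable (at 0)" for u
    using smooth_differentiable[OF smooth_shift[OF H(1)]] .
  have "partial i (\<lambda>t. integral unit_cube (\<lambda>u. wave m u * H (t - A u))) 0 =
      integral unit_cube (\<lambda>u. partial i (\<lambda>t. wave m u * H (t - A u)) 0)"
    by (rule integral_family_partial(2)[OF F])
  also have "\<dots> = integral unit_cube (\<lambda>u. wave m u * partial i H (- A u))"
    using partial_cmult[OF d] partial_shift[OF smooth_differentiable[OF H(1)], where t = 0] by simp
  also have "\<dots> = fourier_coeff (partial i H) m"
    by (simp add: fourier_coeff_def mult.commute)
  finally have "partial i (\<lambda>t. fourier_coeff H m * wave (frequency m) t) 0 = fourier_coeff (partial i H) m"
    unfolding eq .
  moreover have "partial i (\<lambda>t. fourier_coeff H m * wave (frequency m) t) 0 =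
      fourier_coeff H m * (2 * pi * \<i> * complex_of_real (frequency m $ i) * wave (frequency m) 0)"
    by (simp only: partial_cmult[OF smooth_differentiable[OF smooth_wave]] partial_wave)
  ultimately show ?thesis by (simp add: mult_ac)
qed

lemma periodic_partial:
  assumes "smooth H" "\<And>t i. H (t + A (axis i 1)) = H t"
  shows "partial j H (t + A (axis i 1)) = partial j H t"
proof -
  have "partial j (\<lambda>s. H (s - - A (axis i 1))) t = partial j H (t - - A (axis i 1))"
    by (rule partial_shift[OF smooth_differentiable[OF assms(1)]])
  then show ?thesis using assms(2) by simp
qed

text \<open>Pure derivatives in the direction of the largest coordinate of the frequency suffice:
  that coordinate controls the norm up to the factor \<open>CARD('n)\<close>. The surplus factor
  \<open>2 * pi\<close> per derivative is dropped.\<close>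

lemma fourier_coeff_bound:
  assumes H: "smooth H" "\<And>t i. H (t + A (axis i 1)) = H t" and m: "m \<in> int_vec"
    and M: "\<And>js t. length js \<le> k \<Longrightarrow> cmod (pderivs js H t) \<le> M"
  shows "(1 + norm (frequency m)) ^ k * cmod (fourier_coeff H m) \<le> (1 + real CARD('n)) ^ k * M"
proof -
  have zero: "cmod (fourier_coeff G m) \<le> M" if "smooth G" "\<And>t. cmod (G t) \<le> M" for G
  proof -
    have "0 \<le> M" using that(2)[of 0] norm_ge_zero order_trans by blast
    have "cmod (fourier_coeff G m) \<le> M * measure lborel (unit_cube :: (real^'n) set)"
      unfolding fourier_coeff_def
      using continuous_A_image[OF that(1), of unit_cube 0] that(2) \<open>0 \<le> M\<close>
      by (intro integrable_bound integrable_continuous continuous_intros continuous_wave)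
        (auto simp: norm_mult)
    then show ?thesis by (simp add: content_unit_cube)
  qed
  have deriv: "\<bar>frequency m $ i\<bar> ^ k * cmod (fourier_coeff H m) \<le> M" for i
  proof -
    have "smooth (pderivs (replicate j i) H) \<and> (\<forall>t l. pderivs (replicate j i) H (t + A (axis l 1)) = pderivs (replicate j i) H t) \<and>
      fourier_coeff (pderivs (replicate j i) H) m = (2 * pi * \<i> * complex_of_real (frequency m $ i)) ^ j * fourier_coeff H m" for j
    proof (induction j)
      case 0 then show ?case using H by simp
    next
      case (Suc j)
      then show ?case
        using fourier_coeff_partial[of "pderivs (replicate j i) H" m] periodic_partial[of "pderivs (replicate j i) H"] m
        by (simp add: smooth_partial)
    qed
    then have "cmod ((2 * pi * \<i> * complex_of_real (frequency m $ i)) ^ k * fourier_coeff H m) \<le> M"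
      using zero[of "pderivs (replicate k i) H"] M[of "replicate k i"] by simp
    then have *: "(2 * pi * \<bar>frequency m $ i\<bar>) ^ k * cmod (fourier_coeff H m) \<le> M"
      by (simp add: norm_mult norm_power)
    have "\<bar>frequency m $ i\<bar> ^ k \<le> (2 * pi * \<bar>frequency m $ i\<bar>) ^ k"
      using pi_ge_two mult_right_mono[of 1 "2 * pi" "\<bar>frequency m $ i\<bar>"] by (intro power_mono) auto
    with * show ?thesis by (meson mult_right_mono norm_ge_zero order_trans)
  qed
  obtain i where i: "\<And>j. \<bar>frequency m $ j\<bar> \<le> \<bar>frequency m $ i\<bar>"
  proof -
    define S where "S = (\<lambda>j. \<bar>frequency m $ j\<bar>) ` UNIV"
    have "Max S \<in> S" unfolding S_def by (intro Max_in) auto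
    then obtain i where "Max S = \<bar>frequency m $ i\<bar>" unfolding S_def by blast
    moreover have "\<bar>frequency m $ j\<bar> \<le> Max S" for j unfolding S_def by (intro Max_ge) auto
    ultimately show ?thesis using that[of i] by simp
  qed
  have norm: "norm (frequency m) \<le> real CARD('n) * \<bar>frequency m $ i\<bar>"
    using norm_le_l1_cart[of "frequency m"] sum_mono[of UNIV "\<lambda>j. \<bar>frequency m $ j\<bar>" "\<lambda>_. \<bar>frequency m $ i\<bar>"] i
    by simp
  \<comment> \<open>Combines the estimate of order \<open>k\<close> with that of order 0, which is
    the better one when the largest coordinate is below 1.\<close>
  define \<mu> where "\<mu> = max 1 \<bar>frequency m $ i\<bar>"
  have \<mu>: "\<mu> ^ k * cmod (fourier_coeff H m) \<le> M"
    using deriv[of i] zero[of H] H(1) M[of "[]"] unfolding \<mu>_def max_def by auto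
  have "1 + norm (frequency m) \<le> (1 + real CARD('n)) * \<mu>"
  proof -
    have "real CARD('n) * \<bar>frequency m $ i\<bar> \<le> real CARD('n) * \<mu>" by (rule mult_left_mono) (auto simp: \<mu>_def)
    moreover have "1 \<le> \<mu>" by (simp add: \<mu>_def)
    ultimately have "1 + norm (frequency m) \<le> \<mu> + real CARD('n) * \<mu>" using norm by linarith
    then show ?thesis by (simp add: ring_distribs)
  qed
  then have "(1 + norm (frequency m)) ^ k \<le> (1 + real CARD('n)) ^ k * \<mu> ^ k"
    unfolding power_mult_distrib[symmetric] by (intro power_mono) auto
  then have "(1 + norm (frequency m)) ^ k * cmod (fourier_coeff H m) \<le> (1 + real CARD('n)) ^ k * \<mu> ^ k * cmod (fourier_coeff H m)"
    by (intro mult_right_mono) auto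
  also have "\<dots> \<le> (1 + real CARD('n)) ^ k * M"
    unfolding mult.assoc by (intro mult_left_mono \<mu>) simp
  finally show ?thesis .
qed

text \<open>\<open>adjoint A\<close> inverts \<open>frequency\<close> and is bounded, so sums over
  the dual lattice can be compared with sums over \<open>int_vec\<close>.\<close>

lemma frequency_growth:
  obtains b where "b > 0" "\<And>m. 1 + norm m \<le> b * (1 + norm (frequency m))"
proof -
  have "adjoint A (frequency m) = m" for m
  proof -
    have "x \<bullet> adjoint A (frequency m) = x \<bullet> m" for x
      using adjoint_works[OF A(1), of x "frequency m"] adjoint_works[OF A(2), of "A x" m] A(3)
      by (simp add: frequency_def)
    then show ?thesis using vector_eq_ldot by blast
  qed
  moreover obtain B where B: "B > 0" "\<And>x. norm (adjoint A x) \<le> B * norm x"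
    using linear_bounded_pos[OF adjoint_linear[OF A(1)]] by blast
  ultimately have le: "norm m \<le> B * norm (frequency m)" for m by (metis (no_types))
  show ?thesis
  proof (rule that[of "1 + B"])
    show "1 + norm m \<le> (1 + B) * (1 + norm (frequency m))" for m
      using B(1) le[of m] norm_ge_zero[of "frequency m"] unfolding ring_distribs mult_1 mult_1_right by linarith
  qed (use B(1) in simp)
qed

text \<open>The weight \<open>\<tau>\<close> is the growth order of the modulations.
  \<open>C\<close> and \<open>k\<close> are chosen before \<open>H\<close>, and \<open>M\<close>
  enters linearly, so that one estimate covers a whole family of periodic functions.\<close>

lemma fourier_coeff_sum_bound:
  "\<exists>C\<ge>0. \<exists>k. \<forall>H M F. smooth H \<longrightarrow> (\<forall>t i. H (t + A (axis i 1)) = H t) \<longrightarrow>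
    (\<forall>js t. length js \<le> k \<longrightarrow> cmod (pderivs js H t) \<le> M) \<longrightarrow> finite F \<longrightarrow> F \<subseteq> int_vec \<longrightarrow>
    (\<Sum>m\<in>F. cmod (fourier_coeff H m) * (1 + norm (frequency m)) ^ \<tau>) \<le> C * M"
proof -
  let ?n = "CARD('n)"
  obtain S where S: "S \<ge> 0" "\<And>F. finite F \<Longrightarrow> F \<subseteq> (int_vec :: (real^'n) set) \<Longrightarrow>
    (\<Sum>m\<in>F. \<Prod>i\<in>UNIV. 1 / (1 + \<bar>m $ i\<bar>)\<^sup>2) \<le> S"
    by (rule int_vec_inverse_square_sum) (rule that)
  obtain b where b: "b > 0" "\<And>m. 1 + norm m \<le> b * (1 + norm (frequency m))"
    by (rule frequency_growth) (rule that)
  \<comment> \<open>\<open>\<tau>\<close> derivatives absorb the weight; \<open>2 * ?n\<close> more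
    give the factor \<open>1 / (1 + \<bar>m $ i\<bar>) ^ 2\<close> in every coordinate, which is
    summable.\<close>
  define k where "k = \<tau> + 2 * ?n"
  define C where "C = (1 + real ?n) ^ k * b ^ (2 * ?n)"
  have C: "C \<ge> 0" using b by (simp add: C_def)
  show ?thesis
  proof (intro exI[of _ "C * S"] exI[of _ k] conjI allI impI)
    show "C * S \<ge> 0" using C S by simp
    fix H M F
    assume "smooth H" "\<forall>t i. H (t + A (axis i 1)) = H t" "\<forall>js t. length js \<le> k \<longrightarrow> cmod (pderivs js H t) \<le> M"
    then have H: "smooth H" "\<And>t i. H (t + A (axis i 1)) = H t"
      and M: "\<And>js t. length js \<le> k \<Longrightarrow> cmod (pderivs js H t) \<le> M" by blast+
    assume F: "finite F" "F \<subseteq> (int_vec :: (real^'n) set)"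
    have "0 \<le> M" using M[of "[]" 0] norm_ge_zero order_trans by (metis le0 list.size(3))
    have "cmod (fourier_coeff H m) * (1 + norm (frequency m)) ^ \<tau> \<le> C * M * (\<Prod>i\<in>UNIV. 1 / (1 + \<bar>m $ i\<bar>)\<^sup>2)"
      if "m \<in> F" for m
    proof -
      define N where "N = 1 + norm (frequency m)"
      define P where "P = (\<Prod>i\<in>UNIV. (1 + \<bar>m $ i\<bar>)\<^sup>2)"
      have "N > 0" unfolding N_def by (simp add: add_pos_nonneg)
      have "P > 0" unfolding P_def by (intro prod_pos) (simp add: add_pos_nonneg)
      have "P \<le> (\<Prod>i\<in>(UNIV :: 'n set). (1 + norm m)\<^sup>2)"
        unfolding P_def using component_le_norm_cart[of m] by (intro prod_mono conjI power_mono) auto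
      also have "\<dots> = (1 + norm m) ^ (2 * ?n)" by (simp add: power_mult)
      also have "\<dots> \<le> (b * N) ^ (2 * ?n)" unfolding N_def using b by (intro power_mono) auto
      finally have P: "P \<le> b ^ (2 * ?n) * N ^ (2 * ?n)" by (simp add: power_mult_distrib)
      have "N ^ k * cmod (fourier_coeff H m) \<le> (1 + real ?n) ^ k * M"
        unfolding N_def using F that by (intro fourier_coeff_bound H M) auto
      then have "N ^ \<tau> * cmod (fourier_coeff H m) * N ^ (2 * ?n) \<le> (1 + real ?n) ^ k * M"
        by (simp add: k_def power_add mult_ac)
      then have "N ^ \<tau> * cmod (fourier_coeff H m) * (b ^ (2 * ?n) * N ^ (2 * ?n)) \<le> C * M"
        using mult_left_mono[of _ _ "b ^ (2 * ?n)"] b(1) by (simp add: C_def mult_ac)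
      moreover have "N ^ \<tau> * cmod (fourier_coeff H m) * P \<le> N ^ \<tau> * cmod (fourier_coeff H m) * (b ^ (2 * ?n) * N ^ (2 * ?n))"
        using \<open>N > 0\<close> by (intro mult_left_mono P) simp
      ultimately have "N ^ \<tau> * cmod (fourier_coeff H m) * P \<le> C * M" by (rule order_trans[rotated])
      then show ?thesis
        using \<open>P > 0\<close> by (simp add: prod_dividef P_def[symmetric] N_def[symmetric] field_simps)
    qed
    then have "(\<Sum>m\<in>F. cmod (fourier_coeff H m) * (1 + norm (frequency m)) ^ \<tau>) \<le>
        C * M * (\<Sum>m\<in>F. \<Prod>i\<in>UNIV. 1 / (1 + \<bar>m $ i\<bar>)\<^sup>2)"
      unfolding sum_distrib_left by (rule sum_mono)
    also have "\<dots> \<le> C * M * S" using C \<open>0 \<le> M\<close> by (intro mult_left_mono S F) auto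
    finally show "(\<Sum>m\<in>F. cmod (fourier_coeff H m) * (1 + norm (frequency m)) ^ \<tau>) \<le> C * S * M"
      by (simp add: mult_ac)
  qed
qed

end

locale modulation_seminorm = dominated_seminorm q for q :: "(real^'n \<Rightarrow> complex) \<Rightarrow> real" +
  fixes C\<^sub>0 :: real and \<tau> :: nat
  assumes C0_pos: "C\<^sub>0 > 0"
    and modulation_bound: "f \<in> test_functions UNIV \<Longrightarrow> q (\<lambda>t. wave \<xi> t * f t) \<le> C\<^sub>0 * (1 + norm \<xi>) ^ \<tau> * q f"

begin

text \<open>\<open>H * \<phi>\<close> is compared with a finite sum \<open>P\<close> of modulations
  of \<open>\<phi>\<close>, obtained by averaging the translates of \<open>H\<close> against a
  nonnegative trigonometric kernel of mass 1. Such a kernel changes each Fourier coefficient by a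
  factor of modulus at most 1, so \<open>q P\<close> is bounded independently of the kernel, while
  concentrating the kernel makes the error small in \<open>q\<close>.\<close>

theorem periodic_multiplier_bound:
  fixes A A' :: "real^'n \<Rightarrow> real^'n"
  assumes A: "linear A" "linear A'" "\<And>x. A' (A x) = x" "\<And>x. A (A' x) = x"
  shows "\<exists>C\<ge>0. \<exists>k. \<forall>H M. smooth H \<longrightarrow> (\<forall>t i. H (t + A (axis i 1)) = H t) \<longrightarrow>
    (\<forall>js t. length js \<le> k \<longrightarrow> cmod (pderivs js H t) \<le> M) \<longrightarrow>
    (\<forall>\<phi>\<in>test_functions UNIV. q (\<lambda>t. H t * \<phi> t) \<le> C * M * q \<phi>)"
proof -
  let ?f = "fourier_coeff A" and ?\<nu> = "frequency A'"
  obtain C k where C: "C \<ge> 0" and sum: "\<forall>H M F. smooth H \<longrightarrow> (\<forall>t i. H (t + A (axis i 1)) = H t) \<longrightarrow>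
    (\<forall>js t. length js \<le> k \<longrightarrow> cmod (pderivs js H t) \<le> M) \<longrightarrow> finite F \<longrightarrow> F \<subseteq> int_vec \<longrightarrow>
    (\<Sum>m\<in>F. cmod (?f H m) * (1 + norm (?\<nu> m)) ^ \<tau>) \<le> C * M"
    using fourier_coeff_sum_bound[OF A, of \<tau>] by blast
  have "q (\<lambda>t. H t * \<phi> t) \<le> C\<^sub>0 * C * M * q \<phi>"
    if H: "smooth H" "\<And>t i. H (t + A (axis i 1)) = H t"
      and M: "\<And>js t. length js \<le> k \<Longrightarrow> cmod (pderivs js H t) \<le> M" and \<phi>: "\<phi> \<in> test_functions UNIV" for H M \<phi>
  proof (rule field_le_epsilon)
    fix \<epsilon> :: real assume \<epsilon>: "\<epsilon> > 0"
    obtain K where K: "smooth \<phi>" "compact K" "\<And>t. t \<notin> K \<Longrightarrow> \<phi> t = 0"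
      using \<phi> by (rule test_functionsE) (rule that)
    have "A 0 = 0" using A(1) by (rule linear_0)
    \<comment> \<open>The error made when \<open>H\<close> is replaced by its translate by
      \<open>A u\<close>. Its seminorm \<open>\<beta> u\<close> is continuous and vanishes at
      \<open>u = 0\<close>, so a concentrated kernel gives it a small mean.\<close>
    define E where "E u t = (H t + (-1) * H (t - A u)) * \<phi> t" for u t
    have E: "smooth_family E"
      unfolding E_def
      by (intro smooth_family_mult smooth_family_add smooth_imp_smooth_family H(1) K(1) smooth_const
        smooth_family_A_shift[OF A])
    have E0: "E u t = 0" if "t \<notin> K" for u t using K(3)[OF that] by (simp add: E_def)
    define \<beta> where "\<beta> u = q (E u)" for u
    have \<beta>: "continuous_on unit_cube \<beta>" "\<And>u. u \<in> unit_cube \<Longrightarrow> 0 \<le> \<beta> u"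
      unfolding \<beta>_def using seminorm_family_continuous[OF E K(2)] E0 nonneg[OF family_test_function[OF E K(2)]] by blast+
    have \<beta>0: "\<beta> 0 = 0"
      unfolding \<beta>_def E_def \<open>A 0 = 0\<close> using zero by simp
    let ?W = "\<lambda>n u. cosine_bump (u :: real^'n) ^ n"
    obtain n where n: "0 < integral unit_cube (?W n)"
        "integral unit_cube (\<lambda>u. ?W n u * \<beta> u) \<le> (\<beta> 0 + \<epsilon>) * integral unit_cube (?W n)"
      by (rule cosine_bump_concentrates[OF \<beta> \<epsilon>]) (assumption, rule that)
    define I where "I = integral unit_cube (?W n)"
    have I: "I > 0" using n(1) by (simp add: I_def)
    define w where "w u = 1 / I * ?W n u" for u
    have w: "continuous_on S w" "w u \<ge> 0" for S u
      unfolding w_def using I cosine_bump_bounds(1)[of u]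
      by (auto intro!: continuous_intros continuous_cosine_bump)
    have int_w: "integral unit_cube w = 1"
      using I unfolding w_def by (simp add: I_def)
    have "trig_poly (\<lambda>u. complex_of_real (w u))"
      unfolding w_def of_real_mult of_real_power
      by (intro trig_poly_mult trig_poly_power trig_poly_const trig_poly_cosine_bump)
    then obtain F c where F: "finite F" "F \<subseteq> int_vec" "\<And>u. complex_of_real (w u) = (\<Sum>m\<in>F. c m * wave m u)"
        "\<And>m. m \<in> F \<Longrightarrow> cmod (c m) \<le> integral unit_cube w"
      by (rule trig_poly_coefficients[OF _ w]) (rule that)
    \<comment> \<open>\<open>\<phi>\<close> times the average of the translates of \<open>H\<close>,
      with the average written out in characters.\<close>
    define P where "P t = (\<Sum>m\<in>F. (c m * ?f H m) * (wave (?\<nu> m) t * \<phi> t))" for t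
    have PD: "P \<in> test_functions UNIV"
      unfolding P_def by (intro test_functions_sum test_functions_cmult test_functions_mult(1) \<phi> smooth_wave)
    have "smooth_family (\<lambda>u (t :: real^'n). complex_of_real (w u))"
      by (intro smooth_family_scalar continuous_intros w)
    then have wE: "smooth_family (\<lambda>u t. complex_of_real (w u) * E u t)"
      by (rule smooth_family_mult[OF _ E])
    have "integral unit_cube (\<lambda>u. complex_of_real (w u) * E u t) = H t * \<phi> t - P t" for t
    proof -
      have cont: "continuous_on unit_cube (\<lambda>u. H (t - A u))" by (rule continuous_A_image[OF A H(1)])
      have cw: "continuous_on unit_cube (\<lambda>u. complex_of_real (w u))" by (intro continuous_intros w)
      have iw: "integral unit_cube (\<lambda>u. complex_of_real (w u)) = 1"
        using integral_linear[OF integrable_continuous[OF w(1)] bounded_linear_of_real[where 'a = complex]] int_w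
        by (simp add: o_def)
      have iH: "integral unit_cube (\<lambda>u. complex_of_real (w u) * H (t - A u)) = (\<Sum>m\<in>F. c m * (wave (?\<nu> m) t * ?f H m))"
      proof -
        have "integral unit_cube (\<lambda>u. complex_of_real (w u) * H (t - A u)) =
            integral unit_cube (\<lambda>u. \<Sum>m\<in>F. c m * (H (t - A u) * wave m u))"
          unfolding F(3) sum_distrib_right by (simp add: ac_simps)
        also have "\<dots> = (\<Sum>m\<in>F. integral unit_cube (\<lambda>u. c m * (H (t - A u) * wave m u)))"
          by (intro integral_sum F(1) integrable_continuous continuous_intros continuous_wave cont)
        also have "\<dots> = (\<Sum>m\<in>F. c m * (wave (?\<nu> m) t * ?f H m))"
          using F(2) by (intro sum.cong refl) (auto simp: integral_shift_coefficient[OF A H])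
        finally show ?thesis .
      qed
      have "integral unit_cube (\<lambda>u. complex_of_real (w u) * E u t) =
          integral unit_cube (\<lambda>u. H t * \<phi> t * complex_of_real (w u) - \<phi> t * (complex_of_real (w u) * H (t - A u)))"
        by (simp add: E_def algebra_simps)
      also have "\<dots> = H t * \<phi> t * 1 - \<phi> t * (\<Sum>m\<in>F. c m * (wave (?\<nu> m) t * ?f H m))"
        unfolding iw[symmetric] iH[symmetric]
        by (subst integral_diff) (auto intro!: integrable_continuous continuous_intros cont cw)
      also have "\<phi> t * (\<Sum>m\<in>F. c m * (wave (?\<nu> m) t * ?f H m)) = P t"
        unfolding P_def sum_distrib_left by (simp add: ac_simps)
      finally show ?thesis by simp
    qed
    then have "q (\<lambda>t. H t * \<phi> t - P t) \<le> integral unit_cube (\<lambda>u. q (\<lambda>t. complex_of_real (w u) * E u t))"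
      using minkowski_integral[OF wE K(2), of "vec (- (1 / 2))" "vec (1 / 2)"] E0 by simp
    also have "\<dots> = integral unit_cube (\<lambda>u. 1 / I * (?W n u * \<beta> u))"
    proof (rule integral_cong)
      fix u assume "u \<in> (unit_cube :: (real^'n) set)"
      then have "E u \<in> test_functions UNIV" using family_test_function[OF E K(2)] E0 by blast
      then show "q (\<lambda>t. complex_of_real (w u) * E u t) = 1 / I * (?W n u * \<beta> u)"
        using w(2)[of u] by (simp add: homogeneous \<beta>_def) (simp add: w_def)
    qed
    also have "\<dots> = 1 / I * integral unit_cube (\<lambda>u. ?W n u * \<beta> u)" by simp
    also have "\<dots> \<le> 1 / I * (\<epsilon> * I)"
      using n(2) I \<beta>0 by (intro mult_left_mono) (auto simp: I_def)
    also have "\<dots> = \<epsilon>" using I by simp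
    finally have 1: "q (\<lambda>t. H t * \<phi> t - P t) \<le> \<epsilon>" .
    have "q P \<le> (\<Sum>m\<in>F. cmod (c m * ?f H m) * q (\<lambda>t. wave (?\<nu> m) t * \<phi> t))"
      unfolding P_def by (intro triangle_sum F(1) test_functions_mult(1) \<phi> smooth_wave)
    also have "\<dots> \<le> (\<Sum>m\<in>F. C\<^sub>0 * q \<phi> * (cmod (?f H m) * (1 + norm (?\<nu> m)) ^ \<tau>))"
    proof (rule sum_mono)
      fix m assume "m \<in> F"
      \<comment> \<open>The kernel is nonnegative of mass 1, which bounds its coefficients.\<close>
      then have "cmod (c m) \<le> 1" using F(4) int_w by simp
      then have "cmod (c m * ?f H m) \<le> cmod (?f H m)" by (simp add: norm_mult mult_left_le_one_le)
      then have "cmod (c m * ?f H m) * q (\<lambda>t. wave (?\<nu> m) t * \<phi> t) \<le>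
          cmod (?f H m) * (C\<^sub>0 * (1 + norm (?\<nu> m)) ^ \<tau> * q \<phi>)"
        by (intro mult_mono modulation_bound \<phi> nonneg test_functions_mult(1) smooth_wave) auto
      then show "cmod (c m * ?f H m) * q (\<lambda>t. wave (?\<nu> m) t * \<phi> t) \<le>
          C\<^sub>0 * q \<phi> * (cmod (?f H m) * (1 + norm (?\<nu> m)) ^ \<tau>)"
        by (simp add: mult_ac)
    qed
    also have "\<dots> \<le> C\<^sub>0 * q \<phi> * (C * M)"
      unfolding sum_distrib_left[symmetric] using C0_pos nonneg[OF \<phi>] H M F by (intro mult_left_mono sum[rule_format]) auto
    finally have 2: "q P \<le> C\<^sub>0 * q \<phi> * (C * M)" .
    have "q (\<lambda>t. H t * \<phi> t) \<le> q P + q (\<lambda>t. H t * \<phi> t - P t)"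
      by (rule triangle_diff[OF test_functions_mult(1)[OF \<phi> H(1)] PD])
    with 1 2 show "q (\<lambda>t. H t * \<phi> t) \<le> C\<^sub>0 * C * M * q \<phi> + \<epsilon>" by (simp add: mult_ac)
  qed
  then show ?thesis using C C0_pos by (intro exI[of _ "C\<^sub>0 * C"] conjI exI[of _ k]) auto
qed

end

section \<open>The frame operator\<close>

lemma integrable_compact_support:
  fixes g :: "'a::euclidean_space \<Rightarrow> complex"
  assumes "continuous_on UNIV g" "\<And>x. x \<notin> cbox a b \<Longrightarrow> g x = 0"
  shows "integrable lborel g" "(LINT x|lborel. g x) = integral (cbox a b) g"
proof -
  have "(\<lambda>x. indicator (cbox a b) x *\<^sub>R g x) = g"
    using assms(2) by (auto simp: indicator_def)
  then show *: "integrable lborel g"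
    using borel_integrable_compact[of "cbox a b" g] continuous_on_subset[OF assms(1)] by simp
  have "(LINT x|lborel. g x) = integral UNIV g"
    by (rule integral_lborel[OF *, symmetric])
  also have "\<dots> = integral (cbox a b) g"
    using assms(2)
    by (subst integral_restrict_UNIV[symmetric], intro integral_cong) auto
  finally show "(LINT x|lborel. g x) = integral (cbox a b) g" .
qed

lemma lborel_integral_reflect:
  fixes g :: "real^'n \<Rightarrow> complex"
  assumes "g \<in> borel_measurable borel"
  shows "(LINT x|lborel. g (t - x)) = (LINT x|lborel. g x)"
proof -
  have "lborel = density (distr lborel borel (\<lambda>x. t + (\<Sum>j\<in>Basis. ((- 1) * (x \<bullet> j)) *\<^sub>R j)))
      (\<lambda>_. ennreal (\<Prod>j\<in>(Basis :: (real^'n) set). \<bar>- 1\<bar>))"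
    by (rule lborel_affine_euclidean[where c = "\<lambda>_. - 1"]) auto
  also have "\<dots> = distr lborel borel (\<lambda>x. t - x)"
    by (simp add: sum_negf euclidean_representation density_1)
  finally have "(LINT x|lborel. g x) = (LINT x|distr lborel borel (\<lambda>x. t - x). g x)" by simp
  also have "\<dots> = (LINT x|lborel. g (t - x))"
    by (rule integral_distr) (use assms in auto)
  finally show ?thesis by simp
qed

lemma bounded_obtain_cbox:
  assumes "bounded (S :: (real^'n) set)" obtains a b where "S \<subseteq> cbox a b"
  using bounded_subset_cbox_symmetric[OF assms] by blast

lemma test_function_integrable:
  assumes "f \<in> test_functions UNIV" "continuous_on UNIV g"
  shows "integrable lborel (\<lambda>x. f x * g x)" "integrable lborel (\<lambda>x. g x * f x)"
proof -
  obtain K where K: "smooth f" "compact K" "\<And>t. t \<notin> K \<Longrightarrow> f t = 0"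
    using assms(1) by (rule test_functionsE) (rule that)
  obtain a b where "K \<subseteq> cbox a b" using bounded_obtain_cbox[OF compact_imp_bounded[OF K(2)]] .
  with K assms(2) smooth_continuous[OF K(1)] show "integrable lborel (\<lambda>x. f x * g x)"
    by (intro integrable_compact_support(1)[of _ a b]) (auto intro!: continuous_intros)
  then show "integrable lborel (\<lambda>x. g x * f x)" by (simp add: mult.commute)
qed

lemma twisted_translation_wave:
  "twisted_translation B x f = (\<lambda>t. f (t - x) * wave (- (B *v x)) (t - x))"
  by (auto simp: twisted_translation_def wave_def inner_commute)

lemma minus_matrix_vector: "(- B) *v x = - (B *v x)" for B :: "real^'n^'m"
  by (simp add: vec_eq_iff matrix_vector_mult_def sum_negf)

lemma test_functions_twisted:
  assumes "f \<in> test_functions U"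
  shows "twisted_translation B x f \<in> test_functions UNIV"
proof -
  have "(\<lambda>t. f t * wave (- (B *v x)) t) \<in> test_functions U"
    by (rule test_functions_mult(2)[OF assms smooth_wave])
  from test_functions_shift[OF this] show ?thesis by (simp add: twisted_translation_wave)
qed

abbreviation pairing :: "(real^'n \<Rightarrow> complex) \<Rightarrow> (real^'n \<Rightarrow> complex) \<Rightarrow> complex" where
  "pairing f g \<equiv> LINT x|lborel. f x * g x"

text \<open>For a test function \<open>\<phi>\<close> only finitely many coefficients are non-zero, so that no infinite sum is needed.\<close>

definition frame_operator ::
    "real^'n^'n \<Rightarrow> (real^'n) set \<Rightarrow> (real^'n \<Rightarrow> complex) \<Rightarrow> (real^'n \<Rightarrow> complex) \<Rightarrow> (real^'n \<Rightarrow> complex) \<Rightarrow> real^'n \<Rightarrow> complex" where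
  "frame_operator B \<Lambda> \<theta> \<psi> \<phi> = (\<lambda>t. \<Sum>l\<in>{l\<in>\<Lambda>. pairing \<phi> (twisted_translation (- B) l \<theta>) \<noteq> 0}.
     pairing \<phi> (twisted_translation (- B) l \<theta>) * twisted_translation B l \<psi> t)"

locale tiling_set =
  fixes \<Lambda> U :: "(real^'n) set"
  assumes open_U: "open U" and bounded_U: "bounded U" and zero_U: "0 \<in> U"
    and disjoint: "disjoint_family_on (\<lambda>l. (+) l ` U) \<Lambda>"
begin

lemma translate_unique:
  assumes "l \<in> \<Lambda>" "l' \<in> \<Lambda>" "t - l \<in> U" "t - l' \<in> U"
  shows "l = l'"
proof (rule ccontr)
  assume "l \<noteq> l'"
  then have "(+) l ` U \<inter> (+) l' ` U = {}" using disjoint assms unfolding disjoint_family_on_def by blast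
  moreover have "t \<in> (+) l ` U" "t \<in> (+) l' ` U"
    using imageI[OF assms(3), of "(+) l"] imageI[OF assms(4), of "(+) l'"] by simp_all
  ultimately show False by blast
qed

text \<open>If the ball of radius \<open>r\<close> lies in \<open>U\<close>, distinct points of
  \<open>\<Lambda>\<close> are at least \<open>r\<close> apart: otherwise \<open>l\<close> would
  belong to both \<open>l + U\<close> and \<open>l' + U\<close>. Hence each ball of a finite cover
  with radius \<open>r / 2\<close> contains at most one point.\<close>

lemma finite_bounded_part: "finite {l \<in> \<Lambda>. norm l \<le> R}"
proof -
  obtain r where r: "r > 0" "ball 0 r \<subseteq> U" using open_U zero_U open_contains_ball by blast
  obtain k where k: "finite k" "cball (0 :: real^'n) R \<subseteq> (\<Union>x\<in>k. ball x (r / 2))"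
    using conjunct2[OF compact_eq_totally_bounded[THEN iffD1, OF compact_cball], rule_format, of "r / 2" 0 R] r(1)
    by auto
  have "\<exists>x\<in>k. l \<in> ball x (r / 2)" if "l \<in> {l \<in> \<Lambda>. norm l \<le> R}" for l
  proof -
    have "l \<in> cball 0 R" using that by simp
    then show ?thesis using k(2) by blast
  qed
  then obtain c where c: "\<And>l. l \<in> {l \<in> \<Lambda>. norm l \<le> R} \<Longrightarrow> c l \<in> k \<and> l \<in> ball (c l) (r / 2)" by metis
  have "inj_on c {l \<in> \<Lambda>. norm l \<le> R}"
  proof (rule inj_onI)
    fix l l' assume l: "l \<in> {l \<in> \<Lambda>. norm l \<le> R}" "l' \<in> {l \<in> \<Lambda>. norm l \<le> R}" "c l = c l'"
    then have "dist (c l) l < r / 2" "dist (c l) l' < r / 2" using c[OF l(1)] c[OF l(2)] by simp_all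
    then have "dist l l' < r" by (rule dist_triangle_half_r)
    then have "l - l' \<in> U" "l - l \<in> U" using r zero_U by (auto simp: dist_norm)
    then show "l = l'" using translate_unique l by blast
  qed
  moreover have "c ` {l \<in> \<Lambda>. norm l \<le> R} \<subseteq> k" using c by blast
  ultimately show ?thesis using k(1) by (meson finite_imageD finite_subset)
qed

lemma U_bound: obtains R where "R > 0" "\<And>u. u \<in> U \<Longrightarrow> norm u \<le> R"
  using bounded_U by (auto simp: bounded_pos)

text \<open>The supports meet only if \<open>l\<close> is bounded by the sum of their radii. Phases
  do not affect supports, so one \<open>R\<close> serves every \<open>B\<close>.\<close>

lemma pairing_eventually_zero:
  assumes "\<phi> \<in> test_functions UNIV" "\<theta> \<in> test_functions U"
  obtains R where "\<And>B l t. norm l > R \<Longrightarrow> \<phi> t * twisted_translation B l \<theta> t = 0"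
    "\<And>B l. norm l > R \<Longrightarrow> pairing \<phi> (twisted_translation B l \<theta>) = 0"
proof -
  obtain K where K: "compact K" "\<And>t. t \<notin> K \<Longrightarrow> \<phi> t = 0"
    using assms(1) by (rule test_functionsE) (rule that)
  obtain L where L: "L \<subseteq> U" "\<And>t. t \<notin> L \<Longrightarrow> \<theta> t = 0"
    using assms(2) by (rule test_functionsE) (rule that)
  obtain R1 where R1: "\<And>t. t \<in> K \<Longrightarrow> norm t \<le> R1"
    using compact_imp_bounded[OF K(1)] by (auto simp: bounded_iff)
  obtain R2 where R2: "\<And>u. u \<in> U \<Longrightarrow> norm u \<le> R2" by (rule U_bound) (rule that)
  have zero: "\<phi> s * twisted_translation B l \<theta> s = 0" if "norm l > R1 + R2" for B l s
  proof (rule ccontr)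
    assume "\<phi> s * twisted_translation B l \<theta> s \<noteq> 0"
    then have "s \<in> K" "s - l \<in> U" using K(2) L by (auto simp: twisted_translation_wave)
    then have "norm s \<le> R1" "norm (s - l) \<le> R2" using R1 R2 by blast+
    then show False using that norm_triangle_ineq4[of s "s - l"] by simp
  qed
  show ?thesis by (rule that[of "R1 + R2"]) (simp_all add: zero del: mult_eq_0_iff)
qed

lemma frame_operator_eq:
  assumes "finite S" "S \<subseteq> \<Lambda>"
    and "\<And>l. l \<in> \<Lambda> - S \<Longrightarrow> pairing \<phi> (twisted_translation (- B) l \<theta>) = 0"
  shows "frame_operator B \<Lambda> \<theta> \<psi> \<phi> =
    (\<lambda>t. \<Sum>l\<in>S. pairing \<phi> (twisted_translation (- B) l \<theta>) * twisted_translation B l \<psi> t)"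
  unfolding frame_operator_def
  by (intro ext sum.mono_neutral_left) (use assms in auto)

lemma finite_coefficients:
  assumes "\<phi> \<in> test_functions UNIV" "\<theta> \<in> test_functions U"
  shows "finite {l\<in>\<Lambda>. pairing \<phi> (twisted_translation B l \<theta>) \<noteq> 0}"
proof -
  obtain R where R: "\<And>B l. norm l > R \<Longrightarrow> pairing \<phi> (twisted_translation B l \<theta>) = 0"
    by (rule pairing_eventually_zero[OF assms]) (rule that)
  show ?thesis
    by (rule finite_subset[OF _ finite_bounded_part[of R]]) (use R in force)
qed

lemma frame_operator_test_function:
  assumes "\<psi> \<in> test_functions U"
  shows "frame_operator B \<Lambda> \<theta> \<psi> \<phi> \<in> test_functions UNIV"
  unfolding frame_operator_def by (intro test_functions_sum test_functions_cmult test_functions_twisted[OF assms])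

end

lemma lattice_basis:
  fixes \<Lambda> :: "(real^'n) set"
  assumes "span \<Lambda> = UNIV"
  obtains A A' :: "real^'n \<Rightarrow> real^'n" where "linear A" "linear A'" "\<And>x. A' (A x) = x" "\<And>x. A (A' x) = x"
    "\<And>i. A (axis i 1) \<in> \<Lambda>"
proof -
  obtain b where b: "b \<subseteq> \<Lambda>" "independent b" "\<Lambda> \<subseteq> span b"
    using maximal_independent_subset[of \<Lambda>] by blast
  have span: "span b = UNIV" using b(3) assms span_mono[of \<Lambda> "span b"] by (simp add: span_span top.extremum_unique)
  have "card b = CARD('n)"
    using dim_eq_card_independent[OF b(2)] span dim_span[of b] by (simp add: dim_UNIV)
  moreover have "finite b" using b(2) by (rule independent_imp_finite)
  ultimately obtain f where f: "bij_betw f (UNIV :: 'n set) b"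
    using finite_same_card_bij[of "UNIV :: 'n set" b] by auto
  define A where "A u = (\<Sum>i\<in>UNIV. u $ i *\<^sub>R f i)" for u :: "real^'n"
  have lin: "linear A"
    by (rule linearI) (simp_all add: A_def sum.distrib scaleR_add_left scaleR_sum_right)
  have ax: "A (axis i 1) = f i" for i
    unfolding A_def axis_def by (simp add: if_distrib[of "\<lambda>c. c *\<^sub>R _"] cong: if_cong)
  have "b \<subseteq> range A" using f ax unfolding bij_betw_def by (metis image_subset_iff rangeI)
  then have "surj A"
    using span span_minimal[of b "range A"] linear_subspace_image[OF lin subspace_UNIV] by auto
  then obtain A' where "linear A'" "\<forall>x. A' (A x) = x" "\<forall>x. A (A' x) = x"
    using linear_surjective_isomorphism[OF lin] by blast
  moreover have "A (axis i 1) \<in> \<Lambda>" for i using ax f b(1) by (auto simp: bij_betw_def)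
  ultimately show ?thesis using that lin by blast
qed

lemma bounded_continuous_on_box:
  fixes g :: "'a::euclidean_space \<times> 'b::euclidean_space \<Rightarrow> complex"
  assumes "continuous_on UNIV g" "compact K"
  obtains M where "M \<ge> 0" "\<And>x t. x \<in> cbox a b \<Longrightarrow> t \<in> K \<Longrightarrow> cmod (g (x, t)) \<le> M"
proof -
  have "bounded (g ` (cbox a b \<times> K))"
    by (intro compact_imp_bounded compact_continuous_image compact_Times compact_cbox assms(2) continuous_on_subset[OF assms(1)]) simp
  then obtain M where "M > 0" "\<And>z. z \<in> cbox a b \<times> K \<Longrightarrow> cmod (g z) \<le> M"
    unfolding bounded_pos by blast
  then show ?thesis using that[of M] by auto
qed

locale tf_seminorm = modulation_seminorm +
  assumes translation_bound: "f \<in> test_functions UNIV \<Longrightarrow> q (\<lambda>t. f (t - x)) \<le> C\<^sub>0 * (1 + norm x) ^ \<tau> * q f"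

section \<open>Periodization and the integral form of the frame operator\<close>

context tiling_set
begin

text \<open>Disjointness leaves at most one index in the sum. For a function supported in
  \<open>U\<close> this is the sum of all its translates, without any question of
  convergence.\<close>

definition periodization :: "(real^'n \<Rightarrow> complex) \<Rightarrow> real^'n \<Rightarrow> complex" where
  "periodization f t = (\<Sum>l\<in>{l\<in>\<Lambda>. t - l \<in> U}. f (t - l))"

lemma periodization_on_translate:
  assumes "l \<in> \<Lambda>" "t - l \<in> U"
  shows "periodization f t = f (t - l)"
proof -
  have "{l\<in>\<Lambda>. t - l \<in> U} = {l}" using assms translate_unique by blast
  then show ?thesis by (simp add: periodization_def)
qed

lemma periodization_outside: "(\<And>l. l \<in> \<Lambda> \<Longrightarrow> t - l \<in> U \<Longrightarrow> f (t - l) = 0) \<Longrightarrow> periodization f t = 0"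
  unfolding periodization_def by (rule sum.neutral) auto

text \<open>Near a given point only finitely many translates of \<open>K\<close> occur, so the
  complement of their union is locally a finite intersection of open sets.\<close>

lemma open_gap:
  assumes "compact K" "K \<subseteq> U"
  shows "open {t. \<forall>l\<in>\<Lambda>. t - l \<notin> K}"
proof -
  obtain R where R: "\<And>u. u \<in> U \<Longrightarrow> norm u \<le> R" by (rule U_bound) (rule that)
  have "\<exists>S. open S \<and> t \<in> S \<and> S \<subseteq> {t. \<forall>l\<in>\<Lambda>. t - l \<notin> K}" if t: "\<forall>l\<in>\<Lambda>. t - l \<notin> K" for t
  proof -
    \<comment> \<open>Every \<open>l\<close> for which \<open>l + K\<close> meets the ball of radius
      1 about \<open>t\<close>: points of \<open>K\<close> have norm at most
      \<open>R\<close>.\<close>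
    define F where "F = {l \<in> \<Lambda>. norm l \<le> norm t + 1 + R}"
    define S where "S = ball t 1 \<inter> (\<Inter>l\<in>F. - ((+) l ` K))"
    have "finite F" unfolding F_def by (rule finite_bounded_part)
    then have "open S"
      unfolding S_def using assms(1)
      by (intro open_Int open_ball open_INT ballI open_Compl compact_imp_closed compact_translation) auto
    moreover have "t \<in> S"
      unfolding S_def F_def using t by (auto simp: add_diff_cancel_left')
    moreover have "s - l \<notin> K" if "s \<in> S" "l \<in> \<Lambda>" for s l
    proof
      assume "s - l \<in> K"
      then have "norm (s - l) \<le> R" using assms(2) R by blast
      moreover have "norm (s - t) < 1" using that(1) by (simp add: S_def dist_norm norm_minus_commute)
      moreover have "norm l \<le> norm t + norm (s - t) + norm (s - l)"
        using norm_triangle_ineq4[of s "s - l"] norm_triangle_ineq[of t "s - t"] by simp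
      ultimately have "l \<in> F" using that(2) by (simp add: F_def)
      then have "s \<notin> (+) l ` K" using that(1) by (auto simp: S_def)
      moreover have "s \<in> (+) l ` K" using imageI[OF \<open>s - l \<in> K\<close>, of "(+) l"] by simp
      ultimately show False by blast
    qed
    ultimately show ?thesis by blast
  qed
  then show ?thesis by (subst open_subopen) blast
qed

context
  fixes f :: "real^'n \<Rightarrow> complex" and K
  assumes f: "smooth f" "compact K" "K \<subseteq> U" "\<And>t. t \<notin> K \<Longrightarrow> f t = 0"
begin

text \<open>Around each point the periodization is either a single translate of \<open>f\<close> (on
  \<open>l + U\<close>) or zero (off all \<open>l + K\<close>), and these open sets cover the space
  because \<open>K \<subseteq> U\<close>. So every value of a derivative is a value of the same
  derivative of \<open>f\<close> on \<open>K\<close>, or zero.\<close>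

lemma pderivs_periodization:
  shows "smooth (periodization f)"
    "(\<And>t. t \<in> K \<Longrightarrow> cmod (pderivs js f t) \<le> M) \<Longrightarrow> M \<ge> 0 \<Longrightarrow> cmod (pderivs js (periodization f) t) \<le> M"
proof -
  have loc: "pderivs js (periodization f) differentiable (at t) \<and>
      (pderivs js (periodization f) t = 0 \<or> (\<exists>l. pderivs js (periodization f) t = pderivs js f (t - l) \<and> t - l \<in> K))"
    for js t
  proof (cases "\<exists>l\<in>\<Lambda>. t - l \<in> K")
    case True
    then obtain l where l: "l \<in> \<Lambda>" "t - l \<in> K" by blast
    define S where "S = (\<lambda>t. t - l) -` U"
    have S: "open S" "t \<in> S"
      unfolding S_def using l f(3) by (auto intro!: open_vimage open_U continuous_intros)
    have eq: "f (s - l) = periodization f s" if "s \<in> S" for s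
      using periodization_on_translate[OF l(1), of s f] that by (simp add: S_def)
    show ?thesis
      using pderivs_cong_open[OF S(1) eq smooth_shift[OF f(1)] S(2), where js = js] l(2)
      by (auto simp: pderivs_shift[OF f(1)])
  next
    case False
    define S where "S = {t. \<forall>l\<in>\<Lambda>. t - l \<notin> K}"
    have S: "open S" "t \<in> S" unfolding S_def using open_gap[OF f(2,3)] False by auto
    have eq: "0 = periodization f s" if "s \<in> S" for s
      using that f(4) by (subst periodization_outside) (auto simp: S_def)
    show ?thesis
      using pderivs_cong_open[OF S(1) eq smooth_const S(2), where js = js] by auto
  qed
  show "smooth (periodization f)" unfolding smooth_def using loc by blast
  show "cmod (pderivs js (periodization f) t) \<le> M" if "\<And>t. t \<in> K \<Longrightarrow> cmod (pderivs js f t) \<le> M" "M \<ge> 0"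
    using loc[of js t] that by auto
qed

end

lemma periodization_periodic:
  assumes "\<And>x y. x \<in> \<Lambda> \<Longrightarrow> y \<in> \<Lambda> \<Longrightarrow> x + y \<in> \<Lambda>" "\<And>x. x \<in> \<Lambda> \<Longrightarrow> - x \<in> \<Lambda>" "l \<in> \<Lambda>"
  shows "periodization f (t + l) = periodization f t"
proof (cases "\<exists>m\<in>\<Lambda>. t - m \<in> U")
  case True
  then obtain m where m: "m \<in> \<Lambda>" "t - m \<in> U" by blast
  then show ?thesis
    using periodization_on_translate[of m t f] periodization_on_translate[of "m + l" "t + l" f] assms(1)[OF m(1) assms(3)]
    by simp
next
  case False
  have "t + l - m \<notin> U" if "m \<in> \<Lambda>" for m
  proof -
    have "m + - l \<in> \<Lambda>" using assms(1)[OF that assms(2)[OF assms(3)]] .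
    moreover have "t - (m + - l) = t + l - m" by simp
    ultimately show ?thesis using False by metis
  qed
  then have "periodization f (t + l) = 0" by (intro periodization_outside) blast
  moreover have "periodization f t = 0" using False by (intro periodization_outside) blast
  ultimately show ?thesis by simp
qed

text \<open>The substitution \<open>s = t - x\<close> in the coefficients turns the frame operator into a superposition over \<open>x\<close> of
  time-frequency shifts of \<open>\<phi>\<close>, multiplied by the periodization of
  \<open>h\<^sub>x(t) = \<psi>(t) \<theta>(t - x) e\<^bsup>2\<pi>iBt\<cdot>x\<^esup>\<close>; the phase is split so that this factor is periodic.\<close>

lemma frame_operator_integral:
  fixes B :: "real^'n^'n"
  assumes \<psi>: "smooth \<psi>" "K \<subseteq> U" "\<And>t. t \<notin> K \<Longrightarrow> \<psi> t = 0"
    and \<theta>: "smooth \<theta>" "L \<subseteq> U" "\<And>t. t \<notin> L \<Longrightarrow> \<theta> t = 0"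
    and \<phi>: "\<phi> \<in> test_functions UNIV"
    and box: "\<And>s t. s \<in> K \<Longrightarrow> t \<in> L \<Longrightarrow> s - t \<in> cbox a b"
    and S: "finite S" "S \<subseteq> \<Lambda>" "\<And>l. l \<in> \<Lambda> - S \<Longrightarrow> pairing \<phi> (twisted_translation (- B) l \<theta>) = 0"
  shows "frame_operator B \<Lambda> \<theta> \<psi> \<phi> t = integral (cbox a b)
    (\<lambda>x. \<phi> (t - x) * wave (- (transpose B *v x)) t * (\<Sum>l\<in>S. \<psi> (t - l) * \<theta> (t - l - x) * wave (transpose B *v x) (t - l)))"
proof -
  have cont: "continuous_on X (\<lambda>x. \<phi> (t - x) * wave (- (transpose B *v x)) t * (\<psi> (t - l) * \<theta> (t - l - x) * wave (transpose B *v x) (t - l)))"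
    for l X
    unfolding wave_def
    by (intro continuous_intros continuous_on_compose2[OF smooth_continuous[OF test_functions_smooth[OF \<phi>]]]
      continuous_on_compose2[OF smooth_continuous[OF \<theta>(1)]] linear_continuous_on matrix_vector_mul_bounded_linear) auto
  have main: "integral (cbox a b) (\<lambda>x. \<phi> (t - x) * wave (- (transpose B *v x)) t * (\<psi> (t - l) * \<theta> (t - l - x) * wave (transpose B *v x) (t - l)))
      = pairing \<phi> (twisted_translation (- B) l \<theta>) * twisted_translation B l \<psi> t" (is "?I = _") for l
  proof (cases "t - l \<in> K")
    case False
    then show ?thesis by (simp add: \<psi>(3) twisted_translation_wave)
  next
    case True
    define g where "g s = \<phi> s * twisted_translation (- B) l \<theta> s" for s
    have gc: "continuous_on UNIV g"
      unfolding g_def twisted_translation_wave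
      by (intro continuous_intros smooth_continuous[OF test_functions_smooth[OF \<phi>]]
        smooth_continuous[OF smooth_shift[OF \<theta>(1)]] smooth_continuous[OF smooth_shift[OF smooth_wave]])
    have eq: "\<phi> (t - x) * wave (- (transpose B *v x)) t * (\<psi> (t - l) * \<theta> (t - l - x) * wave (transpose B *v x) (t - l))
        = g (t - x) * twisted_translation B l \<psi> t" for x
    proof -
      have tl: "t - l - x = t - x - l" by simp
      \<comment> \<open>Both products of characters reduce to the character of frequency
        \<open>- (transpose B *v x)\<close> at \<open>l\<close>. The matrices of coefficient and
        atom have opposite signs, so the pairings of \<open>B *v l\<close> with \<open>t\<close> and
        with \<open>l\<close> cancel and only the one with \<open>x\<close> survives.\<close>
      have e1: "wave (- (transpose B *v x)) t * wave (transpose B *v x) (t - l) = wave (- (transpose B *v x)) l"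
        by (simp add: wave_def inner_diff_left algebra_simps flip: exp_add)
      have e2: "wave (B *v l) (t - x - l) * wave (- (B *v l)) (t - l) = wave (- (transpose B *v x)) l"
      proof -
        have "x \<bullet> (B *v l) = l \<bullet> (transpose B *v x)"
          using dot_lmul_matrix[of x B l] by (simp add: inner_commute)
        then show ?thesis by (simp add: wave_def inner_diff_left algebra_simps flip: exp_add)
      qed
      have "\<phi> (t - x) * wave (- (transpose B *v x)) t * (\<psi> (t - l) * \<theta> (t - l - x) * wave (transpose B *v x) (t - l)) =
          \<phi> (t - x) * \<psi> (t - l) * \<theta> (t - l - x) * (wave (- (transpose B *v x)) t * wave (transpose B *v x) (t - l))"
        by (simp only: ac_simps)
      also have "\<dots> = \<phi> (t - x) * \<psi> (t - l) * \<theta> (t - x - l) * (wave (B *v l) (t - x - l) * wave (- (B *v l)) (t - l))"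
        by (simp only: e1 e2 tl)
      also have "\<dots> = g (t - x) * twisted_translation B l \<psi> t"
        unfolding g_def twisted_translation_wave minus_matrix_vector minus_minus by (simp only: ac_simps)
      finally show ?thesis .
    qed
    \<comment> \<open>Where the integrand does not vanish, \<open>x\<close> is the difference of the
      point \<open>t - l\<close> of \<open>K\<close> and a point of \<open>L\<close>.\<close>
    have supp: "g (t - x) = 0" if "x \<notin> cbox a b" for x
    proof -
      have "t - x - l \<notin> L" using box[OF True, of "t - x - l"] that by auto
      then show ?thesis by (simp add: g_def twisted_translation_wave \<theta>(3))
    qed
    have "pairing \<phi> (twisted_translation (- B) l \<theta>) = (LINT x|lborel. g (t - x))"
      using lborel_integral_reflect[of g t] borel_measurable_continuous_onI[OF gc] by (simp add: g_def)
    also have "\<dots> = integral (cbox a b) (\<lambda>x. g (t - x))"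
      by (intro integrable_compact_support supp continuous_on_compose2[OF gc] continuous_intros) auto
    finally show ?thesis unfolding eq by simp
  qed
  have "frame_operator B \<Lambda> \<theta> \<psi> \<phi> t =
      (\<Sum>l\<in>S. pairing \<phi> (twisted_translation (- B) l \<theta>) * twisted_translation B l \<psi> t)"
    by (simp only: frame_operator_eq[OF S])
  then show ?thesis
    unfolding sum_distrib_left main[symmetric]
    by (subst integral_sum) (rule S(1), rule integrable_continuous, rule cont, assumption)
qed

end

section \<open>Boundedness of the frame operator\<close>

context tiling_set
begin

text \<open>Minkowski's inequality reduces the claim to single \<open>x\<close> in a box containing
  all differences of support points. There the periodic factor costs \<open>C1 * M\<close>,
  uniformly in \<open>x\<close>, and modulation and translation cost polynomials in the bounded
  quantities \<open>norm (transpose B *v x)\<close> and \<open>norm x\<close>.\<close>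

theorem frame_operator_bounded:
  fixes B :: "real^'n^'n"
  assumes q: "tf_seminorm q C\<^sub>0 \<tau>"
    and \<Lambda>: "\<And>x y. x \<in> \<Lambda> \<Longrightarrow> y \<in> \<Lambda> \<Longrightarrow> x + y \<in> \<Lambda>" "\<And>x. x \<in> \<Lambda> \<Longrightarrow> - x \<in> \<Lambda>" "span \<Lambda> = UNIV"
    and \<psi>D: "\<psi> \<in> test_functions U" and \<theta>D: "\<theta> \<in> test_functions U"
  shows "\<exists>C\<ge>0. \<forall>\<phi>\<in>test_functions UNIV. q (frame_operator B \<Lambda> \<theta> \<psi> \<phi>) \<le> C * q \<phi>"
proof -
  interpret q: tf_seminorm q C\<^sub>0 \<tau> by (rule q)
  obtain K where K: "smooth \<psi>" "compact K" "K \<subseteq> U" "\<And>t. t \<notin> K \<Longrightarrow> \<psi> t = 0"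
    using \<psi>D by (rule test_functionsE) (rule that)
  obtain L where L: "smooth \<theta>" "compact L" "L \<subseteq> U" "\<And>t. t \<notin> L \<Longrightarrow> \<theta> t = 0"
    using \<theta>D by (rule test_functionsE) (rule that)
  obtain A A' :: "real^'n \<Rightarrow> real^'n" where A: "linear A" "linear A'" "\<And>x. A' (A x) = x" "\<And>x. A (A' x) = x"
      and A\<Lambda>: "\<And>i. A (axis i 1) \<in> \<Lambda>"
    by (rule lattice_basis[OF \<Lambda>(3)]) (rule that)
  obtain C1 k where C1: "C1 \<ge> 0" and mult: "\<forall>H M. smooth H \<longrightarrow> (\<forall>t i. H (t + A (axis i 1)) = H t) \<longrightarrow>
    (\<forall>js t. length js \<le> k \<longrightarrow> cmod (pderivs js H t) \<le> M) \<longrightarrow>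
    (\<forall>\<phi>\<in>test_functions UNIV. q (\<lambda>t. H t * \<phi> t) \<le> C1 * M * q \<phi>)"
    using q.periodic_multiplier_bound[OF A] by blast
  have "bounded ((\<lambda>(s, t). s - t) ` (K \<times> L))"
    unfolding case_prod_unfold
    by (intro compact_imp_bounded compact_continuous_image compact_Times K L continuous_intros)
  then obtain a b where "(\<lambda>(s, t). s - t) ` (K \<times> L) \<subseteq> cbox a b" by (rule bounded_obtain_cbox)
  then have box: "s - t \<in> cbox a b" if "s \<in> K" "t \<in> L" for s t using that by blast
  let ?T = "\<lambda>x. transpose B *v x"
  have T: "continuous_on X ?T" for X
    by (intro linear_continuous_on matrix_vector_mul_bounded_linear)
  define h where "h x t = \<psi> t * \<theta> (t - x) * wave (?T x) t" for x t
  have h: "smooth_family h"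
    unfolding h_def
    by (intro smooth_family_mult smooth_imp_smooth_family smooth_family_shift smooth_family_wave K(1) L(1) T continuous_on_id)
  have h0: "h x t = 0" if "t \<notin> K" for x t using K(4)[OF that] by (simp add: h_def)
  define P where "P js r \<longleftrightarrow> r \<ge> 0 \<and> (\<forall>x\<in>cbox a b. \<forall>t\<in>K. cmod (pderivs js (h x) t) \<le> r)" for js r
  have "\<exists>r. P js r" for js
  proof -
    obtain r where "r \<ge> 0" "\<And>x t. x \<in> cbox a b \<Longrightarrow> t \<in> K \<Longrightarrow> cmod (case (x, t) of (x, t) \<Rightarrow> pderivs js (h x) t) \<le> r"
      by (rule bounded_continuous_on_box[OF smooth_family_continuous[OF smooth_family_pderivs[OF h, of js]] K(2), of a b]) (rule that)
    then show ?thesis unfolding P_def by (intro exI[of _ r]) simp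
  qed
  then obtain m where "\<And>js. P js (m js)" by metis
  then have m: "\<And>js. m js \<ge> 0" "\<And>js x t. x \<in> cbox a b \<Longrightarrow> t \<in> K \<Longrightarrow> cmod (pderivs js (h x) t) \<le> m js"
    unfolding P_def by blast+
  \<comment> \<open>One bound for all derivatives of order at most \<open>k\<close> of all
    \<open>h x\<close>, with \<open>x\<close> in the box; the sum is over finitely many index
    lists.\<close>
  define M where "M = (\<Sum>js\<in>{js. length js \<le> k}. m js)"
  have M: "M \<ge> 0" "\<And>js. length js \<le> k \<Longrightarrow> m js \<le> M"
    unfolding M_def by (intro sum_nonneg m(1), intro member_le_sum finite_multi_indices m(1)) simp
  define p where "p x = periodization (h x)" for x
  have p: "smooth (p x)" "p x (t + A (axis i 1)) = p x t" for x t i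
    unfolding p_def using pderivs_periodization(1)[OF smooth_family_imp_smooth[OF h] K(2,3) h0]
      periodization_periodic[OF \<Lambda>(1,2) A\<Lambda>] by blast+
  have pM: "cmod (pderivs js (p x) t) \<le> M" if "x \<in> cbox a b" "length js \<le> k" for js x t
  proof -
    have "cmod (pderivs js (p x) t) \<le> m js"
      unfolding p_def using m that(1)
      by (intro pderivs_periodization(2)[OF smooth_family_imp_smooth[OF h] K(2,3) h0]) auto
    then show ?thesis using M(2)[OF that(2)] by simp
  qed
  obtain R\<^sub>B where RB: "R\<^sub>B \<ge> 0" "\<And>x. x \<in> cbox a b \<Longrightarrow> norm (?T x) \<le> R\<^sub>B" "\<And>x. x \<in> cbox a b \<Longrightarrow> norm x \<le> R\<^sub>B"
  proof -
    have "bounded (?T ` cbox a b)" "bounded (cbox a b)"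
      by (intro compact_imp_bounded compact_continuous_image T compact_cbox)+
    then obtain r s where "\<And>x. x \<in> cbox a b \<Longrightarrow> norm (?T x) \<le> r" "\<And>x. x \<in> cbox a b \<Longrightarrow> norm x \<le> s"
      unfolding bounded_iff by blast
    then show ?thesis by (intro that[of "max 0 (max r s)"]) (auto simp: le_max_iff_disj)
  qed
  \<comment> \<open>One factor \<open>C\<^sub>0 * (1 + R\<^sub>B) ^ \<tau>\<close> for the
    modulation and one for the translation.\<close>
  define D where "D = C1 * M * (C\<^sub>0 * (1 + R\<^sub>B) ^ \<tau> * (C\<^sub>0 * (1 + R\<^sub>B) ^ \<tau>))"
  have D: "D \<ge> 0" unfolding D_def using C1 M(1) q.C0_pos RB(1) by (intro mult_nonneg_nonneg zero_le_power) auto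
  have "q (frame_operator B \<Lambda> \<theta> \<psi> \<phi>) \<le> D * measure lborel (cbox a b) * q \<phi>" if \<phi>: "\<phi> \<in> test_functions UNIV" for \<phi>
  proof -
    obtain Q where Q: "smooth \<phi>" "compact Q" "\<And>t. t \<notin> Q \<Longrightarrow> \<phi> t = 0"
      using \<phi> by (rule test_functionsE) (rule that)
    obtain R1 where R1: "\<And>B l. norm l > R1 \<Longrightarrow> pairing \<phi> (twisted_translation B l \<theta>) = 0"
      by (rule pairing_eventually_zero[OF \<phi> \<theta>D]) (rule that)
    obtain R2 where R2: "\<And>t. t \<in> Q \<Longrightarrow> norm t \<le> R2"
      using compact_imp_bounded[OF Q(2)] by (auto simp: bounded_iff)
    obtain R3 where R3: "\<And>u. u \<in> U \<Longrightarrow> norm u \<le> R3" by (rule U_bound) (rule that)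
    \<comment> \<open>\<open>R1\<close> captures all non-zero coefficients;
      \<open>R2 + R\<^sub>B + R3\<close> captures every \<open>l\<close> with \<open>t - l\<close>
      in \<open>U\<close> whenever \<open>t - x\<close> lies in \<open>Q\<close> and
      \<open>x\<close> in the box.\<close>
    define S where "S = {l \<in> \<Lambda>. norm l \<le> max R1 (R2 + R\<^sub>B + R3)}"
    have S: "finite S" "S \<subseteq> \<Lambda>" unfolding S_def by (rule finite_bounded_part) auto
    have S0: "pairing \<phi> (twisted_translation (- B) l \<theta>) = 0" if "l \<in> \<Lambda> - S" for l
      by (rule R1) (use that in \<open>auto simp: S_def\<close>)
    \<comment> \<open>The factor is a finite sum over \<open>S\<close> rather than
      \<open>p x\<close>, so that joint smoothness follows from the closure rules. For
      \<open>x\<close> in the box the two agree wherever \<open>\<phi> (t - x)\<close> does not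
      vanish.\<close>
    define F where "F x t = \<phi> (t - x) * wave (- (?T x)) t * (\<Sum>l\<in>S. \<psi> (t - l) * \<theta> (t - l - x) * wave (?T x) (t - l))" for x t
    have shifted: "smooth_family (\<lambda>x t. h x (t - l))" for l
    proof -
      have "continuous_on UNIV (\<lambda>x. wave (?T x) (- l))"
        unfolding wave_def by (intro continuous_intros T)
      then have "smooth_family (\<lambda>x t. \<psi> (t - l) * \<theta> (t - (l + x)) * (wave (?T x) t * wave (?T x) (- l)))"
        by (intro smooth_family_mult smooth_family_shift smooth_family_wave K(1) L(1) T continuous_intros
          smooth_family_scalar)
      moreover have "wave (?T x) t * wave (?T x) (- l) = wave (?T x) (t - l)" for x t
        unfolding wave_add[symmetric] by (simp only: diff_conv_add_uminus)
      moreover have "t - (l + x) = t - l - x" for t x :: "real^'n" by simp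
      ultimately show ?thesis unfolding h_def by (simp only:)
    qed
    have "smooth_family (\<lambda>x t. \<Sum>l\<in>S. h x (t - l))"
    proof -
      have "smooth_family (\<lambda>x t. \<Sum>l\<in>S'. h x (t - l))" if "finite S'" for S'
        using that by (induction S' rule: finite_induct)
          (auto intro: smooth_family_add shifted smooth_family_scalar continuous_on_const)
      then show ?thesis using S(1) by blast
    qed
    then have F: "smooth_family F"
      unfolding F_def h_def[symmetric]
      by (intro smooth_family_mult smooth_family_shift[OF Q(1)] smooth_family_wave continuous_intros T)
    have Feq: "F x t = p x t * (wave (- (?T x)) t * \<phi> (t - x))" if x: "x \<in> cbox a b" for x t
    proof (cases "t - x \<in> Q")
      case False
      then show ?thesis using Q(3) by (simp add: F_def)
    next
      case True
      have "(\<Sum>l\<in>S. h x (t - l)) = p x t"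
        unfolding p_def periodization_def
      proof (rule sum.mono_neutral_right[OF S(1)])
        show "{l \<in> \<Lambda>. t - l \<in> U} \<subseteq> S"
        proof
          fix l assume l: "l \<in> {l \<in> \<Lambda>. t - l \<in> U}"
          have "l = (t - x) + x - (t - l)" by simp
          then have "norm l \<le> norm (t - x) + norm x + norm (t - l)"
            using norm_triangle_ineq4[of "(t - x) + x" "t - l"] norm_triangle_ineq[of "t - x" x] by simp
          then have "norm l \<le> R2 + R\<^sub>B + R3"
            using R2[OF True] RB(3)[OF x] R3[of "t - l"] l by simp
          then show "l \<in> S" using l by (simp add: S_def)
        qed
        show "\<forall>l\<in>S - {l \<in> \<Lambda>. t - l \<in> U}. h x (t - l) = 0"
          using S(2) K(3) h0 by blast
      qed
      then show ?thesis by (simp add: F_def h_def)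
    qed
    \<comment> \<open>A compact set containing the supports of all \<open>F x\<close> with
      \<open>x\<close> in the box, as Minkowski's inequality demands.\<close>
    define X where "X = (\<lambda>(s, x). s + x) ` (Q \<times> cbox a b)"
    have X: "compact X"
      unfolding X_def case_prod_unfold by (intro compact_continuous_image compact_Times Q compact_cbox continuous_intros)
    have F0: "F x t = 0" if "x \<in> cbox a b" "t \<notin> X" for x t
    proof -
      have "t - x \<notin> Q"
      proof
        assume "t - x \<in> Q"
        then have "(\<lambda>(s, x). s + x) (t - x, x) \<in> X" unfolding X_def using that(1) by blast
        then show False using that(2) by simp
      qed
      then show ?thesis using Q(3) by (simp add: F_def)
    qed
    have qF: "q (F x) \<le> D * q \<phi>" if x: "x \<in> cbox a b" for x
    proof -
      have s: "(\<lambda>t. \<phi> (t - x)) \<in> test_functions UNIV" by (rule test_functions_shift[OF \<phi>])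
      have ws: "(\<lambda>t. wave (- (?T x)) t * \<phi> (t - x)) \<in> test_functions UNIV"
        by (rule test_functions_mult(1)[OF s smooth_wave])
      have g: "C\<^sub>0 * (1 + norm y) ^ \<tau> \<le> C\<^sub>0 * (1 + R\<^sub>B) ^ \<tau>" if "norm y \<le> R\<^sub>B" for y :: "real^'n"
        using that q.C0_pos by (intro mult_left_mono power_mono) auto
      have nn: "0 \<le> C\<^sub>0 * (1 + R\<^sub>B) ^ \<tau>" using q.C0_pos RB(1) by simp
      have "q (F x) = q (\<lambda>t. p x t * (wave (- (?T x)) t * \<phi> (t - x)))"
        by (rule arg_cong[of _ _ q], rule ext, rule Feq[OF x])
      also have "\<dots> \<le> C1 * M * q (\<lambda>t. wave (- (?T x)) t * \<phi> (t - x))"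
        by (rule mult[rule_format]) (rule p, rule p, rule pM[OF x], assumption, rule ws)
      also have "\<dots> \<le> C1 * M * (C\<^sub>0 * (1 + norm (- (?T x))) ^ \<tau> * q (\<lambda>t. \<phi> (t - x)))"
        using C1 M(1) by (intro mult_left_mono q.modulation_bound s) auto
      also have "\<dots> \<le> C1 * M * (C\<^sub>0 * (1 + R\<^sub>B) ^ \<tau> * (C\<^sub>0 * (1 + norm x) ^ \<tau> * q \<phi>))"
        using C1 M(1) nn RB(2)[OF x] by (intro mult_left_mono mult_mono g q.translation_bound \<phi> q.nonneg s) auto
      also have "\<dots> \<le> C1 * M * (C\<^sub>0 * (1 + R\<^sub>B) ^ \<tau> * (C\<^sub>0 * (1 + R\<^sub>B) ^ \<tau> * q \<phi>))"
        using C1 M(1) nn RB(3)[OF x] by (intro mult_left_mono mult_right_mono g q.nonneg \<phi>) auto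
      also have "\<dots> = D * q \<phi>" by (simp add: D_def)
      finally show ?thesis .
    qed
    have "frame_operator B \<Lambda> \<theta> \<psi> \<phi> = (\<lambda>t. integral (cbox a b) (\<lambda>x. F x t))"
      unfolding F_def using frame_operator_integral[OF K(1,3,4) L(1,3,4) \<phi> box S S0] by (intro ext) simp
    then have "q (frame_operator B \<Lambda> \<theta> \<psi> \<phi>) \<le> integral (cbox a b) (\<lambda>x. q (F x))"
      using q.minkowski_integral[OF F X F0] by simp
    also have "\<dots> \<le> integral (cbox a b) (\<lambda>x. D * q \<phi>)"
      using qF by (intro integral_le integrable_continuous q.seminorm_family_continuous[OF F X F0] continuous_on_const) auto
    also have "\<dots> = D * measure lborel (cbox a b) * q \<phi>" by simp
    finally show ?thesis .
  qed
  then show ?thesis using D by (intro exI[of _ "D * measure lborel (cbox a b)"] conjI ballI) auto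
qed

end

section \<open>Normed spaces of functionals\<close>

lemma complex_subspaceD:
  assumes "complex_subspace V"
  shows "(\<lambda>x. 0) \<in> V" "u \<in> V \<Longrightarrow> v \<in> V \<Longrightarrow> (\<lambda>x. u x + v x) \<in> V" "u \<in> V \<Longrightarrow> (\<lambda>x. a * u x) \<in> V"
  using assms by (simp_all add: complex_subspace_def)

lemma complex_subspace_diff:
  assumes "complex_subspace V" "u \<in> V" "v \<in> V"
  shows "(\<lambda>x. u x - v x) \<in> V"
  using complex_subspaceD(2)[OF assms(1,2) complex_subspaceD(3)[OF assms(1,3), of "-1"]] by simp

lemma norm_onD:
  assumes "norm_on V N"
  shows "u \<in> V \<Longrightarrow> 0 \<le> N u" "u \<in> V \<Longrightarrow> N u = 0 \<longleftrightarrow> u = (\<lambda>x. 0)"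
    "u \<in> V \<Longrightarrow> N (\<lambda>x. a * u x) = cmod a * N u"
    "u \<in> V \<Longrightarrow> v \<in> V \<Longrightarrow> N (\<lambda>x. u x + v x) \<le> N u + N v"
  using assms by (simp_all add: norm_on_def)

lemma linear_functionalD:
  assumes "linear_functional V L"
  shows "u \<in> V \<Longrightarrow> v \<in> V \<Longrightarrow> L (\<lambda>x. u x + v x) = L u + L v" "u \<in> V \<Longrightarrow> L (\<lambda>x. a * u x) = a * L u"
    "u \<notin> V \<Longrightarrow> L u = 0"
  using assms by (simp_all add: linear_functional_def)

lemma linear_functional_diff:
  assumes "linear_functional V L" "complex_subspace V" "u \<in> V" "v \<in> V"
  shows "L (\<lambda>x. u x - v x) = L u - L v"
  using linear_functionalD(1)[OF assms(1,3) complex_subspaceD(3)[OF assms(2,4)], of "-1"]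
    linear_functionalD(2)[OF assms(1,4), of "-1"] by simp

context
  fixes V :: "('a \<Rightarrow> complex) set" and N
  assumes sub: "complex_subspace V" and norm: "norm_on V N"
begin

lemma norm_on_minus:
  assumes "u \<in> V" shows "N (\<lambda>x. - u x) = N u"
  using norm_onD(3)[OF norm assms, of "-1"] by simp

lemma norm_on_diff_commute: "u \<in> V \<Longrightarrow> v \<in> V \<Longrightarrow> N (\<lambda>x. u x - v x) = N (\<lambda>x. v x - u x)"
  using norm_on_minus[OF complex_subspace_diff[OF sub], of u v] by simp

lemma norm_on_triangle3:
  assumes "u \<in> V" "v \<in> V" "w \<in> V"
  shows "N (\<lambda>x. u x - w x) \<le> N (\<lambda>x. u x - v x) + N (\<lambda>x. v x - w x)"
proof -
  have "N (\<lambda>x. (u x - v x) + (v x - w x)) \<le> N (\<lambda>x. u x - v x) + N (\<lambda>x. v x - w x)"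
    by (intro norm_onD(4)[OF norm] complex_subspace_diff[OF sub] assms)
  then show ?thesis by simp
qed

lemma norm_on_triangle_diff:
  assumes "u \<in> V" "v \<in> V" shows "N u \<le> N v + N (\<lambda>x. u x - v x)"
proof -
  have "N (\<lambda>x. v x + (u x - v x)) \<le> N v + N (\<lambda>x. u x - v x)"
    by (intro norm_onD(4)[OF norm] complex_subspace_diff[OF sub] assms)
  then show ?thesis by simp
qed

lemma Metric_space_norm_dist: "Metric_space V (norm_dist V N)"
proof
  show "0 \<le> norm_dist V N x y" for x y
    using norm_onD(1)[OF norm,OF complex_subspace_diff[OF sub]] by (simp add: norm_dist_def)
  show "norm_dist V N x y = norm_dist V N y x" for x y
    using norm_on_diff_commute[of x y] by (simp add: norm_dist_def)
  show "(norm_dist V N x y = 0) = (x = y)" if "x \<in> V" "y \<in> V" for x y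
  proof -
    have "norm_dist V N x y = 0 \<longleftrightarrow> (\<lambda>z. x z - y z) = (\<lambda>z. 0)"
      using norm_onD(2)[OF norm complex_subspace_diff[OF sub that]] that by (simp add: norm_dist_def)
    then show ?thesis by (auto simp: fun_eq_iff)
  qed
  show "norm_dist V N x z \<le> norm_dist V N x y + norm_dist V N y z" if "x \<in> V" "y \<in> V" "z \<in> V" for x y z
    using norm_on_triangle3[OF that] that by (simp add: norm_dist_def)
qed

lemma limitin_norm_topology:
  assumes "\<And>n. \<sigma> n \<in> V"
  shows "limitin (norm_topology V N) \<sigma> l sequentially \<longleftrightarrow> l \<in> V \<and> (\<lambda>n. N (\<lambda>x. \<sigma> n x - l x)) \<longlonglongrightarrow> 0"
proof -
  interpret M: Metric_space V "norm_dist V N" by (rule Metric_space_norm_dist)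
  have "(\<forall>\<epsilon>>0. \<forall>\<^sub>F n in sequentially. N (\<lambda>x. \<sigma> n x - l x) < \<epsilon>) \<longleftrightarrow> (\<lambda>n. N (\<lambda>x. \<sigma> n x - l x)) \<longlonglongrightarrow> 0" if "l \<in> V"
    using norm_onD(1)[OF norm,OF complex_subspace_diff[OF sub assms that]]
    by (simp add: tendsto_iff dist_real_def)
  then show ?thesis
    unfolding norm_topology_def M.limitin_metric using assms by (auto simp: norm_dist_def)
qed

lemma in_norm_closure:
  assumes "u \<in> norm_topology V N closure_of S" "\<epsilon> > 0"
  obtains s where "s \<in> S" "s \<in> V" "u \<in> V" "N (\<lambda>x. u x - s x) < \<epsilon>"
proof -
  interpret M: Metric_space V "norm_dist V N" by (rule Metric_space_norm_dist)
  have "u \<in> V" "\<forall>r>0. \<exists>y\<in>S. y \<in> M.mball u r"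
    using assms(1) unfolding norm_topology_def M.metric_closure_of by auto
  then obtain s where "s \<in> S" "s \<in> V" "norm_dist V N u s < \<epsilon>" using assms(2) by (auto simp: M.in_mball)
  then show ?thesis using that[of s] \<open>u \<in> V\<close> by (simp add: norm_dist_def)
qed

lemma continuous_norm_topology_at_zero:
  assumes "continuous_map (norm_topology V N) X f" "openin X W" "f (\<lambda>x. 0) \<in> W"
  obtains \<delta> where "\<delta> > 0" "\<And>u. u \<in> V \<Longrightarrow> N u < \<delta> \<Longrightarrow> f u \<in> W"
proof -
  interpret M: Metric_space V "norm_dist V N" by (rule Metric_space_norm_dist)
  have 0: "(\<lambda>x. 0) \<in> V" using sub by (simp add: complex_subspace_def)
  have "openin (norm_topology V N) {u \<in> V. f u \<in> W}"
    using assms(1,2) unfolding continuous_map_def norm_topology_def by simp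
  then obtain \<delta> where \<delta>: "\<delta> > 0" "M.mball (\<lambda>x. 0) \<delta> \<subseteq> {u \<in> V. f u \<in> W}"
    using 0 assms(3) unfolding norm_topology_def M.openin_mtopology by blast
  have "u \<in> M.mball (\<lambda>x. 0) \<delta>" if "u \<in> V" "N u < \<delta>" for u
    using that 0 norm_on_minus[OF that(1)] by (simp add: M.in_mball norm_dist_def)
  with \<delta> show ?thesis by (intro that[of \<delta>]) blast+
qed

lemma bounded_linear_continuous_norm_topology:
  assumes "linear_functional V L" "\<And>u. u \<in> V \<Longrightarrow> cmod (L u) \<le> C * N u"
  shows "continuous_map (norm_topology V N) euclidean L"
proof -
  interpret M: Metric_space V "norm_dist V N" by (rule Metric_space_norm_dist)
  show ?thesis
    unfolding continuous_map_def norm_topology_def M.topspace_mtopology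
  proof (intro conjI allI impI)
    fix W :: "complex set" assume "openin euclidean W"
    then have W: "open W" by (simp only: open_openin)
    show "openin M.mtopology {x \<in> V. L x \<in> W}"
      unfolding M.openin_mtopology
    proof (intro conjI allI impI)
      fix u assume u: "u \<in> {x \<in> V. L x \<in> W}"
      obtain e where e: "e > 0" "ball (L u) e \<subseteq> W" using W u open_contains_ball by blast
      have "L v \<in> W" if v: "v \<in> V" "N (\<lambda>x. u x - v x) < e / (\<bar>C\<bar> + 1)" for v
      proof -
        have d: "(\<lambda>x. u x - v x) \<in> V" using complex_subspace_diff[OF sub] u v by blast
        have "L (\<lambda>x. u x - v x) = L u - L v"
          using linear_functional_diff[OF assms(1) sub] u v(1) by blast
        then have "cmod (L u - L v) \<le> C * N (\<lambda>x. u x - v x)" using assms(2)[OF d] by simp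
        also have "\<dots> \<le> (\<bar>C\<bar> + 1) * N (\<lambda>x. u x - v x)"
          using norm_onD(1)[OF norm,OF d] by (intro mult_right_mono) auto
        also have "\<dots> < e" using v(2) by (simp add: field_simps)
        finally show ?thesis using e(2) by (auto simp: dist_norm)
      qed
      then have "M.mball u (e / (\<bar>C\<bar> + 1)) \<subseteq> {x \<in> V. L x \<in> W}"
        using u by (auto simp: M.in_mball norm_dist_def)
      then show "\<exists>r>0. M.mball u r \<subseteq> {x \<in> V. L x \<in> W}"
        using e(1) by (intro exI[of _ "e / (\<bar>C\<bar> + 1)"]) auto
    qed auto
  qed auto
qed

text \<open>Moves completeness out of the metric-space formulation once, so that later proofs speak
  of \<open>N\<close> only.\<close>

lemma complex_banach_space_iff_sequences:
  "complex_banach_space V N \<longleftrightarrow> (\<forall>\<sigma>. (\<forall>n. \<sigma> n \<in> V) \<longrightarrow>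
     (\<forall>\<epsilon>>0. \<exists>n\<^sub>0. \<forall>m\<ge>n\<^sub>0. \<forall>n\<ge>n\<^sub>0. N (\<lambda>x. \<sigma> m x - \<sigma> n x) < \<epsilon>) \<longrightarrow>
     (\<exists>l\<in>V. (\<lambda>n. N (\<lambda>x. \<sigma> n x - l x)) \<longlonglongrightarrow> 0))"
proof -
  interpret M: Metric_space V "norm_dist V N" by (rule Metric_space_norm_dist)
  have cauchy: "M.MCauchy \<sigma> \<longleftrightarrow> (\<forall>n. \<sigma> n \<in> V) \<and> (\<forall>\<epsilon>>0. \<exists>n\<^sub>0. \<forall>m\<ge>n\<^sub>0. \<forall>n\<ge>n\<^sub>0. N (\<lambda>x. \<sigma> m x - \<sigma> n x) < \<epsilon>)" for \<sigma>
  proof -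
    have "norm_dist V N (\<sigma> m) (\<sigma> n) = N (\<lambda>x. \<sigma> m x - \<sigma> n x)" if "\<forall>n. \<sigma> n \<in> V" for m n
      using that by (simp add: norm_dist_def)
    then show ?thesis unfolding M.MCauchy_def image_subset_iff by auto
  qed
  have "M.mcomplete \<longleftrightarrow> (\<forall>\<sigma>. M.MCauchy \<sigma> \<longrightarrow> (\<exists>l\<in>V. (\<lambda>n. N (\<lambda>x. \<sigma> n x - l x)) \<longlonglongrightarrow> 0))"
    unfolding M.mcomplete_def using limitin_norm_topology unfolding norm_topology_def cauchy by blast
  then show ?thesis
    unfolding complex_banach_space_def cauchy using sub norm by blast
qed

end

lemma limitin_lc_topology:
  assumes "l \<in> V" "\<And>n. \<sigma> n \<in> V" "\<And>p. p \<in> P \<Longrightarrow> (\<lambda>n. p (\<lambda>x. \<sigma> n x - l x)) \<longlonglongrightarrow> (0 :: real)"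
  shows "limitin (lc_topology V P) \<sigma> l sequentially"
proof -
  have "openin (lc_topology V P) V"
    unfolding openin_lc_topology by (auto intro!: exI[of _ "{}"] exI[of _ 1])
  then have "l \<in> topspace (lc_topology V P)" using assms(1) openin_subset by blast
  moreover have "\<forall>\<^sub>F n in sequentially. \<sigma> n \<in> W" if W: "openin (lc_topology V P) W" "l \<in> W" for W
  proof -
    obtain F \<epsilon> where F: "finite F" "F \<subseteq> P" "\<epsilon> > 0" "{v \<in> V. \<forall>p\<in>F. p (\<lambda>x. v x - l x) < \<epsilon>} \<subseteq> W"
      using W unfolding openin_lc_topology by blast
    have "\<forall>\<^sub>F n in sequentially. p (\<lambda>x. \<sigma> n x - l x) < \<epsilon>" if "p \<in> F" for p
      using order_tendstoD(2)[OF assms(3), of p \<epsilon>] that F by blast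
    then have "\<forall>\<^sub>F n in sequentially. \<forall>p\<in>F. p (\<lambda>x. \<sigma> n x - l x) < \<epsilon>"
      by (simp add: eventually_ball_finite F(1))
    then show ?thesis by eventually_elim (use F(4) assms(2) in blast)
  qed
  ultimately show ?thesis unfolding limitin_def by blast
qed

lemma schwartz_seminorm_le:
  assumes "schwartz_bound k f M" shows "schwartz_seminorm k f \<le> M"
  unfolding schwartz_seminorm_def
proof (rule cSUP_least)
  show "{js :: 'a list. length js \<le> k} \<times> (UNIV :: (real^'a) set) \<noteq> {}" by (auto intro: exI[of _ "[]"])
qed (use assms in \<open>auto simp: schwartz_bound_def\<close>)

text \<open>The supremum runs over finitely many index lists, so the bounds for the individual
  derivatives make it finite; only then does \<open>SUP\<close> dominate its terms.\<close>

lemma schwartz_space_bound: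
  assumes "f \<in> schwartz_space" shows "schwartz_bound k f (schwartz_seminorm k f)" "schwartz_seminorm k f \<ge> 0"
proof -
  have "\<exists>M. \<forall>t. (1 + norm t) ^ k * cmod (pderivs js f t) \<le> M" for js
  proof -
    have "bounded (range (\<lambda>x. (1 + norm x) ^ k *\<^sub>R pderivs js f x))"
      using assms by (simp add: schwartz_space_def)
    then obtain M where "\<And>x. norm ((1 + norm x) ^ k *\<^sub>R pderivs js f x) \<le> M"
      unfolding bounded_iff by blast
    then show ?thesis by (intro exI[of _ M]) (simp add: abs_of_nonneg)
  qed
  then obtain M where M: "\<And>js t. (1 + norm t) ^ k * cmod (pderivs js f t) \<le> M js" by metis
  define J where "J = {js :: 'a list. length js \<le> k}"
  have J: "finite J" unfolding J_def by (rule finite_multi_indices)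
  have "bdd_above ((\<lambda>(js, x). (1 + norm x) ^ k * cmod (pderivs js f x)) ` (J \<times> UNIV))"
  proof (rule bdd_aboveI2)
    fix z assume "z \<in> J \<times> (UNIV :: (real^'a) set)"
    then obtain js x where z: "z = (js, x)" "js \<in> J" by auto
    have "M js \<le> Max (M ` J)" using z J by simp
    then show "(case z of (js, x) \<Rightarrow> (1 + norm x) ^ k * cmod (pderivs js f x)) \<le> Max (M ` J)"
      using M[of z'x js] z order_trans[OF M] by fastforce
  qed
  then show b: "schwartz_bound k f (schwartz_seminorm k f)"
    unfolding schwartz_bound_def schwartz_seminorm_def J_def[symmetric]
    by (auto intro!: cSUP_upper2[where x = "(js, t)" for js t] simp: J_def)
  have "0 \<le> (1 + norm (0 :: real^'a)) ^ k * cmod (pderivs [] f 0)" by simp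
  also have "\<dots> \<le> schwartz_seminorm k f" using b unfolding schwartz_bound_def by (metis le0 list.size(3))
  finally show "schwartz_seminorm k f \<ge> 0" .
qed

lemma test_functions_subset_schwartz: "test_functions U \<subseteq> schwartz_space"
proof
  fix f assume "f \<in> test_functions U"
  then obtain K where K: "smooth f" "compact K" "\<And>t. t \<notin> K \<Longrightarrow> f t = 0"
    by (rule test_functionsE) (rule that)
  have "bounded (range (\<lambda>x. (1 + norm x) ^ k *\<^sub>R pderivs js f x))" for k js
  proof -
    let ?g = "\<lambda>x. (1 + norm x) ^ k *\<^sub>R pderivs js f x"
    have "continuous_on K ?g"
      by (intro continuous_intros continuous_on_subset[OF smooth_pderivs_continuous[OF K(1)]]) auto
    then have "bounded (insert 0 (?g ` K))"
      using compact_imp_bounded[OF compact_continuous_image[OF _ K(2)]] by simp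
    moreover have "range ?g \<subseteq> insert 0 (?g ` K)"
      using pderivs_zero_outside[OF compact_imp_closed[OF K(2)] K(1,3)] by fastforce
    ultimately show ?thesis by (rule bounded_subset)
  qed
  then show "f \<in> schwartz_space" using K(1) by (simp add: schwartz_space_def)
qed

section \<open>Density of the test functions\<close>

text \<open>The derivative bounds are uniform in \<open>n\<close>, and the region where
  \<open>\<eta> n\<close> equals 1 grows with a fixed lag \<open>r\<close>. Together they give
  convergence of \<open>\<eta> n * f\<close> in every Schwartz seminorm.\<close>

definition cutoff_sequence :: "(nat \<Rightarrow> real^'n \<Rightarrow> complex) \<Rightarrow> bool" where
  "cutoff_sequence \<eta> \<longleftrightarrow> (\<forall>n. \<eta> n \<in> test_functions UNIV) \<and> (\<exists>r. \<forall>n t. norm t < real n - r \<longrightarrow> \<eta> n t = 1) \<and>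
     (\<forall>js. \<exists>M. \<forall>n t. cmod (pderivs js (\<eta> n) t) \<le> M)"

text \<open>The integrand is the continuous function \<open>(cmod (chi t))\<^sup>2\<close>, whose
  integral over a box with interior vanishes only if the function does.\<close>

lemma test_function_energy_pos:
  assumes "chi \<in> test_functions U" "chi \<noteq> (\<lambda>t. 0)"
  shows "(LINT t|lborel. chi t * cnj (chi t)) \<noteq> 0"
proof
  assume zero: "(LINT t|lborel. chi t * cnj (chi t)) = 0"
  obtain K where K: "smooth chi" "compact K" "\<And>t. t \<notin> K \<Longrightarrow> chi t = 0"
    using assms(1) by (rule test_functionsE) (rule that)
  obtain a b where ab: "K \<subseteq> cbox a b" by (rule bounded_obtain_cbox[OF compact_imp_bounded[OF K(2)]])
  \<comment> \<open>Enlarging the box by 1 on each side makes its interior visibly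
    non-empty.\<close>
  define a' b' where "a' = a - 1" and "b' = b + 1"
  have c: "continuous_on S chi" for S using smooth_continuous[OF K(1)] by (rule continuous_on_subset) simp
  have ab': "cbox a b \<subseteq> cbox a' b'"
    unfolding a'_def b'_def by (auto simp: mem_box_cart) (smt (verit))+
  have ne: "box a' b' \<noteq> {}"
  proof -
    obtain t where "chi t \<noteq> 0" using assms(2) by auto
    then have "t \<in> cbox a b" using K(3) ab by blast
    then have "t \<in> box a' b'" unfolding a'_def b'_def by (auto simp: mem_box_cart less_le_trans) (smt (verit))+
    then show ?thesis by blast
  qed
  have "(LINT t|lborel. chi t * cnj (chi t)) = integral (cbox a' b') (\<lambda>t. chi t * cnj (chi t))"
  proof (rule integrable_compact_support(2))
    show "continuous_on UNIV (\<lambda>t. chi t * cnj (chi t))" by (intro continuous_intros c)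
    show "chi x * cnj (chi x) = 0" if "x \<notin> cbox a' b'" for x
      using that ab ab' K(3) by auto
  qed
  also have "\<dots> = integral (cbox a' b') (\<lambda>t. complex_of_real ((cmod (chi t))\<^sup>2))"
    by (simp only: complex_norm_square)
  also have "\<dots> = complex_of_real (integral (cbox a' b') (\<lambda>t. (cmod (chi t))\<^sup>2))"
    using integral_linear[OF integrable_continuous bounded_linear_of_real[where 'a = complex], of a' b' "\<lambda>t. (cmod (chi t))\<^sup>2"]
    by (simp add: o_def c continuous_on_norm continuous_on_power)
  finally have "integral (cbox a' b') (\<lambda>t. (cmod (chi t))\<^sup>2) = 0" using zero by simp
  moreover have c2: "continuous_on (cbox a' b') (\<lambda>t. (cmod (chi t))\<^sup>2)"
    by (intro continuous_on_power continuous_on_norm c)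
  ultimately have hi: "((\<lambda>t. (cmod (chi t))\<^sup>2) has_integral 0) (cbox a' b')"
    using integrable_integral[OF integrable_continuous[OF c2]] by simp
  have z: "(cmod (chi t))\<^sup>2 = 0" if "t \<in> cbox a' b'" for t
    using has_integral_0_cbox_imp_0[OF c2 _ hi ne that] by simp
  have "chi t = 0" for t
  proof (cases "t \<in> cbox a' b'")
    case True
    then show ?thesis using z by simp
  next
    case False
    then show ?thesis using K(3) ab ab' by blast
  qed
  then show False using assms(2) by auto
qed

text \<open>No bump function has to be constructed: the given window yields the test function \<open>|\<chi>|\<^sup>2\<close> of
  non-zero integral, and its convolutions with the indicator functions of growing cubes are cutoffs.\<close>

lemma cutoff_sequence_exists:
  fixes chi :: "real^'n \<Rightarrow> complex"
  assumes "chi \<in> test_functions U" "chi \<noteq> (\<lambda>t. 0)"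
  obtains \<eta> :: "nat \<Rightarrow> real^'n \<Rightarrow> complex" where "cutoff_sequence \<eta>"
proof -
  define I where "I = (LINT t|lborel. chi t * cnj (chi t))"
  have I: "I \<noteq> 0" unfolding I_def by (rule test_function_energy_pos[OF assms])
  define \<rho> where "\<rho> t = 1 / I * (chi t * cnj (chi t))" for t
  have "\<rho> \<in> test_functions U"
    unfolding \<rho>_def using test_functions_smooth[OF assms(1)]
    by (intro test_functions_cmult test_functions_mult(2) assms(1) smooth_cnj)
  then obtain K where K: "smooth \<rho>" "compact K" "\<And>t. t \<notin> K \<Longrightarrow> \<rho> t = 0"
    by (rule test_functionsE) (rule that)
  obtain r where r: "r > 0" "\<And>t. t \<in> K \<Longrightarrow> norm t \<le> r"
    using compact_imp_bounded[OF K(2)] unfolding bounded_pos by blast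
  have int: "(LINT t|lborel. \<rho> t) = 1"
    unfolding \<rho>_def integral_mult_right_zero I_def[symmetric] using I by simp
  define Q where "Q n = cbox (vec (- real n)) (vec (real n) :: real^'n)" for n
  define \<eta> where "\<eta> n t = integral (Q n) (\<lambda>s. \<rho> (t - s))" for n t
  have fam: "smooth_family (\<lambda>s t. \<rho> (t - s))" by (rule smooth_family_shift[OF K(1) continuous_on_id])
  have Qr: "s \<in> Q n" if "norm s \<le> real n" for s n
    using that component_le_norm_cart[of s] unfolding Q_def mem_box_cart
    by (metis abs_le_iff minus_le_iff order_trans vec_component)
  have "\<eta> n \<in> test_functions UNIV" for n
  proof (rule test_functionsI)
    show "smooth (\<eta> n)" unfolding \<eta>_def Q_def by (rule smooth_integral[OF fam])
    show "compact ((\<lambda>(s, x). s + x) ` (K \<times> Q n))"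
      unfolding Q_def case_prod_unfold by (intro compact_continuous_image compact_Times K compact_cbox continuous_intros)
    show "\<eta> n t = 0" if t: "t \<notin> (\<lambda>(s, x). s + x) ` (K \<times> Q n)" for t
    proof -
      have "\<rho> (t - s) = 0" if "s \<in> Q n" for s
      proof (rule K(3), rule notI)
        assume "t - s \<in> K"
        then have "(\<lambda>(s, x). s + x) (t - s, s) \<in> (\<lambda>(s, x). s + x) ` (K \<times> Q n)" using that by blast
        then show False using t by simp
      qed
      then have "\<eta> n t = integral (Q n) (\<lambda>s. 0)" unfolding \<eta>_def by (intro integral_cong)
      then show ?thesis by simp
    qed
  qed simp
  \<comment> \<open>For such \<open>t\<close> the support of \<open>\<rho> (t - s)\<close> in
    \<open>s\<close> lies inside \<open>Q n\<close>, so the cube does not cut anything off the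
    integral of \<open>\<rho>\<close>, which is 1.\<close>
  moreover have "\<eta> n t = 1" if t: "norm t < real n - r" for n t
  proof -
    have "\<eta> n t = (LINT s|lborel. \<rho> (t - s))"
      unfolding \<eta>_def Q_def
    proof (rule integrable_compact_support(2)[symmetric])
      show "continuous_on UNIV (\<lambda>s. \<rho> (t - s))"
        by (rule continuous_on_compose2[OF smooth_continuous[OF K(1)]]) (auto intro!: continuous_intros)
      show "\<rho> (t - s) = 0" if "s \<notin> cbox (vec (- real n)) (vec (real n))" for s
      proof (rule K(3), rule notI)
        assume "t - s \<in> K"
        then have "norm (t - s) \<le> r" by (rule r(2))
        then have "norm s \<le> real n" using t norm_triangle_ineq4[of t "t - s"] by simp
        then show False using Qr[of s n] that by (simp add: Q_def)
      qed
    qed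
    also have "\<dots> = 1"
      using lborel_integral_reflect[OF borel_measurable_continuous_onI[OF smooth_continuous[OF K(1)]]] int by simp
    finally show ?thesis .
  qed
  moreover have "\<exists>M. \<forall>n t. cmod (pderivs js (\<eta> n) t) \<le> M" for js
  proof -
    let ?g = "pderivs js \<rho>"
    have gc: "continuous_on UNIV ?g" by (rule smooth_pderivs_continuous[OF K(1)])
    have g0: "?g t = 0" if "t \<notin> K" for t
      by (rule pderivs_zero_outside[OF compact_imp_closed[OF K(2)] K(1,3) that])
    have "bounded (?g ` K)"
      by (intro compact_imp_bounded compact_continuous_image K continuous_on_subset[OF gc]) simp
    then obtain m where m: "m > 0" "\<And>t. t \<in> K \<Longrightarrow> cmod (?g t) \<le> m" unfolding bounded_pos by auto
    then have m': "cmod (?g t) \<le> m" for t using g0[of t] by (cases "t \<in> K") auto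
    define V where "V = measure lborel (cbox (vec (- r)) (vec r :: real^'n))"
    \<comment> \<open>All derivatives fall on \<open>\<rho>\<close>, and the integrand lives in a
      box of side \<open>2 * r\<close> about \<open>t\<close> whatever the size of the cube
      \<open>Q n\<close>; hence a bound without \<open>n\<close>.\<close>
    have "cmod (pderivs js (\<eta> n) t) \<le> m * V" for n t
    proof -
      let ?R = "cbox (t + vec (- r)) (t + vec r)"
      have supp: "?g (t - s) = 0" if "s \<notin> ?R" for s
      proof (rule g0, rule notI)
        assume "t - s \<in> K"
        then have "norm (t - s) \<le> r" by (rule r(2))
        then have "\<bar>t $ i - s $ i\<bar> \<le> r" for i using component_le_norm_cart[of "t - s" i] by simp
        then have "s \<in> ?R" by (auto simp: mem_box_cart abs_le_iff) (smt (verit))+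
        then show False using that by simp
      qed
      obtain u v where uv: "?R \<inter> Q n = cbox u v" unfolding Q_def Int_interval by blast
      have "pderivs js (\<eta> n) t = integral (Q n) (\<lambda>s. ?g (t - s))"
        unfolding \<eta>_def Q_def pderivs_integral[OF fam] by (simp add: pderivs_shift[OF K(1)])
      also have "\<dots> = integral (Q n) (\<lambda>s. if s \<in> ?R then ?g (t - s) else 0)"
        using supp by (intro integral_cong) auto
      also have "\<dots> = integral (cbox u v) (\<lambda>s. ?g (t - s))"
        unfolding uv[symmetric] by (rule integral_restrict_Int)
      finally have "cmod (pderivs js (\<eta> n) t) = cmod (integral (cbox u v) (\<lambda>s. ?g (t - s)))" by simp
      also have "\<dots> \<le> m * measure lborel (cbox u v)"
        using m(1) m' by (intro integrable_bound integrable_continuous continuous_on_compose2[OF gc] continuous_intros) auto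
      also have "\<dots> \<le> m * measure lborel ?R"
        using m(1) uv by (intro mult_left_mono content_subset) auto
      also have "measure lborel ?R = V"
      proof -
        have "t \<in> ?R" "0 \<in> cbox (vec (- r)) (vec r :: real^'n)" using r(1) by (auto simp: mem_box_cart)
        then have "?R \<noteq> {}" "cbox (vec (- r)) (vec r :: real^'n) \<noteq> {}" by blast+
        then show ?thesis unfolding V_def by (simp add: content_cbox_cart)
      qed
      finally show ?thesis .
    qed
    then show ?thesis by blast
  qed
  ultimately have "cutoff_sequence \<eta>" unfolding cutoff_sequence_def by blast
  then show ?thesis by (rule that)
qed

text \<open>\<open>(\<eta> n - 1) * f\<close> vanishes on the ball of radius
  \<open>real n - r\<close>. Outside it one surplus power of the weight, available from the seminorm
  of order \<open>k + 1\<close>, yields a factor that tends to zero.\<close>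

lemma cutoff_converges:
  assumes \<eta>: "cutoff_sequence \<eta>" and f: "f \<in> schwartz_space"
  shows "limitin schwartz_topology (\<lambda>n t. \<eta> n t * f t) f sequentially"
    and "\<And>n. (\<lambda>t. \<eta> n t * f t) \<in> test_functions UNIV"
proof -
  obtain r where r: "\<And>n t. norm t < real n - r \<Longrightarrow> \<eta> n t = 1" using \<eta> by (auto simp: cutoff_sequence_def)
  have \<eta>D: "\<eta> n \<in> test_functions UNIV" for n using \<eta> by (simp add: cutoff_sequence_def)
  have fs: "smooth f" using f by (simp add: schwartz_space_def)
  show D: "(\<lambda>t. \<eta> n t * f t) \<in> test_functions UNIV" for n by (rule test_functions_mult(2)[OF \<eta>D fs])
  have "\<exists>M. \<forall>n t. cmod (pderivs js (\<eta> n) t) \<le> M" for js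
    using \<eta> by (simp add: cutoff_sequence_def)
  then obtain M where M: "\<And>js n t. cmod (pderivs js (\<eta> n) t) \<le> M js" by metis
  have "(\<lambda>n. schwartz_seminorm k (\<lambda>t. \<eta> n t * f t - f t)) \<longlonglongrightarrow> 0" for k
  proof -
    define J where "J = {js :: 'a list. length js \<le> k}"
    have J: "finite J" unfolding J_def by (rule finite_multi_indices)
    define L where "L = (\<Sum>js\<in>J. \<bar>M js\<bar>) + 1"
    define S where "S = schwartz_seminorm (k + 1) f"
    have S: "schwartz_bound (k + 1) f S" "S \<ge> 0" unfolding S_def by (rule schwartz_space_bound[OF f])+
    \<comment> \<open>\<open>2 ^ k\<close> from the product rule, \<open>L\<close> for the
      derivatives of \<open>\<eta> n - 1\<close>, and \<open>S\<close> for those of \<open>f\<close>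
      with the weight of order \<open>k + 1\<close>.\<close>
    define C where "C = 2 ^ k * L * S"
    have L: "L \<ge> 1" unfolding L_def by (simp add: sum_nonneg)
    have C: "C \<ge> 0" unfolding C_def using L S(2) by simp
    have bound: "schwartz_seminorm k (\<lambda>t. \<eta> n t * f t - f t) \<le> C / (1 + (real n - r))" if n: "real n > r" for n
    proof (rule schwartz_seminorm_le)
      let ?d = "\<lambda>t. \<eta> n t - 1"
      have ds: "smooth ?d" by (rule smooth_diff[OF test_functions_smooth[OF \<eta>D] smooth_const])
      have eq: "(\<lambda>t. \<eta> n t * f t - f t) = (\<lambda>t. ?d t * f t)" by (simp add: algebra_simps)
      show "schwartz_bound k (\<lambda>t. \<eta> n t * f t - f t) (C / (1 + (real n - r)))"
        unfolding schwartz_bound_def eq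
      proof (intro allI impI)
        fix js :: "'a list" and t :: "real^'a" assume js: "length js \<le> k"
        show "(1 + norm t) ^ k * cmod (pderivs js (\<lambda>t. ?d t * f t) t) \<le> C / (1 + (real n - r))"
        proof (cases "norm t < real n - r")
          case True
          have "pderivs js (\<lambda>t. ?d t * f t) t = pderivs js (\<lambda>t. 0) t"
            using True r by (intro pderivs_cong_open(1)[of "ball 0 (real n - r)"] smooth_mult ds fs) auto
          then show ?thesis using C n by simp
        next
          case False
          have Mf: "cmod (pderivs ks f t) \<le> S / (1 + norm t) ^ (k + 1)" if "length ks \<le> length js" for ks
          proof -
            have "(1 + norm t) ^ (k + 1) * cmod (pderivs ks f t) \<le> S"
              using S(1) that js unfolding schwartz_bound_def by simp
            moreover have "(1 + norm t) ^ (k + 1) > 0" by (intro zero_less_power) (simp add: add_pos_nonneg)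
            ultimately show ?thesis by (simp add: pos_le_divide_eq mult.commute)
          qed
          have Md: "cmod (pderivs ks ?d t) \<le> L" if "length ks \<le> length js" for ks
          proof -
            have ks: "ks \<in> J" using that js by (simp add: J_def)
            have "cmod (pderivs ks (\<lambda>t. 1 :: complex) t) \<le> 1" by (cases ks rule: rev_cases) (simp_all add: pderivs_append)
            then have "cmod (pderivs ks ?d t) \<le> M ks + 1"
              unfolding pderivs_diff[OF test_functions_smooth[OF \<eta>D] smooth_const]
              using norm_triangle_ineq4[of "pderivs ks (\<eta> n) t" "pderivs ks (\<lambda>t. 1) t"] M[of ks n t] by linarith
            moreover have "\<bar>M ks\<bar> \<le> (\<Sum>js\<in>J. \<bar>M js\<bar>)" by (rule member_le_sum[OF ks _ J]) simp
            ultimately show ?thesis unfolding L_def by linarith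
          qed
          define w where "w = 1 + norm t"
          have w: "w > 0" "w \<ge> 1 + (real n - r)" unfolding w_def using False by (auto simp: add_pos_nonneg)
          have "cmod (pderivs js (\<lambda>t. ?d t * f t) t) \<le> 2 ^ length js * L * (S / w ^ (k + 1))"
            unfolding w_def by (rule pderivs_mult_bound[OF ds fs Md Mf])
          also have "\<dots> \<le> 2 ^ k * L * (S / w ^ (k + 1))"
            using L S(2) w(1) js by (intro mult_right_mono power_increasing) auto
          finally have "w ^ k * cmod (pderivs js (\<lambda>t. ?d t * f t) t) \<le> w ^ k * (2 ^ k * L * (S / w ^ (k + 1)))"
            using w(1) by (intro mult_left_mono) auto
          also have "\<dots> = C / w" using w(1) by (simp add: C_def field_simps)
          also have "\<dots> \<le> C / (1 + (real n - r))" using w n C by (intro divide_left_mono) auto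
          finally show ?thesis by (simp add: w_def)
        qed
      qed
    qed
    have nonneg: "0 \<le> schwartz_seminorm k (\<lambda>t. \<eta> n t * f t - f t)" for n
    proof -
      have "(\<lambda>t. \<eta> n t * f t - f t) \<in> schwartz_space"
      proof -
        have a: "(\<lambda>t. \<eta> n t * f t) \<in> schwartz_space" using D test_functions_subset_schwartz by blast
        show ?thesis
          unfolding schwartz_space_def mem_Collect_eq
        proof (intro conjI allI)
          have sm: "smooth (\<lambda>t. \<eta> n t * f t)" using a by (simp add: schwartz_space_def)
          then show "smooth (\<lambda>t. \<eta> n t * f t - f t)" using fs by (rule smooth_diff)
          show "bounded (range (\<lambda>x. (1 + norm x) ^ j *\<^sub>R pderivs js (\<lambda>t. \<eta> n t * f t - f t) x))" for j js
            unfolding pderivs_diff[OF sm fs] scaleR_diff_right using a f unfolding schwartz_space_def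
            by (intro bounded_minus_comp) blast+
        qed
      qed
      then show ?thesis by (rule schwartz_space_bound(2))
    qed
    have lim: "(\<lambda>n. C / ((1 - r) + real n)) \<longlonglongrightarrow> 0"
      by (intro tendsto_divide_0[OF tendsto_const] filterlim_at_top_imp_at_infinity
        filterlim_tendsto_add_at_top[OF tendsto_const] filterlim_real_sequentially)
    have "(\<lambda>n. C / (1 + (real n - r))) \<longlonglongrightarrow> 0"
    proof -
      have "1 + (real n - r) = (1 - r) + real n" for n by simp
      then show ?thesis using lim by (simp only:)
    qed
    moreover have ev: "\<forall>\<^sub>F n in sequentially. schwartz_seminorm k (\<lambda>t. \<eta> n t * f t - f t) \<le> C / (1 + (real n - r))"
      using eventually_gt_at_top[of "nat \<lceil>r\<rceil>"] by eventually_elim (rule bound, linarith)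
    ultimately show ?thesis
      by (intro tendsto_sandwich[OF always_eventually[OF allI[OF nonneg]] ev tendsto_const])
  qed
  then show "limitin schwartz_topology (\<lambda>n t. \<eta> n t * f t) f sequentially"
    unfolding schwartz_topology_def
    by (intro limitin_lc_topology) (use f D test_functions_subset_schwartz in auto)
qed

section \<open>Translation-modulation invariant spaces\<close>

text \<open>A translation is the composite of two reflections.\<close>

lemma lborel_integral_translate:
  fixes g :: "real^'n \<Rightarrow> complex"
  assumes "continuous_on UNIV g"
  shows "(LINT x|lborel. g (x + a)) = (LINT x|lborel. g x)"
proof -
  have h: "continuous_on UNIV (\<lambda>x. g (a - x))"
    by (rule continuous_on_compose2[OF assms]) (auto intro!: continuous_intros)
  have "(LINT x|lborel. g (a - (0 - x))) = (LINT x|lborel. g (a - x))"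
    by (rule lborel_integral_reflect[OF borel_measurable_continuous_onI[OF h]])
  also have "\<dots> = (LINT x|lborel. g x)"
    by (rule lborel_integral_reflect[OF borel_measurable_continuous_onI[OF assms]])
  finally show ?thesis by (simp add: add.commute)
qed

lemma pairing_add:
  assumes "f \<in> test_functions UNIV" "g \<in> test_functions UNIV" "continuous_on UNIV h"
  shows "pairing (\<lambda>x. f x + g x) h = pairing f h + pairing g h"
  using test_function_integrable(1)[OF assms(1,3)] test_function_integrable(1)[OF assms(2,3)]
  by (simp add: ring_distribs)

lemma pairing_cmult: "pairing (\<lambda>x. a * f x) h = a * pairing f h"
  by (simp add: mult.assoc)

lemma pairing_sum:
  assumes "finite A" "\<And>a. a \<in> A \<Longrightarrow> f a \<in> test_functions UNIV" "continuous_on UNIV h"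
  shows "pairing (\<lambda>x. \<Sum>a\<in>A. c a * f a x) h = (\<Sum>a\<in>A. c a * pairing (f a) h)"
  using assms(1,2)
proof (induction A rule: finite_induct)
  case empty then show ?case by simp
next
  case (insert b A)
  have "pairing (\<lambda>x. c b * f b x + (\<Sum>a\<in>A. c a * f a x)) h =
      pairing (\<lambda>x. c b * f b x) h + pairing (\<lambda>x. \<Sum>a\<in>A. c a * f a x) h"
    using insert.prems by (intro pairing_add test_functions_cmult test_functions_sum assms(3)) auto
  then show ?case using insert by (simp add: pairing_cmult)
qed

lemma schwartz_embed_test_function:
  "\<phi> \<in> test_functions UNIV \<Longrightarrow> schwartz_embed f \<phi> = pairing f \<phi>"
  using test_functions_subset_schwartz by (auto simp: regular_distribution_def)

lemma schwartz_space_continuous: "\<phi> \<in> schwartz_space \<Longrightarrow> continuous_on UNIV \<phi>"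
  by (simp add: schwartz_space_def smooth_continuous)

lemma schwartz_embed_add:
  assumes "f \<in> test_functions UNIV" "g \<in> test_functions UNIV"
  shows "schwartz_embed (\<lambda>x. f x + g x) = (\<lambda>\<phi>. schwartz_embed f \<phi> + schwartz_embed g \<phi>)"
  unfolding regular_distribution_def
  using pairing_add[OF assms schwartz_space_continuous] by (intro ext) simp

lemma schwartz_embed_cmult: "schwartz_embed (\<lambda>x. a * f x) = (\<lambda>\<phi>. a * schwartz_embed f \<phi>)"
  unfolding regular_distribution_def by (intro ext) (simp add: mult.assoc)

lemma schwartz_embed_diff:
  assumes "f \<in> test_functions UNIV" "g \<in> test_functions UNIV"
  shows "schwartz_embed (\<lambda>x. f x - g x) = (\<lambda>\<phi>. schwartz_embed f \<phi> - schwartz_embed g \<phi>)"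
  using schwartz_embed_add[OF assms(1) test_functions_cmult[OF assms(2), of "-1"]]
  unfolding schwartz_embed_cmult[of "-1"] by simp

lemma tempered_limit:
  assumes "cutoff_sequence \<eta>" "u \<in> tempered_distributions" "\<phi> \<in> schwartz_space"
  shows "(\<lambda>n. u (\<lambda>t. \<eta> n t * \<phi> t)) \<longlonglongrightarrow> u \<phi>"
proof -
  have "continuous_map schwartz_topology euclidean u" using assms(2) by (simp add: tempered_distributions_def)
  from continuous_map_limit[OF this cutoff_converges(1)[OF assms(1,3)]] show ?thesis
    by (simp add: o_def limitin_canonical_iff)
qed

text \<open>Cutoffs make the test functions dense among Schwartz functions; off the Schwartz space
  both functionals are zero by convention.\<close>

lemma tempered_eqI:
  fixes u v :: "(real^'n \<Rightarrow> complex) \<Rightarrow> complex" and \<eta> :: "nat \<Rightarrow> real^'n \<Rightarrow> complex"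
  assumes "cutoff_sequence \<eta>" "u \<in> tempered_distributions" "v \<in> tempered_distributions"
    and eq: "\<And>\<phi>. \<phi> \<in> test_functions UNIV \<Longrightarrow> u \<phi> = v \<phi>"
  shows "u = v"
proof
  fix \<phi>
  show "u \<phi> = v \<phi>"
  proof (cases "\<phi> \<in> schwartz_space")
    case True
    have "(\<lambda>n. u (\<lambda>t. \<eta> n t * \<phi> t)) \<longlonglongrightarrow> v \<phi>"
      using tempered_limit[OF assms(1,3) True] eq[OF cutoff_converges(2)[OF assms(1) True]] by simp
    then show ?thesis using tempered_limit[OF assms(1,2) True] LIMSEQ_unique by blast
  next
    case False
    then show ?thesis
      using assms(2,3) unfolding tempered_distributions_def linear_functional_def by simp
  qed
qed

text \<open>Turns continuity at zero into a norm estimate by scaling, for any absolutely homogeneous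
  \<open>p\<close>.\<close>

lemma homogeneous_bound:
  assumes "complex_subspace V" "norm_on V N"
    and hom: "\<And>a u. u \<in> V \<Longrightarrow> p (\<lambda>x. a * u x) = cmod a * p u"
    and "\<delta> > 0" "\<And>u. u \<in> V \<Longrightarrow> N u < \<delta> \<Longrightarrow> p u < 1" "u \<in> V"
  shows "p u \<le> 2 / \<delta> * N u"
proof (rule field_le_epsilon)
  fix e :: real assume "e > 0"
  \<comment> \<open>Slightly larger than \<open>N u\<close>, hence positive even if
    \<open>N u = 0\<close>, so that scaling by \<open>\<delta> / (2 * s)\<close> is always
    possible.\<close>
  define s where "s = N u + \<delta> / 2 * e"
  have s: "s > 0" "N u < s" using norm_onD(1)[OF assms(2,6)] \<open>e > 0\<close> \<open>\<delta> > 0\<close> by (auto simp: s_def add_nonneg_pos)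
  define c where "c = \<delta> / (2 * s)"
  have c: "c > 0" unfolding c_def using s \<open>\<delta> > 0\<close> by simp
  have "N (\<lambda>x. complex_of_real c * u x) = c * N u" using norm_onD(3)[OF assms(2,6)] c by simp
  also have "\<dots> \<le> c * s" using c s by simp
  also have "\<dots> < \<delta>" using s \<open>\<delta> > 0\<close> by (simp add: c_def)
  finally have "p (\<lambda>x. complex_of_real c * u x) < 1"
    by (intro assms(5) complex_subspaceD(3)[OF assms(1,6)])
  then have "c * p u < 1" using hom[OF assms(6)] c by simp
  then have "p u < 2 * s / \<delta>" using s \<open>\<delta> > 0\<close> by (simp add: c_def field_simps)
  also have "\<dots> = 2 / \<delta> * N u + e" using \<open>\<delta> > 0\<close> by (simp add: s_def field_simps)
  finally show "p u \<le> 2 / \<delta> * N u + e" by simp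
qed

section \<open>Consequences of the axioms of a TMIB\<close>

context
  fixes E :: "((real^'n \<Rightarrow> complex) \<Rightarrow> complex) set" and N
  assumes E: "TMIB E N"
begin

lemma TMIB_D:
  "complex_banach_space E N" "schwartz_embed ` schwartz_space \<subseteq> E"
  "continuous_map schwartz_topology (norm_topology E N) schwartz_embed"
  "norm_topology E N closure_of (schwartz_embed ` schwartz_space) = E"
  "E \<subseteq> tempered_distributions"
  "continuous_map (norm_topology E N) tempered_topology (\<lambda>u. u)"
  "\<forall>x. dist_translation x ` E \<subseteq> E" "\<forall>\<xi>. dist_modulation \<xi> ` E \<subseteq> E"
  "\<exists>C>0. \<exists>\<tau>>0.
        (\<forall>x. \<forall>u\<in>E. N (dist_translation x u) \<le> C * (1 + norm x) powr \<tau> * N u) \<and>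
        (\<forall>\<xi>. \<forall>u\<in>E. N (dist_modulation (- \<xi>) u) \<le> C * (1 + norm \<xi>) powr \<tau> * N u)"
  using E unfolding TMIB_def by iprover+

lemma TMIB_banach: "complex_banach_space E N" "complex_subspace E" "norm_on E N"
  using TMIB_D(1) by (simp_all add: complex_banach_space_def)

lemma TMIB_tempered: "u \<in> E \<Longrightarrow> u \<in> tempered_distributions"
  using TMIB_D(5) by blast

lemma TMIB_linear:
  assumes "u \<in> E" "f \<in> schwartz_space" "g \<in> schwartz_space"
  shows "u (\<lambda>x. f x + g x) = u f + u g" "u (\<lambda>x. a * f x) = a * u f"
  using TMIB_tempered[OF assms(1)] assms(2,3) by (simp_all add: tempered_distributions_def linear_functional_def)

lemma TMIB_embed: "f \<in> test_functions UNIV \<Longrightarrow> schwartz_embed f \<in> E"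
  using TMIB_D(2) test_functions_subset_schwartz by blast

text \<open>A singleton is a bounded set of Schwartz functions, so evaluation at
  \<open>\<phi>\<close> is controlled by a seminorm of the strong dual topology, and the inclusion
  of \<open>E\<close> is continuous for that topology.\<close>

lemma TMIB_evaluation_bound:
  assumes "\<phi> \<in> schwartz_space"
  obtains C where "C \<ge> 0" "\<And>u. u \<in> E \<Longrightarrow> cmod (u \<phi>) \<le> C * N u"
proof -
  define W where "W = {v \<in> tempered_distributions. cmod (v \<phi>) < 1}"
  define p where "p = (\<lambda>u :: (real^'n \<Rightarrow> complex) \<Rightarrow> complex. SUP \<psi>\<in>{\<phi>}. cmod (u \<psi>))"
  have "schwartz_bounded {\<phi>}" using assms by (simp add: schwartz_bounded_def)
  then have p: "p \<in> {(\<lambda>u. SUP \<phi>\<in>A. cmod (u \<phi>)) | A. schwartz_bounded A \<and> A \<noteq> {}}"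
    unfolding p_def by blast
  have "openin tempered_topology W"
    unfolding tempered_topology_def openin_lc_topology
  proof (intro conjI ballI)
    show "W \<subseteq> tempered_distributions" by (auto simp: W_def)
    fix u assume u: "u \<in> W"
    have "{v \<in> tempered_distributions. \<forall>p\<in>{p}. p (\<lambda>x. v x - u x) < 1 - cmod (u \<phi>)} \<subseteq> W"
    proof
      fix v assume v: "v \<in> {v \<in> tempered_distributions. \<forall>p\<in>{p}. p (\<lambda>x. v x - u x) < 1 - cmod (u \<phi>)}"
      then have "cmod (v \<phi> - u \<phi>) < 1 - cmod (u \<phi>)" by (simp add: p_def)
      then have "cmod (v \<phi>) < 1" using norm_triangle_sub[of "v \<phi>" "u \<phi>"] by simp
      then show "v \<in> W" using v by (simp add: W_def)
    qed
    then show "\<exists>F \<epsilon>. finite F \<and> F \<subseteq> {(\<lambda>u. SUP \<phi>\<in>A. cmod (u \<phi>)) | A. schwartz_bounded A \<and> A \<noteq> {}} \<and> 0 < \<epsilon> \<and>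
        {v \<in> tempered_distributions. \<forall>p\<in>F. p (\<lambda>x. v x - u x) < \<epsilon>} \<subseteq> W"
      using p u by (intro exI[of _ "{p}"] exI[of _ "1 - cmod (u \<phi>)"]) (auto simp: W_def)
  qed
  moreover have "(\<lambda>x. 0) \<in> W"
    using TMIB_tempered complex_subspaceD(1)[OF TMIB_banach(2)] by (simp add: W_def)
  ultimately obtain \<delta> where \<delta>: "\<delta> > 0" "\<And>u. u \<in> E \<Longrightarrow> N u < \<delta> \<Longrightarrow> u \<in> W"
    by (rule continuous_norm_topology_at_zero[OF TMIB_banach(2,3) TMIB_D(6)]) (rule that)
  have "cmod (u \<phi>) \<le> 2 / \<delta> * N u" if "u \<in> E" for u
    using \<delta> that
    by (intro homogeneous_bound[OF TMIB_banach(2,3), where p = "\<lambda>u. cmod (u \<phi>)"]) (auto simp: norm_mult W_def)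
  then show ?thesis using \<delta>(1) by (intro that[of "2 / \<delta>"]) auto
qed

text \<open>Continuity of the embedding at zero yields finitely many Schwartz seminorms whose
  smallness forces the norm below 1; scaling turns this into an estimate.\<close>

lemma TMIB_dominated:
  "\<exists>C\<ge>0. \<exists>k. \<forall>f\<in>test_functions UNIV. \<forall>S. schwartz_bound k f S \<longrightarrow> N (schwartz_embed f) \<le> C * S"
proof -
  interpret M: Metric_space E "norm_dist E N" by (rule Metric_space_norm_dist[OF TMIB_banach(2,3)])
  have 0: "(\<lambda>x. 0) \<in> E" by (rule complex_subspaceD(1)[OF TMIB_banach(2)])
  have emb0: "schwartz_embed (\<lambda>x. 0) = (\<lambda>\<phi>. 0)" by (auto simp: regular_distribution_def)
  define X where "X = {\<phi> \<in> topspace schwartz_topology. schwartz_embed \<phi> \<in> M.mball (\<lambda>x. 0) 1}"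
  have X: "openin schwartz_topology X"
    unfolding X_def by (rule openin_continuous_map_preimage[OF TMIB_D(3)]) (simp add: norm_topology_def)
  have "openin schwartz_topology schwartz_space"
    unfolding schwartz_topology_def openin_lc_topology by (auto intro!: exI[of _ "{}"] exI[of _ 1])
  then have "schwartz_space \<subseteq> topspace schwartz_topology" by (rule openin_subset)
  then have "(\<lambda>x. 0) \<in> topspace schwartz_topology"
    using test_functions_zero test_functions_subset_schwartz by blast
  then have X0: "(\<lambda>x. 0) \<in> X"
    unfolding X_def mem_Collect_eq emb0 using 0 by simp
  obtain F \<epsilon> where F: "finite F" "F \<subseteq> range schwartz_seminorm" "\<epsilon> > 0"
      "{v \<in> schwartz_space. \<forall>p\<in>F. p (\<lambda>x. v x - 0) < \<epsilon>} \<subseteq> X"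
    using bspec[OF conjunct2[OF openin_lc_topology[THEN iffD1, OF X[unfolded schwartz_topology_def]]] X0]
    by (elim exE conjE) (rule that)
  obtain J where J: "finite J" "F = schwartz_seminorm ` J" using finite_subset_image[OF F(1,2)] by blast
  \<comment> \<open>The seminorms increase with their order, so the largest one controls the others;
    inserting 0 covers the case of no seminorm at all.\<close>
  define k where "k = Max (insert 0 J)"
  have k: "j \<le> k" if "j \<in> J" for j unfolding k_def using J(1) that by simp
  have small: "N (schwartz_embed f) < 1" if f: "f \<in> test_functions UNIV" "schwartz_bound k f s" "s < \<epsilon>" for f s
  proof -
    have fS: "f \<in> schwartz_space" using f(1) test_functions_subset_schwartz by blast
    have "schwartz_seminorm j f < \<epsilon>" if "j \<in> J" for j
    proof -
      have "schwartz_bound j f s"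
        unfolding schwartz_bound_def
      proof (intro allI impI)
        fix js :: "'n list" and t assume js: "length js \<le> j"
        have "(1 + norm t) ^ j * cmod (pderivs js f t) \<le> (1 + norm t) ^ k * cmod (pderivs js f t)"
          using k[OF that] by (intro mult_right_mono power_increasing) auto
        also have "\<dots> \<le> s" using f(2) js k[OF that] by (simp add: schwartz_bound_def)
        finally show "(1 + norm t) ^ j * cmod (pderivs js f t) \<le> s" .
      qed
      then show ?thesis using schwartz_seminorm_le f(3) by fastforce
    qed
    then have "schwartz_embed f \<in> M.mball (\<lambda>x. 0) 1" using F(4) fS J(2) by (auto simp: X_def)
    then have "N (\<lambda>x. - schwartz_embed f x) < 1" using 0 TMIB_embed[OF f(1)] by (simp add: M.in_mball norm_dist_def)
    then show ?thesis using norm_on_minus[OF TMIB_banach(2,3) TMIB_embed[OF f(1)]] by simp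
  qed
  have "N (schwartz_embed f) \<le> 2 / \<epsilon> * s" if f: "f \<in> test_functions UNIV" "schwartz_bound k f s" for f s
  proof (rule field_le_epsilon)
    fix e :: real assume "e > 0"
    have "0 \<le> s"
    proof -
      have "0 \<le> (1 + norm (0 :: real^'n)) ^ k * cmod (pderivs [] f 0)" by simp
      also have "\<dots> \<le> s" using f(2) unfolding schwartz_bound_def by (metis le0 list.size(3))
      finally show ?thesis .
    qed
    \<comment> \<open>Exceeds \<open>s\<close> strictly, so that scaling remains possible for
      \<open>s = 0\<close>; the excess contributes exactly \<open>e\<close> in the end.\<close>
    define r where "r = s + \<epsilon> / 2 * e"
    have r: "r > 0" "s < r" using \<open>0 \<le> s\<close> \<open>e > 0\<close> F(3) by (auto simp: r_def add_nonneg_pos)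
    define c where "c = \<epsilon> / (2 * r)"
    have c: "c > 0" unfolding c_def using r F(3) by simp
    have "schwartz_bound k (\<lambda>t. complex_of_real c * f t) (c * s)"
      unfolding schwartz_bound_def pderivs_cmult[OF test_functions_smooth[OF f(1)]] norm_mult
      using f(2) c by (auto simp: schwartz_bound_def mult.left_commute[of _ c])
    moreover have "c * s < \<epsilon>"
    proof -
      have "c * s \<le> c * r" using c r by simp
      also have "\<dots> < \<epsilon>" using r F(3) by (simp add: c_def)
      finally show ?thesis .
    qed
    ultimately have "N (schwartz_embed (\<lambda>t. complex_of_real c * f t)) < 1"
      by (rule small[OF test_functions_cmult[OF f(1)]])
    then have "c * N (schwartz_embed f) < 1"
      unfolding schwartz_embed_cmult norm_onD(3)[OF TMIB_banach(3) TMIB_embed[OF f(1)]] using c by simp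
    then have "N (schwartz_embed f) < 2 * r / \<epsilon>" using r F(3) by (simp add: c_def field_simps)
    also have "\<dots> = 2 / \<epsilon> * s + e" using F(3) by (simp add: r_def field_simps)
    finally show "N (schwartz_embed f) \<le> 2 / \<epsilon> * s + e" by simp
  qed
  then show ?thesis using F(3) by (intro exI[of _ "2 / \<epsilon>"] conjI exI[of _ k]) auto
qed

context
  fixes \<eta> :: "nat \<Rightarrow> real^'n \<Rightarrow> complex"
  assumes \<eta>: "cutoff_sequence \<eta>"
begin

lemma TMIB_inj: "inj_on restrict_to_D E"
proof (rule inj_onI)
  fix u v assume uv: "u \<in> E" "v \<in> E" "restrict_to_D u = restrict_to_D v"
  have "u \<phi> = v \<phi>" if "\<phi> \<in> test_functions UNIV" for \<phi>
    using fun_cong[OF uv(3), of \<phi>] that by (simp add: restrict_to_D_def)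
  then show "u = v" using tempered_eqI[OF \<eta>] TMIB_tempered uv(1,2) by blast
qed

lemma TMIB_embed_limit:
  assumes "\<phi> \<in> schwartz_space"
  shows "schwartz_embed \<phi> \<in> E"
    and "(\<lambda>n. N (\<lambda>x. schwartz_embed (\<lambda>t. \<eta> n t * \<phi> t) x - schwartz_embed \<phi> x)) \<longlonglongrightarrow> 0"
proof -
  show "schwartz_embed \<phi> \<in> E" using TMIB_D(2) assms by blast
  from continuous_map_limit[OF TMIB_D(3) cutoff_converges(1)[OF \<eta> assms]]
  have "limitin (norm_topology E N) (\<lambda>n. schwartz_embed (\<lambda>t. \<eta> n t * \<phi> t)) (schwartz_embed \<phi>) sequentially"
    by (simp add: o_def)
  then show "(\<lambda>n. N (\<lambda>x. schwartz_embed (\<lambda>t. \<eta> n t * \<phi> t) x - schwartz_embed \<phi> x)) \<longlonglongrightarrow> 0"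
    using limitin_norm_topology[OF TMIB_banach(2,3), of "\<lambda>n. schwartz_embed (\<lambda>t. \<eta> n t * \<phi> t)"]
      TMIB_embed[OF cutoff_converges(2)[OF \<eta> assms]] by blast
qed

text \<open>Two approximations: Schwartz functions are dense in \<open>E\<close> by definition, and
  cutoffs approximate them in the Schwartz topology, hence also in \<open>E\<close>.\<close>

lemma TMIB_dense:
  assumes "u \<in> E" "\<epsilon> > 0"
  obtains f where "f \<in> test_functions UNIV" "N (\<lambda>x. u x - schwartz_embed f x) < \<epsilon>"
proof -
  have "u \<in> norm_topology E N closure_of (schwartz_embed ` schwartz_space)" using TMIB_D(4) assms(1) by simp
  then obtain s where s: "s \<in> schwartz_embed ` schwartz_space" "N (\<lambda>x. u x - s x) < \<epsilon> / 2"
    by (rule in_norm_closure[OF TMIB_banach(2,3) _ half_gt_zero[OF assms(2)]]) (rule that)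
  then obtain \<phi> where \<phi>: "\<phi> \<in> schwartz_space" "s = schwartz_embed \<phi>" by blast
  obtain n where n: "N (\<lambda>x. schwartz_embed (\<lambda>t. \<eta> n t * \<phi> t) x - schwartz_embed \<phi> x) < \<epsilon> / 2"
    using order_tendstoD(2)[OF TMIB_embed_limit(2)[OF \<phi>(1)], of "\<epsilon> / 2"] assms(2)
    unfolding eventually_sequentially by auto
  let ?f = "\<lambda>t. \<eta> n t * \<phi> t"
  have f: "?f \<in> test_functions UNIV" by (rule cutoff_converges(2)[OF \<eta> \<phi>(1)])
  have "N (\<lambda>x. u x - schwartz_embed ?f x) \<le> N (\<lambda>x. u x - s x) + N (\<lambda>x. s x - schwartz_embed ?f x)"
    using TMIB_embed_limit(1)[OF \<phi>(1)] \<phi>(2) by (intro norm_on_triangle3[OF TMIB_banach(2,3) assms(1) _ TMIB_embed[OF f]]) simp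
  also have "N (\<lambda>x. s x - schwartz_embed ?f x) = N (\<lambda>x. schwartz_embed ?f x - s x)"
    using TMIB_embed_limit(1)[OF \<phi>(1)] \<phi>(2) by (intro norm_on_diff_commute[OF TMIB_banach(2,3) _ TMIB_embed[OF f]]) simp
  finally have "N (\<lambda>x. u x - schwartz_embed ?f x) < \<epsilon>" using s(2) n \<phi>(2) by simp
  with f show ?thesis by (rule that)
qed

text \<open>The axioms speak of operators on distributions. Testing against test functions shows
  that these act on embedded functions as the pointwise translation and modulation, so the growth
  bounds pass to the pulled-back seminorm.\<close>

lemma TMIB_tf_seminorm:
  obtains C\<^sub>0 \<tau> where "tf_seminorm (\<lambda>f. N (schwartz_embed f)) C\<^sub>0 \<tau>"
proof -
  obtain C \<tau> where C: "C > 0" "\<tau> > 0"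
      "\<forall>x. \<forall>u\<in>E. N (dist_translation x u) \<le> C * (1 + norm x) powr \<tau> * N u"
      "\<forall>\<xi>. \<forall>u\<in>E. N (dist_modulation (- \<xi>) u) \<le> C * (1 + norm \<xi>) powr \<tau> * N u"
    using TMIB_D(9) by blast
  have inv: "dist_translation x u \<in> E" "dist_modulation \<xi> u \<in> E" if "u \<in> E" for x \<xi> u
    using TMIB_D(7,8) that by blast+
  \<comment> \<open>The real exponent is rounded up to a natural number, which only enlarges a power
    of \<open>1 + norm x\<close>.\<close>
  define k where "k = nat \<lceil>\<tau>\<rceil>"
  have pow: "C * (1 + norm x) powr \<tau> * N u \<le> C * (1 + norm x) ^ k * N u" if "u \<in> E" for x :: "real^'n" and u
  proof -
    have "(1 + norm x) powr \<tau> \<le> (1 + norm x) powr real k"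
      unfolding k_def by (intro powr_mono) (auto simp: real_nat_ceiling_ge)
    also have "\<dots> = (1 + norm x) ^ k" by (simp add: powr_realpow add_pos_nonneg)
    finally show ?thesis using C(1) norm_onD(1)[OF TMIB_banach(3) that] by (intro mult_right_mono mult_left_mono) auto
  qed
  have tr: "schwartz_embed (\<lambda>t. f (t - x)) = dist_translation x (schwartz_embed f)" if f: "f \<in> test_functions UNIV" for f :: "real^'n \<Rightarrow> complex" and x
  proof (rule tempered_eqI[OF \<eta> TMIB_tempered TMIB_tempered])
    show "schwartz_embed (\<lambda>t. f (t - x)) \<in> E" "dist_translation x (schwartz_embed f) \<in> E"
      using f by (auto intro!: TMIB_embed test_functions_shift inv)
    fix \<phi> :: "real^'n \<Rightarrow> complex" assume \<phi>: "\<phi> \<in> test_functions UNIV"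
    have tD: "translation (- x) \<phi> \<in> test_functions UNIV"
      unfolding translation_def using test_functions_shift[OF \<phi>, of "- x"] .
    have "continuous_on UNIV (\<lambda>t. f (t - x) * \<phi> t)"
      by (intro continuous_intros smooth_continuous[OF test_functions_smooth[OF \<phi>]]
        smooth_continuous[OF smooth_shift[OF test_functions_smooth[OF f]]])
    from lborel_integral_translate[OF this, of x]
    have "pairing f (\<lambda>t. \<phi> (t + x)) = pairing (\<lambda>t. f (t - x)) \<phi>" by simp
    then show "schwartz_embed (\<lambda>t. f (t - x)) \<phi> = dist_translation x (schwartz_embed f) \<phi>"
      using schwartz_embed_test_function[OF \<phi>] schwartz_embed_test_function[OF tD, of f]
      by (simp add: dist_translation_def translation_def)
  qed
  have md: "schwartz_embed (\<lambda>t. wave \<xi> t * f t) = dist_modulation \<xi> (schwartz_embed f)" if f: "f \<in> test_functions UNIV" for f :: "real^'n \<Rightarrow> complex" and \<xi>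
  proof (rule tempered_eqI[OF \<eta> TMIB_tempered TMIB_tempered])
    show "schwartz_embed (\<lambda>t. wave \<xi> t * f t) \<in> E" "dist_modulation \<xi> (schwartz_embed f) \<in> E"
      using f by (auto intro!: TMIB_embed test_functions_mult(1) smooth_wave inv)
    fix \<phi> :: "real^'n \<Rightarrow> complex" assume \<phi>: "\<phi> \<in> test_functions UNIV"
    have m: "modulation \<xi> \<phi> = (\<lambda>t. \<phi> t * wave \<xi> t)" by (simp add: modulation_def wave_def)
    have mD: "modulation \<xi> \<phi> \<in> test_functions UNIV"
      unfolding m by (rule test_functions_mult(2)[OF \<phi> smooth_wave])
    show "schwartz_embed (\<lambda>t. wave \<xi> t * f t) \<phi> = dist_modulation \<xi> (schwartz_embed f) \<phi>"
      unfolding dist_modulation_def schwartz_embed_test_function[OF \<phi>] schwartz_embed_test_function[OF mD]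
      unfolding m by (simp add: mult_ac)
  qed
  have "tf_seminorm (\<lambda>f. N (schwartz_embed f)) C k"
  proof
    fix f g :: "real^'n \<Rightarrow> complex" assume f: "f \<in> test_functions UNIV"
    show "N (schwartz_embed (\<lambda>t. c * f t)) = cmod c * N (schwartz_embed f)" for c
      unfolding schwartz_embed_cmult by (rule norm_onD(3)[OF TMIB_banach(3) TMIB_embed[OF f]])
    show "N (schwartz_embed (\<lambda>t. wave \<xi> t * f t)) \<le> C * (1 + norm \<xi>) ^ k * N (schwartz_embed f)" for \<xi>
      unfolding md[OF f] using C(4)[rule_format, of "schwartz_embed f" "- \<xi>"] pow[OF TMIB_embed[OF f], of \<xi>] TMIB_embed[OF f] by simp
    show "N (schwartz_embed (\<lambda>t. f (t - x))) \<le> C * (1 + norm x) ^ k * N (schwartz_embed f)" for x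
      unfolding tr[OF f] using C(3)[rule_format, of "schwartz_embed f" x] pow[OF TMIB_embed[OF f], of x] TMIB_embed[OF f] by simp
    assume g: "g \<in> test_functions UNIV"
    show "N (schwartz_embed (\<lambda>t. f t + g t)) \<le> N (schwartz_embed f) + N (schwartz_embed g)"
      unfolding schwartz_embed_add[OF f g] by (rule norm_onD(4)[OF TMIB_banach(3) TMIB_embed[OF f] TMIB_embed[OF g]])
  qed (rule TMIB_dominated, rule C(1))
  then show ?thesis by (rule that)
qed

end

end

section \<open>Extension of the frame operator\<close>

locale lattice_tiling = tiling_set \<Lambda> U for \<Lambda> U :: "(real^'n) set" +
  assumes lattice_add: "\<And>x y. x \<in> \<Lambda> \<Longrightarrow> y \<in> \<Lambda> \<Longrightarrow> x + y \<in> \<Lambda>"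
    and lattice_minus: "\<And>x. x \<in> \<Lambda> \<Longrightarrow> - x \<in> \<Lambda>" and lattice_span: "span \<Lambda> = UNIV"
begin

text \<open>What the two halves of the theorem need from \<open>E\<close>: it is a Banach space of distributions on
  which the transposed frame operators act boundedly.\<close>

definition admissible :: "((real^'n \<Rightarrow> complex) \<Rightarrow> complex) set \<Rightarrow> (((real^'n \<Rightarrow> complex) \<Rightarrow> complex) \<Rightarrow> real) \<Rightarrow> bool" where
  "admissible E N \<longleftrightarrow> complex_banach_space E N \<and> inj_on restrict_to_D E \<and>
    (\<forall>u\<in>E. \<forall>f\<in>test_functions UNIV. \<forall>g\<in>test_functions UNIV. u (\<lambda>x. f x + g x) = u f + u g) \<and>
    (\<forall>u\<in>E. \<forall>f\<in>test_functions UNIV. \<forall>a. u (\<lambda>x. a * f x) = a * u f) \<and>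
    (\<forall>f\<in>test_functions UNIV. \<exists>C\<ge>0. \<forall>u\<in>E. cmod (u f) \<le> C * N u) \<and>
    (\<forall>B. \<forall>\<psi>\<in>test_functions U. \<forall>\<theta>\<in>test_functions U. \<exists>C\<ge>0. \<forall>u\<in>E. \<exists>v\<in>E.
      (\<forall>f\<in>test_functions UNIV. v f = u (frame_operator B \<Lambda> \<psi> \<theta> f)) \<and> N v \<le> C * N u)"

text \<open>The index set inside \<open>frame_operator\<close> depends on its argument; enlarging it
  to a common finite set makes several expansions comparable.\<close>

lemma frame_operator_expand:
  assumes "finite S" "S \<subseteq> \<Lambda>" "{l\<in>\<Lambda>. pairing \<phi> (twisted_translation (- B) l \<theta>) \<noteq> 0} \<subseteq> S"
  shows "frame_operator B \<Lambda> \<theta> \<psi> \<phi> = (\<lambda>t. \<Sum>l\<in>S. pairing \<phi> (twisted_translation (- B) l \<theta>) * twisted_translation B l \<psi> t)"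
  using assms(3) by (intro frame_operator_eq assms(1,2)) blast

lemma twisted_continuous:
  assumes "\<psi> \<in> test_functions U" shows "continuous_on UNIV (twisted_translation B l \<psi>)"
  by (rule smooth_continuous[OF test_functions_smooth[OF test_functions_twisted[OF assms]]])

lemma frame_operator_diff:
  assumes f: "f \<in> test_functions UNIV" and g: "g \<in> test_functions UNIV"
    and \<theta>: "\<theta> \<in> test_functions U" and \<psi>: "\<psi> \<in> test_functions U"
  shows "frame_operator B \<Lambda> \<theta> \<psi> (\<lambda>x. f x - g x) = (\<lambda>t. frame_operator B \<Lambda> \<theta> \<psi> f t - frame_operator B \<Lambda> \<theta> \<psi> g t)"
proof -
  let ?T = "\<lambda>f. {l\<in>\<Lambda>. pairing f (twisted_translation (- B) l \<theta>) \<noteq> 0}"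
  define S where "S = ?T f \<union> ?T g \<union> ?T (\<lambda>x. f x - g x)"
  have S: "finite S" "S \<subseteq> \<Lambda>"
    unfolding S_def using finite_coefficients[OF _ \<theta>] f g test_functions_diff[OF f g] by auto
  have d: "pairing (\<lambda>x. f x - g x) (twisted_translation (- B) l \<theta>) =
      pairing f (twisted_translation (- B) l \<theta>) - pairing g (twisted_translation (- B) l \<theta>)" for l
    using pairing_add[OF f test_functions_cmult[OF g, of "-1"] twisted_continuous[OF \<theta>, of "- B" l]]
    by simp
  have "frame_operator B \<Lambda> \<theta> \<psi> (\<lambda>x. f x - g x) =
      (\<lambda>t. \<Sum>l\<in>S. pairing (\<lambda>x. f x - g x) (twisted_translation (- B) l \<theta>) * twisted_translation B l \<psi> t)"
    by (rule frame_operator_expand[OF S]) (auto simp: S_def)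
  then have "frame_operator B \<Lambda> \<theta> \<psi> (\<lambda>x. f x - g x) =
      (\<lambda>t. \<Sum>l\<in>S. pairing f (twisted_translation (- B) l \<theta>) * twisted_translation B l \<psi> t -
        pairing g (twisted_translation (- B) l \<theta>) * twisted_translation B l \<psi> t)"
    unfolding d by (simp only: left_diff_distrib)
  moreover have "frame_operator B \<Lambda> \<theta> \<psi> f = (\<lambda>t. \<Sum>l\<in>S. pairing f (twisted_translation (- B) l \<theta>) * twisted_translation B l \<psi> t)"
    by (rule frame_operator_expand[OF S]) (auto simp: S_def)
  moreover have "frame_operator B \<Lambda> \<theta> \<psi> g = (\<lambda>t. \<Sum>l\<in>S. pairing g (twisted_translation (- B) l \<theta>) * twisted_translation B l \<psi> t)"
    by (rule frame_operator_expand[OF S]) (auto simp: S_def)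
  ultimately show ?thesis by (simp only: sum_subtractf)
qed

text \<open>Both sides are the sum of \<open>pairing f (twisted_translation B l \<theta>) * pairing
  (twisted_translation (- B) l \<psi>) g\<close>. Reading this from one side or the other exchanges
  the windows and the sign of \<open>B\<close>.\<close>

lemma frame_operator_adjoint:
  assumes f: "f \<in> test_functions UNIV" and g: "g \<in> test_functions UNIV"
    and \<theta>: "\<theta> \<in> test_functions U" and \<psi>: "\<psi> \<in> test_functions U"
  shows "pairing (frame_operator (- B) \<Lambda> \<theta> \<psi> f) g = pairing f (frame_operator B \<Lambda> \<psi> \<theta> g)"
proof -
  define S where "S = {l\<in>\<Lambda>. pairing f (twisted_translation (- (- B)) l \<theta>) \<noteq> 0} \<union>
    {l\<in>\<Lambda>. pairing g (twisted_translation (- B) l \<psi>) \<noteq> 0}"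
  have S: "finite S" "S \<subseteq> \<Lambda>"
    unfolding S_def using finite_coefficients[OF f \<theta>] finite_coefficients[OF g \<psi>] by auto
  have c: "continuous_on UNIV f" "continuous_on UNIV g"
    using f g test_functions_smooth smooth_continuous by blast+
  have comm: "pairing a b = pairing b a" for a b :: "real^'n \<Rightarrow> complex" by (simp add: mult.commute)
  have "frame_operator (- B) \<Lambda> \<theta> \<psi> f = (\<lambda>t. \<Sum>l\<in>S. pairing f (twisted_translation (- (- B)) l \<theta>) * twisted_translation (- B) l \<psi> t)"
    by (rule frame_operator_expand[OF S]) (auto simp: S_def)
  then have 1: "pairing (frame_operator (- B) \<Lambda> \<theta> \<psi> f) g =
      (\<Sum>l\<in>S. pairing f (twisted_translation B l \<theta>) * pairing (twisted_translation (- B) l \<psi>) g)"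
    by (simp only: pairing_sum[OF S(1) test_functions_twisted[OF \<psi>] c(2)] minus_minus)
  have "frame_operator B \<Lambda> \<psi> \<theta> g = (\<lambda>t. \<Sum>l\<in>S. pairing g (twisted_translation (- B) l \<psi>) * twisted_translation B l \<theta> t)"
    by (rule frame_operator_expand[OF S]) (auto simp: S_def)
  then have "pairing (frame_operator B \<Lambda> \<psi> \<theta> g) f =
      (\<Sum>l\<in>S. pairing g (twisted_translation (- B) l \<psi>) * pairing (twisted_translation B l \<theta>) f)"
    by (simp only: pairing_sum[OF S(1) test_functions_twisted[OF \<theta>] c(1)])
  then have "pairing f (frame_operator B \<Lambda> \<psi> \<theta> g) =
      (\<Sum>l\<in>S. pairing f (twisted_translation B l \<theta>) * pairing (twisted_translation (- B) l \<psi>) g)"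
    unfolding comm[of f] comm[of _ g] by (simp only: mult.commute)
  with 1 show ?thesis by simp
qed

text \<open>On test functions \<open>?P\<close> is bounded for the norm of \<open>E\<close>, so it
  extends along approximating sequences, and \<open>v\<close> is the value of the extension at
  \<open>u\<close>. The relation with the transpose holds for the approximants by
  \<open>frame_operator_adjoint\<close> and passes to the limit because evaluation at a test
  function is continuous.\<close>

lemma TMIB_frame_operator_extension:
  fixes B :: "real^'n^'n"
    and E :: "((real^'n \<Rightarrow> complex) \<Rightarrow> complex) set" and \<eta> :: "nat \<Rightarrow> real^'n \<Rightarrow> complex"
  assumes E: "TMIB E N" and \<eta>: "cutoff_sequence \<eta>"
    and \<theta>: "\<theta> \<in> test_functions U" and \<psi>: "\<psi> \<in> test_functions U"
  shows "\<exists>C\<ge>0. \<forall>u\<in>E. \<exists>v\<in>E. (\<forall>f\<in>test_functions UNIV. v f = u (frame_operator B \<Lambda> \<psi> \<theta> f)) \<and> N v \<le> C * N u"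
proof -
  note ban = TMIB_banach[OF E] and emb = TMIB_embed[OF E]
  let ?P = "frame_operator (- B) \<Lambda> \<theta> \<psi>"
  obtain C\<^sub>0 \<tau> where "tf_seminorm (\<lambda>f. N (schwartz_embed f)) C\<^sub>0 \<tau>"
    by (rule TMIB_tf_seminorm[OF E \<eta>]) (rule that)
  from frame_operator_bounded[OF this lattice_add lattice_minus lattice_span \<psi> \<theta>, of "- B"]
  obtain C where C: "C \<ge> 0" "\<And>f. f \<in> test_functions UNIV \<Longrightarrow> N (schwartz_embed (?P f)) \<le> C * N (schwartz_embed f)"
    by blast
  have PD: "?P f \<in> test_functions UNIV" for f by (rule frame_operator_test_function[OF \<psi>])
  have "\<exists>v\<in>E. (\<forall>f\<in>test_functions UNIV. v f = u (frame_operator B \<Lambda> \<psi> \<theta> f)) \<and> N v \<le> C * N u" if u: "u \<in> E" for u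
  proof -
    define R where "R n f \<longleftrightarrow> f \<in> test_functions UNIV \<and> N (\<lambda>x. u x - schwartz_embed f x) < inverse (real (Suc n))" for n f
    have "\<exists>f. R n f" for n
    proof -
      have "inverse (real (Suc n)) > 0" by simp
      then obtain f where "f \<in> test_functions UNIV" "N (\<lambda>x. u x - schwartz_embed f x) < inverse (real (Suc n))"
        by (rule TMIB_dense[OF E \<eta> u]) (rule that)
      then show ?thesis unfolding R_def by blast
    qed
    then obtain F where "\<And>n. R n (F n)" by metis
    then have F: "\<And>n. F n \<in> test_functions UNIV" "\<And>n. N (\<lambda>x. u x - schwartz_embed (F n) x) < inverse (real (Suc n))"
      unfolding R_def by blast+
    have conv: "(\<lambda>n. N (\<lambda>x. u x - schwartz_embed (F n) x)) \<longlonglongrightarrow> 0"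
    proof (rule tendsto_sandwich[OF _ _ tendsto_const LIMSEQ_inverse_real_of_nat])
      show "\<forall>\<^sub>F n in sequentially. 0 \<le> N (\<lambda>x. u x - schwartz_embed (F n) x)"
        using norm_onD(1)[OF ban(3) complex_subspace_diff[OF ban(2) u emb[OF F(1)]]] by simp
      show "\<forall>\<^sub>F n in sequentially. N (\<lambda>x. u x - schwartz_embed (F n) x) \<le> inverse (real (Suc n))"
        using F(2) less_imp_le by (intro always_eventually allI) blast
    qed
    define \<sigma> where "\<sigma> n = schwartz_embed (?P (F n))" for n
    have \<sigma>: "\<sigma> n \<in> E" for n unfolding \<sigma>_def by (rule emb[OF PD])
    have diff: "N (\<lambda>x. \<sigma> m x - \<sigma> n x) \<le> C * (N (\<lambda>x. u x - schwartz_embed (F m) x) + N (\<lambda>x. u x - schwartz_embed (F n) x))" for m n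
    proof -
      have "(\<lambda>x. \<sigma> m x - \<sigma> n x) = schwartz_embed (?P (\<lambda>x. F m x - F n x))"
        unfolding \<sigma>_def frame_operator_diff[OF F(1) F(1) \<theta> \<psi>] schwartz_embed_diff[OF PD PD] ..
      then have "N (\<lambda>x. \<sigma> m x - \<sigma> n x) \<le> C * N (schwartz_embed (\<lambda>x. F m x - F n x))"
        using C(2)[OF test_functions_diff[OF F(1) F(1)]] by simp
      also have "N (schwartz_embed (\<lambda>x. F m x - F n x)) \<le> N (\<lambda>x. u x - schwartz_embed (F m) x) + N (\<lambda>x. u x - schwartz_embed (F n) x)"
        unfolding schwartz_embed_diff[OF F(1) F(1)]
        using norm_on_triangle3[OF ban(2,3) emb[OF F(1)] u emb[OF F(1)], of m n]
          norm_on_diff_commute[OF ban(2,3) emb[OF F(1)] u, of m] by simp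
      finally show ?thesis using C(1) by (simp add: mult_left_mono)
    qed
    have "\<exists>n\<^sub>0. \<forall>m\<ge>n\<^sub>0. \<forall>n\<ge>n\<^sub>0. N (\<lambda>x. \<sigma> m x - \<sigma> n x) < \<epsilon>" if "\<epsilon> > 0" for \<epsilon>
    proof -
      \<comment> \<open>Makes \<open>C * (d + d)\<close> smaller than \<open>\<epsilon>\<close>,
        also for \<open>C = 0\<close>.\<close>
      define d where "d = \<epsilon> / (2 * (C + 1))"
      have d: "d > 0" "C * (d + d) < \<epsilon>"
      proof -
        show "d > 0" using that C(1) by (simp add: d_def)
        have "2 * (C + 1) * d = \<epsilon>" using C(1) by (simp add: d_def)
        then have "\<epsilon> = (C + 1) * (d + d)" by (simp add: algebra_simps)
        moreover have "C * (d + d) < (C + 1) * (d + d)" using \<open>d > 0\<close> by (intro mult_strict_right_mono) auto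
        ultimately show "C * (d + d) < \<epsilon>" by simp
      qed
      obtain n\<^sub>0 where n0: "\<And>n. n \<ge> n\<^sub>0 \<Longrightarrow> N (\<lambda>x. u x - schwartz_embed (F n) x) < d"
        using order_tendstoD(2)[OF conv d(1)] unfolding eventually_sequentially by blast
      have "N (\<lambda>x. \<sigma> m x - \<sigma> n x) < \<epsilon>" if "m \<ge> n\<^sub>0" "n \<ge> n\<^sub>0" for m n
      proof -
        have "C * (N (\<lambda>x. u x - schwartz_embed (F m) x) + N (\<lambda>x. u x - schwartz_embed (F n) x)) \<le> C * (d + d)"
          using n0[OF that(1)] n0[OF that(2)] C(1) by (intro mult_left_mono) auto
        then show ?thesis using diff[of m n] d(2) by linarith
      qed
      then show ?thesis by blast
    qed
    then obtain v where v: "v \<in> E" "(\<lambda>n. N (\<lambda>x. \<sigma> n x - v x)) \<longlonglongrightarrow> 0"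
      using complex_banach_space_iff_sequences[OF ban(2,3)] ban(1) \<sigma> by blast
    have "N v \<le> C * N u"
    proof -
      have "N v \<le> C * (N u + N (\<lambda>x. u x - schwartz_embed (F n) x)) + N (\<lambda>x. \<sigma> n x - v x)" for n
      proof -
        have "N v \<le> N (\<sigma> n) + N (\<lambda>x. v x - \<sigma> n x)" by (rule norm_on_triangle_diff[OF ban(2,3) v(1) \<sigma>])
        moreover have "N (\<lambda>x. v x - \<sigma> n x) = N (\<lambda>x. \<sigma> n x - v x)" by (rule norm_on_diff_commute[OF ban(2,3) v(1) \<sigma>])
        moreover have "N (\<sigma> n) \<le> C * N (schwartz_embed (F n))" unfolding \<sigma>_def by (rule C(2)[OF F(1)])
        moreover have "N (schwartz_embed (F n)) \<le> N u + N (\<lambda>x. u x - schwartz_embed (F n) x)"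
          using norm_on_triangle_diff[OF ban(2,3) emb[OF F(1)] u, of n] norm_on_diff_commute[OF ban(2,3) emb[OF F(1)] u, of n] by simp
        then have "C * N (schwartz_embed (F n)) \<le> C * (N u + N (\<lambda>x. u x - schwartz_embed (F n) x))"
          using C(1) by (rule mult_left_mono)
        ultimately show ?thesis by linarith
      qed
      moreover have "(\<lambda>n. C * (N u + N (\<lambda>x. u x - schwartz_embed (F n) x)) + N (\<lambda>x. \<sigma> n x - v x)) \<longlonglongrightarrow> C * (N u + 0) + 0"
        by (intro tendsto_intros conv v(2))
      ultimately show ?thesis by (intro LIMSEQ_le_const[where X = "\<lambda>n. C * (N u + N (\<lambda>x. u x - schwartz_embed (F n) x)) + N (\<lambda>x. \<sigma> n x - v x)"]) auto
    qed
    moreover have "v f = u (frame_operator B \<Lambda> \<psi> \<theta> f)" if f: "f \<in> test_functions UNIV" for f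
    proof -
      let ?g = "frame_operator B \<Lambda> \<psi> \<theta> f"
      have g: "?g \<in> test_functions UNIV" by (rule frame_operator_test_function[OF \<theta>])
      \<comment> \<open>Convergence in \<open>E\<close> implies convergence on every test function;
        this is applied to the approximants of \<open>u\<close> as well as to their images.\<close>
      have lim: "(\<lambda>n. w n h) \<longlonglongrightarrow> w' h"
        if w: "\<And>n. w n \<in> E" "w' \<in> E" "(\<lambda>n. N (\<lambda>x. w n x - w' x)) \<longlonglongrightarrow> 0" and h: "h \<in> test_functions UNIV" for w w' h
      proof -
        have "h \<in> schwartz_space" using h test_functions_subset_schwartz by blast
        then obtain K where K: "K \<ge> 0" "\<And>u. u \<in> E \<Longrightarrow> cmod (u h) \<le> K * N u"
          by (rule TMIB_evaluation_bound[OF E]) (rule that)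
        have le: "cmod (w n h - w' h) \<le> K * N (\<lambda>x. w n x - w' x)" for n
          using K(2)[OF complex_subspace_diff[OF ban(2) w(1,2)]] by simp
        have "(\<lambda>n. K * N (\<lambda>x. w n x - w' x)) \<longlonglongrightarrow> 0"
          using tendsto_mult_left[OF w(3), of K] by simp
        then have "(\<lambda>n. w n h - w' h) \<longlonglongrightarrow> 0"
          by (rule Lim_null_comparison[OF always_eventually[OF allI[OF le]]])
        then show ?thesis by (rule LIM_zero_cancel)
      qed
      have "(\<lambda>n. N (\<lambda>x. schwartz_embed (F n) x - u x)) \<longlonglongrightarrow> 0"
        using conv norm_on_diff_commute[OF ban(2,3) emb[OF F(1)] u] by simp
      then have "(\<lambda>n. schwartz_embed (F n) ?g) \<longlonglongrightarrow> u ?g" by (intro lim emb F(1) u g)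
      moreover have "\<sigma> n f = schwartz_embed (F n) ?g" for n
        unfolding \<sigma>_def schwartz_embed_test_function[OF f] schwartz_embed_test_function[OF g]
        by (rule frame_operator_adjoint[OF F(1) f \<theta> \<psi>])
      moreover have "(\<lambda>n. \<sigma> n f) \<longlonglongrightarrow> v f" by (intro lim \<sigma> v f)
      ultimately show ?thesis using LIMSEQ_unique by simp
    qed
    ultimately show ?thesis using v(1) by blast
  qed
  then show ?thesis using C(1) by blast
qed

lemma TMIB_admissible:
  fixes E :: "((real^'n \<Rightarrow> complex) \<Rightarrow> complex) set" and \<eta> :: "nat \<Rightarrow> real^'n \<Rightarrow> complex"
  assumes E: "TMIB E N" and \<eta>: "cutoff_sequence \<eta>"
  shows "admissible E N"
  unfolding admissible_def
proof (intro conjI allI ballI)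
  fix u and f g :: "real^'n \<Rightarrow> complex" and a assume u: "u \<in> E" and f: "f \<in> test_functions UNIV"
  then have fS: "f \<in> schwartz_space" using test_functions_subset_schwartz by blast
  show "u (\<lambda>x. a * f x) = a * u f" by (rule TMIB_linear(2)[OF E u fS fS])
  assume "g \<in> test_functions UNIV"
  then have "g \<in> schwartz_space" using test_functions_subset_schwartz by blast
  then show "u (\<lambda>x. f x + g x) = u f + u g" by (rule TMIB_linear(1)[OF E u fS])
next
  fix f :: "real^'n \<Rightarrow> complex" assume "f \<in> test_functions UNIV"
  then have fS: "f \<in> schwartz_space" using test_functions_subset_schwartz by blast
  obtain C where "C \<ge> 0" "\<And>u. u \<in> E \<Longrightarrow> cmod (u f) \<le> C * N u"
    by (rule TMIB_evaluation_bound[OF E fS]) (rule that)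
  then show "\<exists>C\<ge>0. \<forall>u\<in>E. cmod (u f) \<le> C * N u" by blast
qed (use TMIB_banach(1)[OF E] TMIB_inj[OF E \<eta>] TMIB_frame_operator_extension[OF E \<eta>] in auto)

end

section \<open>Dual spaces\<close>

context
  fixes V :: "('a \<Rightarrow> complex) set" and N
  assumes sub: "complex_subspace V" and norm: "norm_on V N"
begin

lemma dual_space_iff:
  "L \<in> dual_space V N \<longleftrightarrow> linear_functional V L \<and> (\<exists>C\<ge>0. \<forall>u\<in>V. cmod (L u) \<le> C * N u)"
proof
  assume L: "L \<in> dual_space V N"
  then have lin: "linear_functional V L" by (simp add: dual_space_def)
  have cont: "continuous_map (norm_topology V N) euclidean L" using L by (simp add: dual_space_def)
  have "(\<lambda>x. 0) = (\<lambda>x. 0 * (0 :: complex))" by simp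
  then have "L (\<lambda>x. 0) = 0"
    using linear_functionalD(2)[OF lin complex_subspaceD(1)[OF sub], of 0] by simp
  then have L0: "L (\<lambda>x. 0) \<in> ball 0 1" by simp
  have op: "openin euclidean (ball (0::complex) 1)" using open_ball by (simp only: open_openin)
  obtain \<delta> where \<delta>: "\<delta> > 0" "\<And>u. u \<in> V \<Longrightarrow> N u < \<delta> \<Longrightarrow> L u \<in> ball 0 1"
    by (rule continuous_norm_topology_at_zero[OF sub norm cont op L0]) (rule that)
  have "cmod (L u) \<le> 2 / \<delta> * N u" if "u \<in> V" for u
  proof (rule homogeneous_bound[OF sub norm _ \<delta>(1) _ that, where p = "\<lambda>u. cmod (L u)"])
    show "cmod (L (\<lambda>x. a * u x)) = cmod a * cmod (L u)" if "u \<in> V" for a u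
      using linear_functionalD(2)[OF lin that] by (simp add: norm_mult)
    show "cmod (L u) < 1" if "u \<in> V" "N u < \<delta>" for u using \<delta>(2)[OF that] by simp
  qed
  then show "linear_functional V L \<and> (\<exists>C\<ge>0. \<forall>u\<in>V. cmod (L u) \<le> C * N u)"
    using lin \<delta>(1) by (intro conjI exI[of _ "2 / \<delta>"]) auto
next
  assume L: "linear_functional V L \<and> (\<exists>C\<ge>0. \<forall>u\<in>V. cmod (L u) \<le> C * N u)"
  then obtain C where "\<And>u. u \<in> V \<Longrightarrow> cmod (L u) \<le> C * N u" by blast
  then show "L \<in> dual_space V N"
    using bounded_linear_continuous_norm_topology[OF sub norm] L unfolding dual_space_def by blast
qed

lemma dual_norm_le:
  assumes "C \<ge> 0" "\<And>u. u \<in> V \<Longrightarrow> cmod (L u) \<le> C * N u"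
  shows "dual_norm V N L \<le> C"
  unfolding dual_norm_def
proof (rule cSUP_least)
  have "N (\<lambda>x. 0) = 0" using norm_onD(2)[OF norm complex_subspaceD(1)[OF sub]] by simp
  then show "{u \<in> V. N u \<le> 1} \<noteq> {}" using complex_subspaceD(1)[OF sub] by auto
  fix u assume u: "u \<in> {u \<in> V. N u \<le> 1}"
  then have "cmod (L u) \<le> C * N u" using assms(2) by blast
  also have "\<dots> \<le> C * 1" using u assms(1) by (intro mult_left_mono) auto
  finally show "cmod (L u) \<le> C" by simp
qed

lemma dual_norm_bound:
  assumes L: "L \<in> dual_space V N" and u: "u \<in> V"
  shows "cmod (L u) \<le> dual_norm V N L * N u" "0 \<le> dual_norm V N L"
proof -
  obtain C where C: "C \<ge> 0" "\<And>u. u \<in> V \<Longrightarrow> cmod (L u) \<le> C * N u" and lin: "linear_functional V L"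
    using L dual_space_iff by blast
  have bdd: "bdd_above ((\<lambda>u. cmod (L u)) ` {u \<in> V. N u \<le> 1})"
  proof (rule bdd_aboveI2)
    fix u assume u: "u \<in> {u \<in> V. N u \<le> 1}"
    then have "cmod (L u) \<le> C * N u" using C(2) by blast
    also have "\<dots> \<le> C * 1" using u C(1) by (intro mult_left_mono) auto
    finally show "cmod (L u) \<le> C" by simp
  qed
  have up: "cmod (L u) \<le> dual_norm V N L" if "u \<in> V" "N u \<le> 1" for u
    unfolding dual_norm_def using bdd that by (intro cSUP_upper) auto
  have 0: "(\<lambda>x. 0) \<in> V" "N (\<lambda>x. 0) = 0"
    using complex_subspaceD(1)[OF sub] norm_onD(2)[OF norm complex_subspaceD(1)[OF sub]] by simp_all
  show nn: "0 \<le> dual_norm V N L" using order_trans[OF norm_ge_zero up[OF 0(1)]] 0(2) by simp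
  show "cmod (L u) \<le> dual_norm V N L * N u"
  proof (cases "N u = 0")
    case True
    then show ?thesis using C(2)[OF u] by simp
  next
    case False
    then have pos: "N u > 0" using norm_onD(1)[OF norm u] by simp
    define c where "c = complex_of_real (1 / N u)"
    have "N (\<lambda>x. c * u x) = 1" using norm_onD(3)[OF norm u, of c] pos by (simp add: c_def norm_divide)
    then have "cmod (L (\<lambda>x. c * u x)) \<le> dual_norm V N L" by (intro up complex_subspaceD(3)[OF sub u]) simp
    moreover have "cmod (L (\<lambda>x. c * u x)) = 1 / N u * cmod (L u)"
      unfolding linear_functionalD(2)[OF lin u] norm_mult using pos by (simp add: c_def norm_divide)
    ultimately show ?thesis using pos by (simp add: field_simps)
  qed
qed

lemma dual_space_subspace: "complex_subspace (dual_space V N)"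
  unfolding complex_subspace_def
proof (intro conjI ballI allI)
  show "(\<lambda>x. 0) \<in> dual_space V N"
    unfolding dual_space_iff by (auto simp: linear_functional_def intro: exI[of _ 0])
  fix L M assume L: "L \<in> dual_space V N"
  then obtain C where C: "C \<ge> 0" "\<And>u. u \<in> V \<Longrightarrow> cmod (L u) \<le> C * N u" and lL: "linear_functional V L"
    using dual_space_iff by blast
  show "(\<lambda>x. a * L x) \<in> dual_space V N" for a
    unfolding dual_space_iff
  proof (intro conjI exI[of _ "cmod a * C"] ballI)
    show "linear_functional V (\<lambda>x. a * L x)"
      using lL by (simp add: linear_functional_def algebra_simps)
    show "cmod (a * L u) \<le> cmod a * C * N u" if "u \<in> V" for u
      using mult_left_mono[OF C(2)[OF that], of "cmod a"] by (simp add: norm_mult mult.assoc)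
  qed (use C in simp)
  assume M: "M \<in> dual_space V N"
  then obtain D where D: "D \<ge> 0" "\<And>u. u \<in> V \<Longrightarrow> cmod (M u) \<le> D * N u" and lM: "linear_functional V M"
    using dual_space_iff by blast
  show "(\<lambda>x. L x + M x) \<in> dual_space V N"
    unfolding dual_space_iff
  proof (intro conjI exI[of _ "C + D"] ballI)
    show "linear_functional V (\<lambda>x. L x + M x)"
      using lL lM by (simp add: linear_functional_def algebra_simps)
    show "cmod (L u + M u) \<le> (C + D) * N u" if "u \<in> V" for u
      using norm_triangle_ineq[of "L u" "M u"] C(2)[OF that] D(2)[OF that] by (simp add: ring_distribs)
  qed (use C D in simp)
qed

lemma dual_norm_norm_on: "norm_on (dual_space V N) (dual_norm V N)"
proof -
  have scale: "dual_norm V N (\<lambda>x. a * L x) \<le> cmod a * dual_norm V N L" if L: "L \<in> dual_space V N" for a L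
  proof (rule dual_norm_le)
    show "0 \<le> cmod a * dual_norm V N L" using dual_norm_bound(2)[OF L complex_subspaceD(1)[OF sub]] by simp
    show "cmod (a * L u) \<le> cmod a * dual_norm V N L * N u" if "u \<in> V" for u
      using mult_left_mono[OF dual_norm_bound(1)[OF L that], of "cmod a"] by (simp add: norm_mult mult.assoc)
  qed
  show ?thesis
    unfolding norm_on_def
  proof (intro conjI ballI allI)
    fix L assume L: "L \<in> dual_space V N"
    then have lin: "linear_functional V L" using dual_space_iff by blast
    show nn: "0 \<le> dual_norm V N L" by (rule dual_norm_bound(2)[OF L complex_subspaceD(1)[OF sub]])
    show "dual_norm V N L = 0 \<longleftrightarrow> L = (\<lambda>x. 0)"
    proof
      assume 0: "dual_norm V N L = 0"
      have "L u = 0" for u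
        using dual_norm_bound(1)[OF L, of u] linear_functionalD(3)[OF lin, of u] 0 by (cases "u \<in> V") auto
      then show "L = (\<lambda>x. 0)" by auto
    next
      assume "L = (\<lambda>x. 0)"
      then show "dual_norm V N L = 0" using dual_norm_le[of 0 L] nn by simp
    qed
    show "dual_norm V N (\<lambda>x. a * L x) = cmod a * dual_norm V N L" for a
    proof (cases "a = 0")
      case True
      have "dual_norm V N (\<lambda>x. 0) = 0"
        using dual_norm_le[of 0 "\<lambda>x. 0"] dual_norm_bound(2)[OF complex_subspaceD(1)[OF dual_space_subspace] complex_subspaceD(1)[OF sub]]
        by simp
      then show ?thesis using True by simp
    next
      case False
      \<comment> \<open>The reverse inequality is the first one applied to the factor
        \<open>inverse a\<close>.\<close>
      have "dual_norm V N (\<lambda>x. inverse a * (a * L x)) \<le> cmod (inverse a) * dual_norm V N (\<lambda>x. a * L x)"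
        by (rule scale[OF complex_subspaceD(3)[OF dual_space_subspace L]])
      moreover have "(\<lambda>x. inverse a * (a * L x)) = L" using False by (simp add: mult.assoc[symmetric])
      ultimately have "cmod a * dual_norm V N L \<le> dual_norm V N (\<lambda>x. a * L x)"
        using False by (simp add: norm_divide field_simps)
      then show ?thesis using scale[OF L, of a] by simp
    qed
    fix M assume M: "M \<in> dual_space V N"
    show "dual_norm V N (\<lambda>x. L x + M x) \<le> dual_norm V N L + dual_norm V N M"
    proof (rule dual_norm_le)
      show "0 \<le> dual_norm V N L + dual_norm V N M"
        using nn dual_norm_bound(2)[OF M complex_subspaceD(1)[OF sub]] by simp
      show "cmod (L u + M u) \<le> (dual_norm V N L + dual_norm V N M) * N u" if "u \<in> V" for u
        using norm_triangle_ineq[of "L u" "M u"] dual_norm_bound(1)[OF L that] dual_norm_bound(1)[OF M that]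
        by (simp add: ring_distribs)
    qed
  qed
qed

text \<open>Completeness of the scalars gives a pointwise limit, and the Cauchy estimate, being
  uniform relative to \<open>N u\<close>, survives passage to the limit in one index.\<close>

lemma dual_space_complete:
  assumes \<sigma>: "\<And>n. \<sigma> n \<in> dual_space V N"
    and cauchy: "\<And>\<epsilon>. \<epsilon> > 0 \<Longrightarrow> \<exists>n\<^sub>0. \<forall>m\<ge>n\<^sub>0. \<forall>n\<ge>n\<^sub>0. dual_norm V N (\<lambda>x. \<sigma> m x - \<sigma> n x) < \<epsilon>"
  shows "\<exists>L\<in>dual_space V N. (\<lambda>n. dual_norm V N (\<lambda>x. \<sigma> n x - L x)) \<longlonglongrightarrow> 0"
proof -
  have lin: "linear_functional V (\<sigma> n)" for n using \<sigma> dual_space_iff by blast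
  have diff: "cmod (\<sigma> m u - \<sigma> n u) \<le> dual_norm V N (\<lambda>x. \<sigma> m x - \<sigma> n x) * N u" if "u \<in> V" for m n u
    using dual_norm_bound(1)[OF complex_subspace_diff[OF dual_space_subspace \<sigma> \<sigma>] that] .
  have unif: "\<exists>n\<^sub>0. \<forall>m\<ge>n\<^sub>0. \<forall>n\<ge>n\<^sub>0. \<forall>u\<in>V. cmod (\<sigma> m u - \<sigma> n u) \<le> \<epsilon> * N u" if e0: "\<epsilon> > 0" for \<epsilon>
  proof -
    obtain n0 where n0: "\<And>m n. m \<ge> n0 \<Longrightarrow> n \<ge> n0 \<Longrightarrow> dual_norm V N (\<lambda>x. \<sigma> m x - \<sigma> n x) < \<epsilon>"
      using cauchy[OF e0] by blast
    have "cmod (\<sigma> m u - \<sigma> n u) \<le> \<epsilon> * N u" if "m \<ge> n0" "n \<ge> n0" "u \<in> V" for m n u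
      using diff[OF that(3), of m n] mult_right_mono[OF less_imp_le[OF n0[OF that(1,2)]] norm_onD(1)[OF norm that(3)]]
      by linarith
    then show ?thesis by blast
  qed
  have "convergent (\<lambda>n. \<sigma> n u)" if u: "u \<in> V" for u
  proof (rule Cauchy_convergent, rule CauchyI)
    fix e :: real assume "e > 0"
    define \<epsilon> where "\<epsilon> = e / (N u + 1)"
    have Nu: "N u \<ge> 0" by (rule norm_onD(1)[OF norm u])
    have "\<epsilon> > 0" using \<open>e > 0\<close> Nu by (simp add: \<epsilon>_def)
    have "\<epsilon> * N u < e"
    proof -
      have "\<epsilon> * N u < \<epsilon> * (N u + 1)" using \<open>\<epsilon> > 0\<close> by simp
      also have "\<dots> = e" using Nu by (simp add: \<epsilon>_def)
      finally show ?thesis .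
    qed
    then show "\<exists>M. \<forall>m\<ge>M. \<forall>n\<ge>M. norm (\<sigma> m u - \<sigma> n u) < e"
      using unif[OF \<open>\<epsilon> > 0\<close>] u by (meson le_less_trans)
  qed
  then have lim: "(\<lambda>n. \<sigma> n u) \<longlonglongrightarrow> lim (\<lambda>n. \<sigma> n u)" if "u \<in> V" for u
    using that convergent_LIMSEQ_iff by blast
  define L where "L u = (if u \<in> V then lim (\<lambda>n. \<sigma> n u) else 0)" for u
  have L: "(\<lambda>n. \<sigma> n u) \<longlonglongrightarrow> L u" if "u \<in> V" for u using lim[OF that] that by (simp add: L_def)
  have close: "\<exists>n\<^sub>0. \<forall>n\<ge>n\<^sub>0. \<forall>u\<in>V. cmod (\<sigma> n u - L u) \<le> \<epsilon> * N u" if e0: "\<epsilon> > 0" for \<epsilon>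
  proof -
    obtain n0 where n0: "\<And>m n u. m \<ge> n0 \<Longrightarrow> n \<ge> n0 \<Longrightarrow> u \<in> V \<Longrightarrow> cmod (\<sigma> m u - \<sigma> n u) \<le> \<epsilon> * N u"
      using unif[OF e0] by blast
    have "cmod (\<sigma> m u - L u) \<le> \<epsilon> * N u" if "m \<ge> n0" "u \<in> V" for m u
    proof (rule LIMSEQ_le_const2)
      show "(\<lambda>n. cmod (\<sigma> m u - \<sigma> n u)) \<longlonglongrightarrow> cmod (\<sigma> m u - L u)"
        by (intro tendsto_intros L that)
      show "\<exists>k. \<forall>n\<ge>k. cmod (\<sigma> m u - \<sigma> n u) \<le> \<epsilon> * N u" using n0 that by blast
    qed
    then show ?thesis by blast
  qed
  have "linear_functional V L"
    unfolding linear_functional_def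
  proof (intro conjI ballI allI impI)
    fix u a assume u: "u \<in> V"
    have "(\<lambda>n. a * \<sigma> n u) \<longlonglongrightarrow> L (\<lambda>x. a * u x)"
      using L[OF complex_subspaceD(3)[OF sub u]] by (simp add: linear_functionalD(2)[OF lin u])
    then show "L (\<lambda>x. a * u x) = a * L u" using tendsto_mult_left[OF L[OF u]] LIMSEQ_unique by blast
    fix v assume v: "v \<in> V"
    have "(\<lambda>n. \<sigma> n u + \<sigma> n v) \<longlonglongrightarrow> L (\<lambda>x. u x + v x)"
      using L[OF complex_subspaceD(2)[OF sub u v]] by (simp add: linear_functionalD(1)[OF lin u v])
    then show "L (\<lambda>x. u x + v x) = L u + L v" using tendsto_add[OF L[OF u] L[OF v]] LIMSEQ_unique by blast
  qed (simp add: L_def)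
  moreover have "\<exists>C\<ge>0. \<forall>u\<in>V. cmod (L u) \<le> C * N u"
  proof -
    obtain n where n: "\<And>u. u \<in> V \<Longrightarrow> cmod (\<sigma> n u - L u) \<le> 1 * N u" using close[of 1] by auto
    have "cmod (L u) \<le> (dual_norm V N (\<sigma> n) + 1) * N u" if "u \<in> V" for u
      using n[OF that] dual_norm_bound(1)[OF \<sigma> that, of n] norm_triangle_sub[of "L u" "\<sigma> n u"]
      by (simp add: ring_distribs norm_minus_commute)
    then show ?thesis
      using dual_norm_bound(2)[OF \<sigma> complex_subspaceD(1)[OF sub], of n]
      by (intro exI[of _ "dual_norm V N (\<sigma> n) + 1"]) auto
  qed
  ultimately have LD: "L \<in> dual_space V N" using dual_space_iff by blast
  have "(\<lambda>n. dual_norm V N (\<lambda>x. \<sigma> n x - L x)) \<longlonglongrightarrow> 0"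
  proof (rule LIMSEQ_I)
    fix e :: real assume "e > 0"
    then obtain n0 where n0: "\<And>n u. n \<ge> n0 \<Longrightarrow> u \<in> V \<Longrightarrow> cmod (\<sigma> n u - L u) \<le> e / 2 * N u"
      using close[of "e / 2"] half_gt_zero by blast
    have "norm (dual_norm V N (\<lambda>x. \<sigma> n x - L x) - 0) < e" if "n \<ge> n0" for n
    proof -
      have "dual_norm V N (\<lambda>x. \<sigma> n x - L x) \<le> e / 2"
        using n0[OF that] \<open>e > 0\<close> by (intro dual_norm_le) auto
      moreover have "0 \<le> dual_norm V N (\<lambda>x. \<sigma> n x - L x)"
        by (rule dual_norm_bound(2)[OF complex_subspace_diff[OF dual_space_subspace \<sigma> LD] complex_subspaceD(1)[OF sub]])
      ultimately show ?thesis using \<open>e > 0\<close> by simp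
    qed
    then show "\<exists>n0. \<forall>n\<ge>n0. norm (dual_norm V N (\<lambda>x. \<sigma> n x - L x) - 0) < e" by blast
  qed
  with LD show ?thesis by blast
qed

end

section \<open>Admissibility of dual spaces\<close>

context lattice_tiling
begin

lemma admissible_eqI:
  assumes "admissible E N" "v \<in> E" "w \<in> E" "\<And>f. f \<in> test_functions UNIV \<Longrightarrow> v f = w f"
  shows "v = w"
proof -
  have "inj_on restrict_to_D E" using assms(1) by (simp add: admissible_def)
  moreover have "restrict_to_D v = restrict_to_D w" using assms(4) by (auto simp: restrict_to_D_def)
  ultimately show ?thesis using assms(2,3) by (simp add: inj_on_eq_iff)
qed

text \<open>Density of test functions in the predual \<open>E0\<close> makes
  \<open>dual_embed\<close> injective, so the Banach structure of the dual carries over. The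
  operator on \<open>E\<close> is composition with the extended frame operator \<open>Q\<close> on
  \<open>E0\<close>.\<close>

lemma DTMIB_admissible:
  fixes E :: "((real^'n \<Rightarrow> complex) \<Rightarrow> complex) set" and \<eta> :: "nat \<Rightarrow> real^'n \<Rightarrow> complex"
  assumes D: "DTMIB E N" and \<eta>: "cutoff_sequence \<eta>"
  shows "admissible E N"
proof -
  obtain E0 N0 where E0: "TMIB E0 N0" and EX: "E = dual_embed ` dual_space E0 N0"
      and NX: "\<And>L. L \<in> dual_space E0 N0 \<Longrightarrow> N (dual_embed L) = dual_norm E0 N0 L"
    using D unfolding DTMIB_def by blast
  note ban = TMIB_banach[OF E0] and emb = TMIB_embed[OF E0]
  let ?X = "dual_space E0 N0"
  note subX = dual_space_subspace[OF ban(2,3)] and normX = dual_norm_norm_on[OF ban(2,3)]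
  have DS: "f \<in> schwartz_space" if "f \<in> test_functions UNIV" for f :: "real^'n \<Rightarrow> complex"
    using that test_functions_subset_schwartz by blast
  have lin: "linear_functional E0 L" if "L \<in> ?X" for L using that dual_space_iff[OF ban(2,3)] by blast
  have de: "dual_embed L f = L (schwartz_embed f)" if "f \<in> test_functions UNIV" for L and f :: "real^'n \<Rightarrow> complex"
    using DS[OF that] by (simp add: dual_embed_def)
  \<comment> \<open>Both functionals are bounded and agree on the embedded test functions, which are
    dense in \<open>E0\<close>.\<close>
  have uniq: "L = M" if L: "L \<in> ?X" and M: "M \<in> ?X" and eq: "\<And>f. f \<in> test_functions UNIV \<Longrightarrow> dual_embed L f = dual_embed M f" for L M
  proof
    fix u
    show "L u = M u"
    proof (cases "u \<in> E0")
      case False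
      then show ?thesis using linear_functionalD(3)[OF lin[OF L]] linear_functionalD(3)[OF lin[OF M]] by simp
    next
      case True
      have LM: "(\<lambda>x. L x - M x) \<in> ?X" by (rule complex_subspace_diff[OF subX L M])
      define C where "C = dual_norm E0 N0 (\<lambda>x. L x - M x)"
      have C: "C \<ge> 0" "\<And>u. u \<in> E0 \<Longrightarrow> cmod (L u - M u) \<le> C * N0 u"
        unfolding C_def using dual_norm_bound[OF ban(2,3) LM] complex_subspaceD(1)[OF ban(2)] by blast+
      have "cmod (L u - M u) \<le> 0 + e" if "e > 0" for e
      proof -
        have "e / (C + 1) > 0" using C(1) that by simp
        then obtain f where f: "f \<in> test_functions UNIV" "N0 (\<lambda>x. u x - schwartz_embed f x) < e / (C + 1)"
          by (rule TMIB_dense[OF E0 \<eta> True]) (rule that)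
        have d: "(\<lambda>x. u x - schwartz_embed f x) \<in> E0" by (rule complex_subspace_diff[OF ban(2) True emb[OF f(1)]])
        have "L (\<lambda>x. u x - schwartz_embed f x) - M (\<lambda>x. u x - schwartz_embed f x) = L u - M u"
          using linear_functional_diff[OF lin[OF L] ban(2) True emb[OF f(1)]]
            linear_functional_diff[OF lin[OF M] ban(2) True emb[OF f(1)]] eq[OF f(1)] de[OF f(1)] by simp
        then have "cmod (L u - M u) \<le> C * N0 (\<lambda>x. u x - schwartz_embed f x)" using C(2)[OF d] by simp
        also have "\<dots> \<le> C * (e / (C + 1))" using f(2) C(1) by (intro mult_left_mono) auto
        also have "\<dots> \<le> (C + 1) * (e / (C + 1))" using C(1) \<open>e / (C + 1) > 0\<close> by (intro mult_right_mono) auto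
        also have "\<dots> = e" using C(1) by simp
        finally show ?thesis by simp
      qed
      then have "cmod (L u - M u) \<le> 0" by (rule field_le_epsilon)
      then show ?thesis by simp
    qed
  qed
  have dual_embed_lin: "dual_embed (\<lambda>x. L x + M x) = (\<lambda>f. dual_embed L f + dual_embed M f)"
      "dual_embed (\<lambda>x. a * L x) = (\<lambda>f. a * dual_embed L f)"
      "dual_embed (\<lambda>x. L x - M x) = (\<lambda>f. dual_embed L f - dual_embed M f)"
      "dual_embed (\<lambda>x. 0) = (\<lambda>f. 0)"
    for L M :: "((real^'n \<Rightarrow> complex) \<Rightarrow> complex) \<Rightarrow> complex" and a
    by (auto simp: dual_embed_def fun_eq_iff)
  have subE: "complex_subspace E"
    unfolding complex_subspace_def
  proof (intro conjI ballI allI)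
    show "(\<lambda>x. 0) \<in> E" unfolding EX dual_embed_lin(4)[symmetric] by (intro imageI complex_subspaceD(1)[OF subX])
    fix u a assume "u \<in> E"
    then obtain L where L: "L \<in> ?X" "u = dual_embed L" unfolding EX by blast
    show "(\<lambda>x. a * u x) \<in> E"
      unfolding EX L(2) dual_embed_lin(2)[symmetric] by (intro imageI complex_subspaceD(3)[OF subX L(1)])
    fix v assume "v \<in> E"
    then obtain M where M: "M \<in> ?X" "v = dual_embed M" unfolding EX by blast
    show "(\<lambda>x. u x + v x) \<in> E"
      unfolding EX L(2) M(2) dual_embed_lin(1)[symmetric] by (intro imageI complex_subspaceD(2)[OF subX L(1) M(1)])
  qed
  have normE: "norm_on E N"
    unfolding norm_on_def
  proof (intro conjI ballI allI)
    fix u a assume "u \<in> E"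
    then obtain L where L: "L \<in> ?X" "u = dual_embed L" unfolding EX by blast
    show "0 \<le> N u" unfolding L(2) NX[OF L(1)] by (rule norm_onD(1)[OF normX L(1)])
    have "u = (\<lambda>x. 0) \<longleftrightarrow> L = (\<lambda>x. 0)"
      using uniq[OF L(1) complex_subspaceD(1)[OF subX]] L(2) dual_embed_lin(4) by metis
    then show "N u = 0 \<longleftrightarrow> u = (\<lambda>x. 0)" using norm_onD(2)[OF normX L(1)] NX[OF L(1)] L(2) by simp
    have "N (dual_embed (\<lambda>x. a * L x)) = cmod a * dual_norm E0 N0 L"
      unfolding NX[OF complex_subspaceD(3)[OF subX L(1)]] by (rule norm_onD(3)[OF normX L(1)])
    then show "N (\<lambda>x. a * u x) = cmod a * N u" unfolding dual_embed_lin(2) L(2) NX[OF L(1)] .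
    fix v assume "v \<in> E"
    then obtain M where M: "M \<in> ?X" "v = dual_embed M" unfolding EX by blast
    have "N (dual_embed (\<lambda>x. L x + M x)) \<le> dual_norm E0 N0 L + dual_norm E0 N0 M"
      unfolding NX[OF complex_subspaceD(2)[OF subX L(1) M(1)]] by (rule norm_onD(4)[OF normX L(1) M(1)])
    then show "N (\<lambda>x. u x + v x) \<le> N u + N v" unfolding dual_embed_lin(1) L(2) M(2) NX[OF L(1)] NX[OF M(1)] .
  qed
  have banE: "complex_banach_space E N"
    unfolding complex_banach_space_iff_sequences[OF subE normE]
  proof (intro allI impI)
    fix \<sigma> :: "nat \<Rightarrow> _" assume \<sigma>: "\<forall>n. \<sigma> n \<in> E"
      and cauchy: "\<forall>\<epsilon>>0. \<exists>n\<^sub>0. \<forall>m\<ge>n\<^sub>0. \<forall>n\<ge>n\<^sub>0. N (\<lambda>x. \<sigma> m x - \<sigma> n x) < \<epsilon>"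
    have "\<exists>L. L \<in> ?X \<and> \<sigma> n = dual_embed L" for n :: nat using \<sigma> unfolding EX by blast
    then obtain L where L: "\<And>n. L n \<in> ?X" "\<And>n. \<sigma> n = dual_embed (L n)" by metis
    have N: "N (\<lambda>x. dual_embed M x - dual_embed M' x) = dual_norm E0 N0 (\<lambda>x. M x - M' x)" if "M \<in> ?X" "M' \<in> ?X" for M M'
      using NX[OF complex_subspace_diff[OF subX that]] unfolding dual_embed_lin(3) .
    have "\<exists>M\<in>?X. (\<lambda>n. dual_norm E0 N0 (\<lambda>x. L n x - M x)) \<longlonglongrightarrow> 0"
      using cauchy unfolding L(2) N[OF L(1) L(1)] by (intro dual_space_complete[OF ban(2,3) L(1)]) blast
    then obtain M where M: "M \<in> ?X" "(\<lambda>n. dual_norm E0 N0 (\<lambda>x. L n x - M x)) \<longlonglongrightarrow> 0" by blast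
    then show "\<exists>l\<in>E. (\<lambda>n. N (\<lambda>x. \<sigma> n x - l x)) \<longlonglongrightarrow> 0"
      unfolding L(2) by (intro bexI[of _ "dual_embed M"]) (simp_all add: N[OF L(1) M(1)] EX)
  qed
  have injE: "inj_on restrict_to_D E"
  proof (rule inj_onI)
    fix u v assume u: "u \<in> E" and v: "v \<in> E" and eq: "restrict_to_D u = restrict_to_D v"
    obtain L M where LM: "L \<in> ?X" "u = dual_embed L" "M \<in> ?X" "v = dual_embed M" using u v unfolding EX by blast
    have "L = M"
    proof (rule uniq[OF LM(1,3)])
      fix f :: "real^'n \<Rightarrow> complex" assume "f \<in> test_functions UNIV"
      then show "dual_embed L f = dual_embed M f" using fun_cong[OF eq, of f] LM by (simp add: restrict_to_D_def)
    qed
    then show "u = v" using LM by simp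
  qed
  have op: "\<exists>C\<ge>0. \<forall>u\<in>E. \<exists>v\<in>E. (\<forall>f\<in>test_functions UNIV. v f = u (frame_operator B \<Lambda> \<psi> \<theta> f)) \<and> N v \<le> C * N u"
    if \<psi>: "\<psi> \<in> test_functions U" and \<theta>: "\<theta> \<in> test_functions U" for B \<psi> \<theta>
  proof -
    let ?P = "frame_operator B \<Lambda> \<psi> \<theta>" and ?Pt = "frame_operator (- B) \<Lambda> \<theta> \<psi>"
    obtain C where C: "C \<ge> 0" "\<forall>u\<in>E0. \<exists>v\<in>E0. (\<forall>f\<in>test_functions UNIV. v f = u (?Pt f)) \<and> N0 v \<le> C * N0 u"
      using TMIB_frame_operator_extension[OF E0 \<eta> \<psi> \<theta>, of "- B"] by blast
    then obtain Q where Q: "\<And>u. u \<in> E0 \<Longrightarrow> Q u \<in> E0" "\<And>u f. u \<in> E0 \<Longrightarrow> f \<in> test_functions UNIV \<Longrightarrow> Q u f = u (?Pt f)"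
        "\<And>u. u \<in> E0 \<Longrightarrow> N0 (Q u) \<le> C * N0 u"
      by metis
    \<comment> \<open>\<open>Q\<close> is picked by choice, but its values are determined by their
      action on test functions; this yields linearity of \<open>Q\<close> and its values on embedded
      functions.\<close>
    have eqI: "v = w" if "v \<in> E0" "w \<in> E0" "\<And>f. f \<in> test_functions UNIV \<Longrightarrow> v f = w f" for v w
      by (rule admissible_eqI[OF TMIB_admissible[OF E0 \<eta>] that])
    have Qadd: "Q (\<lambda>x. u x + v x) = (\<lambda>x. Q u x + Q v x)" if "u \<in> E0" "v \<in> E0" for u v
      using that by (intro eqI) (auto intro!: Q(1) complex_subspaceD(2)[OF ban(2)] simp: Q(2) complex_subspaceD(2)[OF ban(2)])
    have Qscale: "Q (\<lambda>x. a * u x) = (\<lambda>x. a * Q u x)" if "u \<in> E0" for u a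
      using that by (intro eqI) (auto intro!: Q(1) complex_subspaceD(3)[OF ban(2)] simp: Q(2) complex_subspaceD(3)[OF ban(2)])
    have PD: "?P f \<in> test_functions UNIV" "?Pt f \<in> test_functions UNIV" for f
      by (rule frame_operator_test_function[OF \<theta>], rule frame_operator_test_function[OF \<psi>])
    have Qemb: "Q (schwartz_embed f) = schwartz_embed (?P f)" if f: "f \<in> test_functions UNIV" for f
    proof (rule eqI[OF Q(1)[OF emb[OF f]] emb[OF PD(1)]])
      fix g :: "real^'n \<Rightarrow> complex" assume g: "g \<in> test_functions UNIV"
      have "pairing f (?Pt g) = pairing (?P f) g"
        using frame_operator_adjoint[OF f g \<psi> \<theta>, of "- B"] by simp
      then show "Q (schwartz_embed f) g = schwartz_embed (?P f) g"
        unfolding Q(2)[OF emb[OF f] g] schwartz_embed_test_function[OF g] schwartz_embed_test_function[OF PD(2)] .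
    qed
    have "\<exists>v\<in>E. (\<forall>f\<in>test_functions UNIV. v f = u (?P f)) \<and> N v \<le> C * N u" if u: "u \<in> E" for u
    proof -
      obtain L where L: "L \<in> ?X" "u = dual_embed L" using u unfolding EX by blast
      \<comment> \<open>The transpose of \<open>Q\<close> applied to \<open>L\<close>, extended by
        zero off \<open>E0\<close> as the encoding of functionals requires.\<close>
      define M where "M w = (if w \<in> E0 then L (Q w) else 0)" for w
      have bound: "cmod (M w) \<le> C * dual_norm E0 N0 L * N0 w" if "w \<in> E0" for w
      proof -
        have "cmod (M w) \<le> dual_norm E0 N0 L * N0 (Q w)"
          using dual_norm_bound(1)[OF ban(2,3) L(1) Q(1)[OF that]] that by (simp add: M_def)
        also have "\<dots> \<le> dual_norm E0 N0 L * (C * N0 w)"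
          using Q(3)[OF that] norm_onD(1)[OF normX L(1)] by (intro mult_left_mono) auto
        finally show ?thesis by (simp add: mult_ac)
      qed
      have nn: "0 \<le> C * dual_norm E0 N0 L" using C(1) norm_onD(1)[OF normX L(1)] by simp
      have "linear_functional E0 M"
        unfolding linear_functional_def M_def
        using linear_functionalD(1,2)[OF lin[OF L(1)]] Q(1)
        by (auto simp: Qadd Qscale complex_subspaceD(2,3)[OF ban(2)])
      then have M: "M \<in> ?X" using bound nn dual_space_iff[OF ban(2,3)] by blast
      have "dual_embed M f = u (?P f)" if f: "f \<in> test_functions UNIV" for f
        unfolding L(2) de[OF f] de[OF PD(1)] by (simp add: M_def emb[OF f] Qemb[OF f])
      moreover have "N (dual_embed M) \<le> C * N u"
        unfolding L(2) NX[OF M] NX[OF L(1)] by (rule dual_norm_le[OF ban(2,3) nn bound])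
      ultimately show ?thesis using M unfolding EX by blast
    qed
    then show ?thesis using C(1) by blast
  qed
  show ?thesis
    unfolding admissible_def
  proof (intro conjI ballI allI)
    fix u and f g :: "real^'n \<Rightarrow> complex" and a assume "u \<in> E" and f: "f \<in> test_functions UNIV"
    then obtain L where L: "L \<in> ?X" "u = dual_embed L" unfolding EX by blast
    show "u (\<lambda>x. a * f x) = a * u f"
      unfolding L(2) de[OF f] de[OF test_functions_cmult[OF f]] schwartz_embed_cmult
      by (rule linear_functionalD(2)[OF lin[OF L(1)] emb[OF f]])
    assume g: "g \<in> test_functions UNIV"
    show "u (\<lambda>x. f x + g x) = u f + u g"
      unfolding L(2) de[OF f] de[OF g] de[OF test_functions_add[OF f g]] schwartz_embed_add[OF f g]
      by (rule linear_functionalD(1)[OF lin[OF L(1)] emb[OF f] emb[OF g]])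
  next
    fix f :: "real^'n \<Rightarrow> complex" assume f: "f \<in> test_functions UNIV"
    have "cmod (u f) \<le> N0 (schwartz_embed f) * N u" if u: "u \<in> E" for u
    proof -
      obtain L where L: "L \<in> ?X" "u = dual_embed L" using u unfolding EX by blast
      show ?thesis
        unfolding L(2) de[OF f] NX[OF L(1)]
        using dual_norm_bound(1)[OF ban(2,3) L(1) emb[OF f]] by (simp add: mult.commute)
    qed
    then show "\<exists>C\<ge>0. \<forall>u\<in>E. cmod (u f) \<le> C * N u"
      using norm_onD(1)[OF ban(3) emb[OF f]] by blast
  qed (use banE injE op in auto)
qed

end

section \<open>The discrete spaces\<close>

context lattice_tiling
begin

text \<open>Only translates that meet the support of \<open>\<phi>\<close> contribute, and their
  index set does not depend on \<open>c\<close>, so sums and limits in \<open>c\<close> can be taken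
  termwise. Finite supersets are allowed in order to adjoin further indices.\<close>

lemma synthesis_finite_sum:
  assumes chi: "chi \<in> test_functions U" and \<phi>: "\<phi> \<in> test_functions UNIV"
  obtains S where "finite S" "S \<subseteq> \<Lambda>"
    "\<And>c T. finite T \<Longrightarrow> S \<subseteq> T \<Longrightarrow> T \<subseteq> \<Lambda> \<Longrightarrow>
      synthesis B \<Lambda> chi c \<phi> = (\<Sum>l\<in>T. c l * pairing (twisted_translation B l chi) \<phi>)"
proof -
  obtain R where R: "\<And>B l t. norm l > R \<Longrightarrow> \<phi> t * twisted_translation B l chi t = 0"
    by (rule pairing_eventually_zero[OF \<phi> chi]) (rule that)
  define S where "S = {l \<in> \<Lambda>. norm l \<le> R}"
  have S: "finite S" "S \<subseteq> \<Lambda>" unfolding S_def by (rule finite_bounded_part) auto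
  have "synthesis B \<Lambda> chi c \<phi> = (\<Sum>l\<in>T. c l * pairing (twisted_translation B l chi) \<phi>)"
    if T: "finite T" "S \<subseteq> T" "T \<subseteq> \<Lambda>" for c T
  proof -
    have eq: "(\<Sum>\<^sub>\<infinity>l\<in>\<Lambda>. c l * twisted_translation B l chi t) * \<phi> t = (\<Sum>l\<in>T. c l * twisted_translation B l chi t) * \<phi> t" for t
    proof (cases "\<phi> t = 0")
      case False
      have "(\<Sum>\<^sub>\<infinity>l\<in>\<Lambda>. c l * twisted_translation B l chi t) = (\<Sum>\<^sub>\<infinity>l\<in>T. c l * twisted_translation B l chi t)"
      proof (rule infsum_cong_neutral)
        fix l assume "l \<in> \<Lambda> - T"
        then have "norm l > R" using T(2) by (auto simp: S_def)
        from R[OF this, of t B] False show "c l * twisted_translation B l chi t = 0" by simp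
      qed (use T in auto)
      then show ?thesis using T(1) by simp
    qed simp
    have "synthesis B \<Lambda> chi c \<phi> = pairing (\<lambda>t. \<Sum>l\<in>T. c l * twisted_translation B l chi t) \<phi>"
      using \<phi> unfolding synthesis_def regular_distribution_def by (simp only: eq if_True)
    also have "\<dots> = (\<Sum>l\<in>T. c l * pairing (twisted_translation B l chi) \<phi>)"
      using T(1) by (intro pairing_sum test_functions_twisted[OF chi] smooth_continuous[OF test_functions_smooth[OF \<phi>]])
    finally show ?thesis .
  qed
  with S show ?thesis by (rule that)
qed

text \<open>For \<open>l = m\<close> the opposite signs of \<open>B\<close> cancel the phases;
  otherwise the supports lie in disjoint translates of \<open>U\<close>.\<close>

lemma pairing_biorthogonal:
  assumes chi: "chi \<in> test_functions U" and \<theta>: "\<theta> \<in> test_functions U"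
    and one: "pairing chi \<theta> = 1" and l: "l \<in> \<Lambda>" "m \<in> \<Lambda>"
  shows "pairing (twisted_translation B l chi) (twisted_translation (- B) m \<theta>) = (if l = m then 1 else 0)"
proof (cases "l = m")
  case True
  have w: "wave (- (B *v m)) s * wave (B *v m) s = 1" for s
    unfolding wave_freq_add[symmetric] by simp
  have "twisted_translation B l chi t * twisted_translation (- B) m \<theta> t = chi (t - m) * \<theta> (t - m)" for t
  proof -
    have "twisted_translation B l chi t * twisted_translation (- B) m \<theta> t =
        chi (t - m) * \<theta> (t - m) * (wave (- (B *v m)) (t - m) * wave (B *v m) (t - m))"
      unfolding twisted_translation_wave minus_matrix_vector minus_minus True by (simp only: ac_simps)
    then show ?thesis by (simp only: w mult_1_right)
  qed
  then have "pairing (twisted_translation B l chi) (twisted_translation (- B) m \<theta>) = (LINT t|lborel. chi (t - m) * \<theta> (t - m))"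
    by simp
  also have "\<dots> = pairing chi \<theta>"
    using lborel_integral_translate[of "\<lambda>t. chi t * \<theta> t" "- m"] chi \<theta>
    by (simp add: continuous_on_mult smooth_continuous test_functions_smooth)
  finally show ?thesis using one True by simp
next
  case False
  have z: "f t = 0" if "f \<in> test_functions U" "t \<notin> U" for f and t :: "real^'n"
    using that(1) by (rule test_functionsE) (use that(2) in blast)
  have pz: "twisted_translation B l chi t * twisted_translation (- B) m \<theta> t = 0" for t
    using translate_unique[OF l, of t] False z[OF chi, of "t - l"] z[OF \<theta>, of "t - m"]
    by (auto simp: twisted_translation_wave)
  show ?thesis unfolding pz using False by simp
qed

lemma synthesis_coefficient:
  assumes chi: "chi \<in> test_functions U" and \<theta>: "\<theta> \<in> test_functions U"
    and one: "pairing chi \<theta> = 1" and m: "m \<in> \<Lambda>"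
  shows "synthesis B \<Lambda> chi c (twisted_translation (- B) m \<theta>) = c m"
proof -
  obtain S where S: "finite S" "S \<subseteq> \<Lambda>" "\<And>c T. finite T \<Longrightarrow> S \<subseteq> T \<Longrightarrow> T \<subseteq> \<Lambda> \<Longrightarrow>
      synthesis B \<Lambda> chi c (twisted_translation (- B) m \<theta>) =
      (\<Sum>l\<in>T. c l * pairing (twisted_translation B l chi) (twisted_translation (- B) m \<theta>))"
    by (rule synthesis_finite_sum[OF chi test_functions_twisted[OF \<theta>], of B "- B" m]) (rule that)
  have T: "finite (insert m S)" "S \<subseteq> insert m S" "insert m S \<subseteq> \<Lambda>" using S m by auto
  have "synthesis B \<Lambda> chi c (twisted_translation (- B) m \<theta>) = (\<Sum>l\<in>insert m S. if l = m then c l else 0)"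
    unfolding S(3)[OF T] using T(3) m
    by (intro sum.cong refl) (auto simp: pairing_biorthogonal[OF chi \<theta> one])
  then show ?thesis using T(1) by simp
qed

lemma synthesis_linear:
  assumes chi: "chi \<in> test_functions U" and \<phi>: "\<phi> \<in> test_functions UNIV"
  shows "synthesis B \<Lambda> chi (\<lambda>l. c l + d l) \<phi> = synthesis B \<Lambda> chi c \<phi> + synthesis B \<Lambda> chi d \<phi>"
    and "synthesis B \<Lambda> chi (\<lambda>l. a * c l) \<phi> = a * synthesis B \<Lambda> chi c \<phi>"
    and "synthesis B \<Lambda> chi (\<lambda>l. c l - d l) \<phi> = synthesis B \<Lambda> chi c \<phi> - synthesis B \<Lambda> chi d \<phi>"
    and "synthesis B \<Lambda> chi (\<lambda>l. 0) \<phi> = 0"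
proof -
  obtain S where S: "finite S" "S \<subseteq> \<Lambda>" "\<And>c T. finite T \<Longrightarrow> S \<subseteq> T \<Longrightarrow> T \<subseteq> \<Lambda> \<Longrightarrow>
      synthesis B \<Lambda> chi c \<phi> = (\<Sum>l\<in>T. c l * pairing (twisted_translation B l chi) \<phi>)"
    by (rule synthesis_finite_sum[OF chi \<phi>, of B]) (rule that)
  note eq = S(3)[OF S(1) subset_refl S(2)]
  show "synthesis B \<Lambda> chi (\<lambda>l. c l + d l) \<phi> = synthesis B \<Lambda> chi c \<phi> + synthesis B \<Lambda> chi d \<phi>"
    "synthesis B \<Lambda> chi (\<lambda>l. a * c l) \<phi> = a * synthesis B \<Lambda> chi c \<phi>"
    "synthesis B \<Lambda> chi (\<lambda>l. c l - d l) \<phi> = synthesis B \<Lambda> chi c \<phi> - synthesis B \<Lambda> chi d \<phi>"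
    "synthesis B \<Lambda> chi (\<lambda>l. 0) \<phi> = 0"
    unfolding eq by (simp_all add: ring_distribs sum.distrib sum_subtractf sum_distrib_left mult.assoc)
qed

section \<open>The discrete spaces of an admissible space: Banach property and change of
  window\<close>

context
  fixes E :: "((real^'n \<Rightarrow> complex) \<Rightarrow> complex) set" and N
  assumes E: "admissible E N"
begin

lemma admissible_space: "complex_banach_space E N" "complex_subspace E" "norm_on E N" "inj_on restrict_to_D E"
  using E by (simp_all add: admissible_def complex_banach_space_def)

lemma admissible_linear:
  assumes "u \<in> E" "f \<in> test_functions UNIV"
  shows "g \<in> test_functions UNIV \<Longrightarrow> u (\<lambda>x. f x + g x) = u f + u g" "u (\<lambda>x. a * f x) = a * u f"
  using E assms by (simp_all add: admissible_def)

lemma admissible_evaluation: "f \<in> test_functions UNIV \<Longrightarrow> \<exists>C\<ge>0. \<forall>u\<in>E. cmod (u f) \<le> C * N u"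
  using E by (simp add: admissible_def)

lemma admissible_frame_operator:
  assumes "\<psi> \<in> test_functions U" "\<theta> \<in> test_functions U"
  shows "\<exists>C\<ge>0. \<forall>u\<in>E. \<exists>v\<in>E. (\<forall>f\<in>test_functions UNIV. v f = u (frame_operator B \<Lambda> \<psi> \<theta> f)) \<and> N v \<le> C * N u"
  using E assms by (simp add: admissible_def)

text \<open>Exhibiting an element of \<open>E\<close> that acts on test functions as
  \<open>synthesis\<close> does settles both membership and norm; together with
  \<open>discrete_spaceE\<close> it hides \<open>restrict_to_D\<close> and its inverse.\<close>

lemma discrete_spaceI:
  assumes "u \<in> E" "\<And>\<phi>. \<phi> \<in> test_functions UNIV \<Longrightarrow> u \<phi> = synthesis B \<Lambda> chi c \<phi>" "\<And>x. x \<notin> \<Lambda> \<Longrightarrow> c x = 0"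
  shows "c \<in> discrete_space E B \<Lambda> chi" "discrete_norm E N B \<Lambda> chi c = N u"
proof -
  have eq: "synthesis B \<Lambda> chi c = restrict_to_D u"
    using assms(2) by (auto simp: restrict_to_D_def synthesis_def regular_distribution_def)
  then show "c \<in> discrete_space E B \<Lambda> chi" using assms by (auto simp: discrete_space_def)
  show "discrete_norm E N B \<Lambda> chi c = N u"
    unfolding discrete_norm_def eq by (simp add: the_inv_into_f_f[OF admissible_space(4) assms(1)])
qed

lemma discrete_spaceE:
  assumes "c \<in> discrete_space E B \<Lambda> chi"
  obtains u where "u \<in> E" "\<And>\<phi>. \<phi> \<in> test_functions UNIV \<Longrightarrow> u \<phi> = synthesis B \<Lambda> chi c \<phi>"
    "\<And>x. x \<notin> \<Lambda> \<Longrightarrow> c x = 0" "discrete_norm E N B \<Lambda> chi c = N u"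
proof -
  obtain u where u: "u \<in> E" "synthesis B \<Lambda> chi c = restrict_to_D u" and c: "\<And>x. x \<notin> \<Lambda> \<Longrightarrow> c x = 0"
    using assms unfolding discrete_space_def by blast
  have v: "u \<phi> = synthesis B \<Lambda> chi c \<phi>" if "\<phi> \<in> test_functions UNIV" for \<phi>
    unfolding u(2) using that by (simp add: restrict_to_D_def)
  from that[OF u(1) v c] show ?thesis using discrete_spaceI(2)[OF u(1) v c] by blast
qed

text \<open>The dual window \<open>\<theta>\<close> serves definiteness: if the distribution
  vanishes, so do the coefficients read off from it.\<close>

lemma discrete_space_structure:
  assumes chi: "chi \<in> test_functions U" and \<theta>: "\<theta> \<in> test_functions U" and one: "pairing chi \<theta> = 1"
  shows "complex_subspace (discrete_space E B \<Lambda> chi)" "norm_on (discrete_space E B \<Lambda> chi) (discrete_norm E N B \<Lambda> chi)"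
proof -
  let ?V = "discrete_space E B \<Lambda> chi" and ?N = "discrete_norm E N B \<Lambda> chi"
  have zero: "(\<lambda>x. 0) \<in> ?V" "?N (\<lambda>x. 0) = N (\<lambda>x. 0)"
    by (rule discrete_spaceI[OF complex_subspaceD(1)[OF admissible_space(2)]], simp_all add: synthesis_linear(4)[OF chi])+
  have scale: "(\<lambda>x. a * c x) \<in> ?V \<and> ?N (\<lambda>x. a * c x) = cmod a * ?N c" if c: "c \<in> ?V" for a c
  proof -
    obtain u where u: "u \<in> E" "\<And>\<phi>. \<phi> \<in> test_functions UNIV \<Longrightarrow> u \<phi> = synthesis B \<Lambda> chi c \<phi>"
        "\<And>x. x \<notin> \<Lambda> \<Longrightarrow> c x = 0" "?N c = N u"
      using c by (rule discrete_spaceE) (rule that)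
    have "(\<lambda>x. a * c x) \<in> ?V" "?N (\<lambda>x. a * c x) = N (\<lambda>\<phi>. a * u \<phi>)"
      by (rule discrete_spaceI[OF complex_subspaceD(3)[OF admissible_space(2) u(1), of a]], simp_all add: synthesis_linear(2)[OF chi] u)+
    then show ?thesis using norm_onD(3)[OF admissible_space(3) u(1)] u(4) by simp
  qed
  have add: "(\<lambda>x. c x + d x) \<in> ?V \<and> ?N (\<lambda>x. c x + d x) \<le> ?N c + ?N d" if c: "c \<in> ?V" and d: "d \<in> ?V" for c d
  proof -
    obtain u where u: "u \<in> E" "\<And>\<phi>. \<phi> \<in> test_functions UNIV \<Longrightarrow> u \<phi> = synthesis B \<Lambda> chi c \<phi>"
        "\<And>x. x \<notin> \<Lambda> \<Longrightarrow> c x = 0" "?N c = N u"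
      using c by (rule discrete_spaceE) (rule that)
    obtain v where v: "v \<in> E" "\<And>\<phi>. \<phi> \<in> test_functions UNIV \<Longrightarrow> v \<phi> = synthesis B \<Lambda> chi d \<phi>"
        "\<And>x. x \<notin> \<Lambda> \<Longrightarrow> d x = 0" "?N d = N v"
      using d by (rule discrete_spaceE) (rule that)
    have "(\<lambda>x. c x + d x) \<in> ?V" "?N (\<lambda>x. c x + d x) = N (\<lambda>\<phi>. u \<phi> + v \<phi>)"
      by (rule discrete_spaceI[OF complex_subspaceD(2)[OF admissible_space(2) u(1) v(1)]], simp_all add: synthesis_linear(1)[OF chi] u v)+
    then show ?thesis using norm_onD(4)[OF admissible_space(3) u(1) v(1)] u(4) v(4) by simp
  qed
  show sub: "complex_subspace ?V"
    unfolding complex_subspace_def using zero(1) scale add by blast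
  show "norm_on ?V ?N"
    unfolding norm_on_def
  proof (intro conjI ballI allI)
    fix c assume c: "c \<in> ?V"
    obtain u where u: "u \<in> E" "\<And>\<phi>. \<phi> \<in> test_functions UNIV \<Longrightarrow> u \<phi> = synthesis B \<Lambda> chi c \<phi>"
        "\<And>x. x \<notin> \<Lambda> \<Longrightarrow> c x = 0" "?N c = N u"
      using c by (rule discrete_spaceE) (rule that)
    show "0 \<le> ?N c" unfolding u(4) by (rule norm_onD(1)[OF admissible_space(3) u(1)])
    show "?N c = 0 \<longleftrightarrow> c = (\<lambda>x. 0)"
    proof
      assume "?N c = 0"
      then have u0: "u = (\<lambda>x. 0)" using norm_onD(2)[OF admissible_space(3) u(1)] u(4) by simp
      have "c x = 0" for x
      proof (cases "x \<in> \<Lambda>")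
        case True
        show ?thesis
          using synthesis_coefficient[OF chi \<theta> one True, of B c]
            u(2)[OF test_functions_twisted[OF \<theta>], of "- B" x] u0 by simp
      qed (rule u(3))
      then show "c = (\<lambda>x. 0)" by auto
    next
      assume "c = (\<lambda>x. 0)"
      then show "?N c = 0" using zero(2) norm_onD(2)[OF admissible_space(3) complex_subspaceD(1)[OF admissible_space(2)]] by simp
    qed
    show "?N (\<lambda>x. a * c x) = cmod a * ?N c" for a using scale[OF c] by blast
    show "?N (\<lambda>x. c x + d x) \<le> ?N c + ?N d" if "d \<in> ?V" for d using add[OF c that] by blast
  qed
qed

lemma discrete_space_banach:
  assumes chi: "chi \<in> test_functions U" and \<theta>: "\<theta> \<in> test_functions U" and one: "pairing chi \<theta> = 1"
  shows "complex_banach_space (discrete_space E B \<Lambda> chi) (discrete_norm E N B \<Lambda> chi)"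
  unfolding complex_banach_space_iff_sequences[OF discrete_space_structure[OF assms]]
proof (intro allI impI)
  let ?V = "discrete_space E B \<Lambda> chi" and ?N = "discrete_norm E N B \<Lambda> chi"
  fix \<sigma> :: "nat \<Rightarrow> _" assume \<sigma>: "\<forall>n. \<sigma> n \<in> ?V"
    and cauchy: "\<forall>\<epsilon>>0. \<exists>n\<^sub>0. \<forall>m\<ge>n\<^sub>0. \<forall>n\<ge>n\<^sub>0. ?N (\<lambda>x. \<sigma> m x - \<sigma> n x) < \<epsilon>"
  define P where "P n u \<longleftrightarrow> u \<in> E \<and> (\<forall>\<phi>\<in>test_functions UNIV. u \<phi> = synthesis B \<Lambda> chi (\<sigma> n) \<phi>)" for n u
  have "\<exists>u. P n u" for n
  proof -
    obtain u where "u \<in> E" "\<And>\<phi>. \<phi> \<in> test_functions UNIV \<Longrightarrow> u \<phi> = synthesis B \<Lambda> chi (\<sigma> n) \<phi>"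
      by (rule discrete_spaceE[OF \<sigma>[rule_format, of n]]) (rule that)
    then show ?thesis unfolding P_def by blast
  qed
  then obtain u where "\<And>n. P n (u n)" by metis
  then have u: "\<And>n. u n \<in> E" "\<And>n \<phi>. \<phi> \<in> test_functions UNIV \<Longrightarrow> u n \<phi> = synthesis B \<Lambda> chi (\<sigma> n) \<phi>"
    unfolding P_def by blast+
  have out: "\<sigma> n x = 0" if "x \<notin> \<Lambda>" for n x using \<sigma> that unfolding discrete_space_def by blast
  have "?N (\<lambda>x. \<sigma> m x - \<sigma> n x) = N (\<lambda>\<phi>. u m \<phi> - u n \<phi>)" for m n
    by (rule discrete_spaceI(2)[OF complex_subspace_diff[OF admissible_space(2) u(1) u(1)]])
      (simp_all add: u(2) out synthesis_linear(3)[OF chi])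
  then have "\<forall>\<epsilon>>0. \<exists>n\<^sub>0. \<forall>m\<ge>n\<^sub>0. \<forall>n\<ge>n\<^sub>0. N (\<lambda>\<phi>. u m \<phi> - u n \<phi>) < \<epsilon>" using cauchy by simp
  then obtain v where v: "v \<in> E" "(\<lambda>n. N (\<lambda>\<phi>. u n \<phi> - v \<phi>)) \<longlonglongrightarrow> 0"
    using complex_banach_space_iff_sequences[OF admissible_space(2,3)] admissible_space(1) u(1) by blast
  have lim: "(\<lambda>n. u n \<phi>) \<longlonglongrightarrow> v \<phi>" if \<phi>: "\<phi> \<in> test_functions UNIV" for \<phi>
  proof -
    obtain C where C: "\<And>w. w \<in> E \<Longrightarrow> cmod (w \<phi>) \<le> C * N w"
      using admissible_evaluation[OF \<phi>] by blast
    have le: "cmod (u n \<phi> - v \<phi>) \<le> C * N (\<lambda>\<phi>. u n \<phi> - v \<phi>)" for n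
      using C[OF complex_subspace_diff[OF admissible_space(2) u(1) v(1)]] .
    have "(\<lambda>n. C * N (\<lambda>\<phi>. u n \<phi> - v \<phi>)) \<longlonglongrightarrow> 0"
      using tendsto_mult_left[OF v(2), of C] by simp
    then have "(\<lambda>n. u n \<phi> - v \<phi>) \<longlonglongrightarrow> 0"
      by (rule Lim_null_comparison[OF always_eventually[OF allI[OF le]]])
    then show ?thesis by (rule LIM_zero_cancel)
  qed
  \<comment> \<open>The limit distribution is tested against the functions that read off
    coefficients; since this commutes with limits, \<open>c\<close> is the pointwise limit of the
    families \<open>\<sigma> n\<close>.\<close>
  define c where "c m = (if m \<in> \<Lambda> then v (twisted_translation (- B) m \<theta>) else 0)" for m
  have c: "(\<lambda>n. \<sigma> n m) \<longlonglongrightarrow> c m" if "m \<in> \<Lambda>" for m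
    using lim[OF test_functions_twisted[OF \<theta>], of "- B" m] that
    by (simp add: c_def u(2)[OF test_functions_twisted[OF \<theta>]] synthesis_coefficient[OF chi \<theta> one that])
  have vc: "v \<phi> = synthesis B \<Lambda> chi c \<phi>" if \<phi>: "\<phi> \<in> test_functions UNIV" for \<phi>
  proof -
    obtain S where S: "finite S" "S \<subseteq> \<Lambda>" "\<And>c T. finite T \<Longrightarrow> S \<subseteq> T \<Longrightarrow> T \<subseteq> \<Lambda> \<Longrightarrow>
        synthesis B \<Lambda> chi c \<phi> = (\<Sum>l\<in>T. c l * pairing (twisted_translation B l chi) \<phi>)"
      by (rule synthesis_finite_sum[OF chi \<phi>, of B]) (rule that)
    note eq = S(3)[OF S(1) subset_refl S(2)]
    have "(\<lambda>n. synthesis B \<Lambda> chi (\<sigma> n) \<phi>) \<longlonglongrightarrow> synthesis B \<Lambda> chi c \<phi>"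
      unfolding eq using S(2) by (intro tendsto_sum tendsto_mult_right c) blast
    then show ?thesis using lim[OF \<phi>] LIMSEQ_unique unfolding u(2)[OF \<phi>] by blast
  qed
  have c0: "c x = 0" if "x \<notin> \<Lambda>" for x using that by (simp add: c_def)
  have cV: "c \<in> ?V" by (rule discrete_spaceI(1)[OF v(1) vc c0])
  have "?N (\<lambda>x. \<sigma> n x - c x) = N (\<lambda>\<phi>. u n \<phi> - v \<phi>)" for n
    by (rule discrete_spaceI(2)[OF complex_subspace_diff[OF admissible_space(2) u(1) v(1)]])
      (simp_all add: u(2) vc out c0 synthesis_linear(3)[OF chi])
  then show "\<exists>l\<in>?V. (\<lambda>n. ?N (\<lambda>x. \<sigma> n x - l x)) \<longlonglongrightarrow> 0"
    using v(2) cV by (intro bexI[of _ c]) simp_all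
qed

text \<open>The element of \<open>E\<close> belonging to \<open>chi\<close> is composed with
  \<open>?P\<close>. Expanding \<open>?P \<phi>\<close> brings in its values at the twisted
  translates of \<open>\<theta>\<close>, which are the coefficients \<open>c\<close>, so the result
  acts as the synthesis of the same \<open>c\<close> with window \<open>psi\<close>.\<close>

lemma discrete_space_window_change:
  assumes chi: "chi \<in> test_functions U" and \<theta>: "\<theta> \<in> test_functions U" and one: "pairing chi \<theta> = 1"
    and psi: "psi \<in> test_functions U"
  shows "\<exists>C\<ge>0. \<forall>c\<in>discrete_space E B \<Lambda> chi. c \<in> discrete_space E B \<Lambda> psi \<and>
    discrete_norm E N B \<Lambda> psi c \<le> C * discrete_norm E N B \<Lambda> chi c"
proof -
  let ?P = "frame_operator (- B) \<Lambda> psi \<theta>"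
  obtain C where C: "C \<ge> 0" "\<And>u. u \<in> E \<Longrightarrow> \<exists>v\<in>E. (\<forall>f\<in>test_functions UNIV. v f = u (?P f)) \<and> N v \<le> C * N u"
    using admissible_frame_operator[OF psi \<theta>, of "- B"] by blast
  have lin: "u (\<lambda>x. \<Sum>l\<in>S. a l * f l x) = (\<Sum>l\<in>S. a l * u (f l))"
    if "u \<in> E" "finite S" "\<And>l. f l \<in> test_functions UNIV" for u S a and f :: "real^'n \<Rightarrow> real^'n \<Rightarrow> complex"
    using that(2)
  proof (induction S rule: finite_induct)
    case empty
    have "u (\<lambda>x. 0 * 0) = 0 * u (\<lambda>x. 0)"
      using admissible_linear(2)[OF that(1) test_functions_zero, of 0] by simp
    then show ?case by simp
  next
    case (insert l S)
    have "u (\<lambda>x. a l * f l x + (\<Sum>l\<in>S. a l * f l x)) = u (\<lambda>x. a l * f l x) + u (\<lambda>x. \<Sum>l\<in>S. a l * f l x)"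
      by (intro admissible_linear(1)[OF that(1)] test_functions_sum test_functions_cmult that(3))
    moreover have "u (\<lambda>x. a l * f l x) = a l * u (f l)"
      by (rule admissible_linear(2)[OF that(1,3)])
    ultimately show ?case using insert by simp
  qed
  have "c \<in> discrete_space E B \<Lambda> psi \<and> discrete_norm E N B \<Lambda> psi c \<le> C * discrete_norm E N B \<Lambda> chi c"
    if c: "c \<in> discrete_space E B \<Lambda> chi" for c
  proof -
    obtain u where u: "u \<in> E" "\<And>\<phi>. \<phi> \<in> test_functions UNIV \<Longrightarrow> u \<phi> = synthesis B \<Lambda> chi c \<phi>"
        "\<And>x. x \<notin> \<Lambda> \<Longrightarrow> c x = 0" "discrete_norm E N B \<Lambda> chi c = N u"
      using c by (rule discrete_spaceE) (rule that)
    obtain v where v: "v \<in> E" "\<And>f. f \<in> test_functions UNIV \<Longrightarrow> v f = u (?P f)" "N v \<le> C * N u"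
      using C(2)[OF u(1)] by blast
    have "v \<phi> = synthesis B \<Lambda> psi c \<phi>" if \<phi>: "\<phi> \<in> test_functions UNIV" for \<phi>
    proof -
      obtain S where S: "finite S" "S \<subseteq> \<Lambda>" "\<And>c T. finite T \<Longrightarrow> S \<subseteq> T \<Longrightarrow> T \<subseteq> \<Lambda> \<Longrightarrow>
          synthesis B \<Lambda> psi c \<phi> = (\<Sum>l\<in>T. c l * pairing (twisted_translation B l psi) \<phi>)"
        by (rule synthesis_finite_sum[OF psi \<phi>, of B]) (rule that)
      \<comment> \<open>Puts the expansions of \<open>synthesis\<close> and of
        \<open>?P \<phi>\<close> over the same finite index set.\<close>
      define T where "T = S \<union> {l\<in>\<Lambda>. pairing \<phi> (twisted_translation (- (- B)) l psi) \<noteq> 0}"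
      have T: "finite T" "S \<subseteq> T" "T \<subseteq> \<Lambda>"
        unfolding T_def using S finite_coefficients[OF \<phi> psi] by auto
      have "?P \<phi> = (\<lambda>t. \<Sum>l\<in>T. pairing \<phi> (twisted_translation (- (- B)) l psi) * twisted_translation (- B) l \<theta> t)"
        by (rule frame_operator_expand[OF T(1,3)]) (auto simp: T_def)
      then have "v \<phi> = (\<Sum>l\<in>T. pairing \<phi> (twisted_translation (- (- B)) l psi) * u (twisted_translation (- B) l \<theta>))"
        unfolding v(2)[OF \<phi>] by (simp only: lin[OF u(1) T(1) test_functions_twisted[OF \<theta>]])
      also have "\<dots> = (\<Sum>l\<in>T. c l * pairing (twisted_translation B l psi) \<phi>)"
      proof (rule sum.cong[OF refl])
        fix l assume "l \<in> T"
        then have "l \<in> \<Lambda>" using T(3) by blast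
        then have "u (twisted_translation (- B) l \<theta>) = c l"
          unfolding u(2)[OF test_functions_twisted[OF \<theta>]] by (rule synthesis_coefficient[OF chi \<theta> one])
        moreover have "pairing \<phi> (twisted_translation B l psi) = pairing (twisted_translation B l psi) \<phi>"
          by (simp add: mult.commute)
        ultimately show "pairing \<phi> (twisted_translation (- (- B)) l psi) * u (twisted_translation (- B) l \<theta>) =
            c l * pairing (twisted_translation B l psi) \<phi>"
          by simp
      qed
      also have "\<dots> = synthesis B \<Lambda> psi c \<phi>" by (rule S(3)[OF T, symmetric])
      finally show ?thesis .
    qed
    from discrete_spaceI[OF v(1) this u(3)] show ?thesis using v(3) u(4) by simp
  qed
  then show ?thesis using C(1) by blast
qed

end

end

text \<open>The conjugate of \<open>chi\<close>, divided by the energy of \<open>chi\<close>, has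
  the same support and pairs with \<open>chi\<close> to 1.\<close>

lemma dual_window_exists:
  assumes "chi \<in> test_functions U - {\<lambda>t. 0}"
  obtains \<theta> where "\<theta> \<in> test_functions U" "pairing chi \<theta> = 1"
proof -
  define I where "I = (LINT t|lborel. chi t * cnj (chi t))"
  have chi: "chi \<in> test_functions U" "chi \<noteq> (\<lambda>t. 0)" using assms by auto
  have I: "I \<noteq> 0" unfolding I_def by (rule test_function_energy_pos[OF chi])
  have "(\<lambda>t. cnj (chi t)) \<in> test_functions U"
    using chi(1) by (rule test_functionsE) (auto intro!: test_functionsI smooth_cnj)
  then have "(\<lambda>t. 1 / I * cnj (chi t)) \<in> test_functions U" by (rule test_functions_cmult)
  moreover have "pairing chi (\<lambda>t. 1 / I * cnj (chi t)) = 1"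
  proof -
    have "pairing chi (\<lambda>t. 1 / I * cnj (chi t)) = (LINT t|lborel. 1 / I * (chi t * cnj (chi t)))"
      by (simp only: ac_simps)
    also have "\<dots> = 1 / I * I" unfolding I_def by (rule integral_mult_right_zero)
    finally show ?thesis using I by simp
  qed
  ultimately show ?thesis by (rule that)
qed

theorem theorem5p2:
  fixes E :: "((real^'n \<Rightarrow> complex) \<Rightarrow> complex) set"
    and N :: "((real^'n \<Rightarrow> complex) \<Rightarrow> complex) \<Rightarrow> real"
    and B :: "real^'n^'n"
    and \<Lambda> U :: "(real^'n) set"
  assumes "TMIB E N \<or> DTMIB E N"
    and "euclidean_lattice \<Lambda>"
    and "open U" and "bounded U" and "0 \<in> U"
    and "disjoint_family_on (\<lambda>l. (+) l ` U) \<Lambda>"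
  shows "(\<forall>chi \<in> test_functions U - {\<lambda>t. 0}.
            complex_banach_space (discrete_space E B \<Lambda> chi) (discrete_norm E N B \<Lambda> chi)) \<and>
         (\<forall>chi \<in> test_functions U - {\<lambda>t. 0}. \<forall>psi \<in> test_functions U - {\<lambda>t. 0}.
            discrete_space E B \<Lambda> chi = discrete_space E B \<Lambda> psi \<and>
            (\<exists>a>0. \<exists>b>0. \<forall>c \<in> discrete_space E B \<Lambda> chi.
               a * discrete_norm E N B \<Lambda> chi c \<le> discrete_norm E N B \<Lambda> psi c \<and>
               discrete_norm E N B \<Lambda> psi c \<le> b * discrete_norm E N B \<Lambda> chi c))"
proof -
  interpret lattice_tiling \<Lambda> U
    using assms(2-6) by unfold_locales (auto simp: euclidean_lattice_def)
  \<comment> \<open>The cutoffs are built from a non-zero window, so admissibility is derived in the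
    presence of one; both claims quantify over such windows.\<close>
  have adm: "admissible E N" if chi: "chi \<in> test_functions U - {\<lambda>t. 0}" for chi
  proof -
    have "chi \<in> test_functions U" "chi \<noteq> (\<lambda>t. 0)" using chi by auto
    then obtain \<eta> :: "nat \<Rightarrow> real^'n \<Rightarrow> complex" where "cutoff_sequence \<eta>"
      by (rule cutoff_sequence_exists) (rule that)
    then show ?thesis using assms(1) TMIB_admissible DTMIB_admissible by blast
  qed
  have change: "\<exists>C>0. \<forall>c\<in>discrete_space E B \<Lambda> chi. c \<in> discrete_space E B \<Lambda> psi \<and>
      discrete_norm E N B \<Lambda> psi c \<le> C * discrete_norm E N B \<Lambda> chi c"
    if chi: "chi \<in> test_functions U - {\<lambda>t. 0}" and psi: "psi \<in> test_functions U - {\<lambda>t. 0}" for chi psi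
  proof -
    obtain \<theta> where \<theta>: "\<theta> \<in> test_functions U" "pairing chi \<theta> = 1" by (rule dual_window_exists[OF chi]) (rule that)
    have chiD: "chi \<in> test_functions U" and psiD: "psi \<in> test_functions U" using chi psi by auto
    obtain C where C: "C \<ge> 0" "\<And>c. c \<in> discrete_space E B \<Lambda> chi \<Longrightarrow> c \<in> discrete_space E B \<Lambda> psi \<and>
        discrete_norm E N B \<Lambda> psi c \<le> C * discrete_norm E N B \<Lambda> chi c"
      using discrete_space_window_change[OF adm[OF chi] chiD \<theta> psiD] by blast
    \<comment> \<open>\<open>C\<close> may be zero, whereas equivalence of norms asks for positive
      constants.\<close>
    have "discrete_norm E N B \<Lambda> psi c \<le> (C + 1) * discrete_norm E N B \<Lambda> chi c" if "c \<in> discrete_space E B \<Lambda> chi" for c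
      using C(2)[OF that] norm_onD(1)[OF discrete_space_structure(2)[OF adm[OF chi] chiD \<theta>] that]
      by (simp add: ring_distribs)
    then show ?thesis using C by (intro exI[of _ "C + 1"]) auto
  qed
  show ?thesis
  proof (intro conjI ballI)
    fix chi assume chi: "chi \<in> test_functions U - {\<lambda>t. 0}"
    obtain \<theta> where \<theta>: "\<theta> \<in> test_functions U" "pairing chi \<theta> = 1" by (rule dual_window_exists[OF chi]) (rule that)
    show "complex_banach_space (discrete_space E B \<Lambda> chi) (discrete_norm E N B \<Lambda> chi)"
      using chi by (intro discrete_space_banach[OF adm[OF chi] _ \<theta>]) blast
    fix psi assume psi: "psi \<in> test_functions U - {\<lambda>t. 0}"
    obtain C where C: "C > 0" "\<And>c. c \<in> discrete_space E B \<Lambda> chi \<Longrightarrow> c \<in> discrete_space E B \<Lambda> psi \<and>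
        discrete_norm E N B \<Lambda> psi c \<le> C * discrete_norm E N B \<Lambda> chi c"
      using change[OF chi psi] by blast
    obtain C' where C': "C' > 0" "\<And>c. c \<in> discrete_space E B \<Lambda> psi \<Longrightarrow> c \<in> discrete_space E B \<Lambda> chi \<and>
        discrete_norm E N B \<Lambda> chi c \<le> C' * discrete_norm E N B \<Lambda> psi c"
      using change[OF psi chi] by blast
    show "discrete_space E B \<Lambda> chi = discrete_space E B \<Lambda> psi" using C(2) C'(2) by blast
    show "\<exists>a>0. \<exists>b>0. \<forall>c \<in> discrete_space E B \<Lambda> chi.
        a * discrete_norm E N B \<Lambda> chi c \<le> discrete_norm E N B \<Lambda> psi c \<and>
        discrete_norm E N B \<Lambda> psi c \<le> b * discrete_norm E N B \<Lambda> chi c"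
    proof -
      \<comment> \<open>The lower estimate is the change of window in the opposite direction,
        divided by its constant.\<close>
      have "1 / C' * discrete_norm E N B \<Lambda> chi c \<le> discrete_norm E N B \<Lambda> psi c \<and>
          discrete_norm E N B \<Lambda> psi c \<le> C * discrete_norm E N B \<Lambda> chi c"
        if c: "c \<in> discrete_space E B \<Lambda> chi" for c
        using C(2)[OF c] C'(2)[of c] C'(1) by (simp add: field_simps)
      moreover have "1 / C' > 0" using C'(1) by simp
      ultimately show ?thesis using C(1) by blast
    qed
  qed
qed

end
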